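(* Let $\boldsymbol{y}=\boldsymbol{X}\boldsymbol{\beta}^*+\boldsymbol{\epsilon}$ be the sub-Gaussian linear model described in the context, with $k^*$ the number of non-zero entries of $\boldsymbol{\beta}^*$, and $G,s^*,m^*$ the group quantities defined there. Let $\delta\in(0,\tfrac12)$ and $\alpha\ge2$. Below, $\lesssim$ denotes inequality up to a universal multiplicative constant. (1) (Lasso) Assume $\|\boldsymbol{X}_j\|_2\le\sqrt n$ for every column $\boldsymbol{X}_j$, $j=1,\dots,p$, and that there is a constant $\kappa^*$ such that, almost surely, $$0<\kappa^*\le\inf_{|S|\le k^*}\ \inf_{\boldsymbol{z}\in\Lambda\left(S,\frac{\alpha}{\alpha-1},\frac{\sqrt{k^*}}{\alpha-1}\right),\ \boldsymbol{z}\ne0}\ \frac{\boldsymbol{z}^T\boldsymbol{X}^T\boldsymbol{X}\boldsymbol{z}}{n\|\boldsymbol{z}\|_2^2}.$$ Let $\hat{\boldsymbol{\beta}}_1$ be a solution of $$\min_{\boldsymbol{\beta}\in\mathbb{R}^p}\ \frac1n\|\boldsymbol{y}-\boldsymbol{X}\boldsymbol{\beta}\|_2^2+\lambda\|\boldsymbol{\beta}\|_1,\qquad \lambda=24\,\alpha\,\sigma\sqrt{n^{-1}\log(2pe/k^* )\,\log(1/\delta)}.$$ Then $$\mathbb{E}\,\|\hat{\boldsymbol{\beta}}_1-\boldsymbol{\beta}^*\|_2\lesssim\frac{\alpha\sigma}{\kappa^*}\sqrt{\frac{k^*\log(p/k^* )}{n}}.$$ (2) (Group Lasso) Assume that almost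 surely $\sup_{g=1,\dots,G}\mu_{\max}(\boldsymbol{X}_g^T\boldsymbol{X}_g)\le n$, that the total size $m_0$ of the $s^*$ largest groups satisfies $m_0\le\gamma m^*$ for some $\gamma\ge1$, and that there is a constant $\kappa^*$ such that, almost surely, $$0<\kappa^*\le\inf_{|\mathcal{J}|\le s^*}\ \inf_{\boldsymbol{z}\in\Omega\left(\mathcal{J},\frac{\alpha}{\alpha-1},\frac{\sqrt{s^*}}{\alpha-1}\right),\ \boldsymbol{z}\ne0}\ \frac{\boldsymbol{z}^T\boldsymbol{X}^T\boldsymbol{X}\boldsymbol{z}}{n\|\boldsymbol{z}\|_2^2}.$$ Let $\hat{\boldsymbol{\beta}}_{L1-L2}$ be a solution of $$\min_{\boldsymbol{\beta}\in\mathbb{R}^p}\ \frac1n\|\boldsymbol{y}-\boldsymbol{X}\boldsymbol{\beta}\|_2^2+\lambda_G\sum_{g=1}^G\|\boldsymbol{\beta}_g\|_2,\qquad \lambda_G=24\,\alpha\,\sigma\sqrt{n^{-1}\log(2Ge/s^* )\,\log(2/\delta)}+4\,\alpha\,\sigma\sqrt{n^{-1}\gamma\,(s^* )^{-1}m^*}.$$ Then $$\mathbb{E}\,\|\hat{\boldsymbol{\beta}}_{L1-L2}-\boldsymbol{\beta}^*\|_2\lesssim\frac{\alpha\sigma}{\kappa^*}\sqrt{\frac{s^*\log(G/s^* )+\gamma m^*}{n}}.$$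
   Context: Model: $\boldsymbol{y}=\boldsymbol{X}\boldsymbol{\beta}^*+\boldsymbol{\epsilon}$ with $\boldsymbol{y}\in\mathbb{R}^n$, model matrix $\boldsymbol{X}\in\mathbb{R}^{n\times p}$, ground truth $\boldsymbol{\beta}^*\in\mathbb{R}^p$ with $k^*$ non-zero entries, and $\boldsymbol{\epsilon}=(\epsilon_1,\dots,\epsilon_n)$ whose entries are independent realizations of a sub-Gaussian random variable with variance (proxy) $\sigma^2$, i.e. $\mathbb{E}\,\epsilon_i=0$ and $\mathbb{E}\exp(t\epsilon_i)\le\exp(\sigma^2t^2/2)$ for all $t\in\mathbb{R}$. In the formulas for $\lambda,\lambda_G$, $e=\exp(1)$. Groups: the coefficient indexes $\{1,\dots,p\}$ are split into known disjoint groups $\mathcal{I}_1,\dots,\mathcal{I}_G$, with sizes $n_g=|\mathcal{I}_g|$. For $\boldsymbol{z}\in\mathbb{R}^p$, $\boldsymbol{z}_g$ is the restriction of $\boldsymbol{z}$ to $\mathcal{I}_g$, and $\boldsymbol{z}_S$ its restriction to an index set $S$. $\boldsymbol{X}_g\in\mathbb{R}^{n\times n_g}$ is the restriction of $\boldsymbol{X}$ to the columns in $\mathcal{I}_g$, and $\mu_{\max}$ denotes the highest eigenvalue. $\mathcal{J}^*\subset\{1,\dots,G\}$ is the smallest subset of group indexes such that the support of $\boldsymbol{\beta}^*$ is included in the union of these groups; $s^*=|\mathcal{J}^*|$; $m^*$ is the sum of the sizes of these $s^*$ groups. Cones: for $S\subset\{1,\dots,p\}$ and $\gamma_1,\gamma_2>0$,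 $$\Lambda(S,\gamma_1,\gamma_2)=\{\boldsymbol{z}\in\mathbb{R}^p:\ \|\boldsymbol{z}_{S^c}\|_1\le\gamma_1\|\boldsymbol{z}_S\|_1+\gamma_2\|\boldsymbol{z}_S\|_2\}.$$ For $\mathcal{J}\subset\{1,\dots,G\}$, $\mathcal{T}(\mathcal{J})=\cup_{g\in\mathcal{J}}\mathcal{I}_g$, and $\epsilon_1,\epsilon_2>0$ (scalars unrelated to the noise), $$\Omega(\mathcal{J},\epsilon_1,\epsilon_2)=\Big\{\boldsymbol{z}\in\mathbb{R}^p:\ \sum_{g\notin\mathcal{J}}\|\boldsymbol{z}_g\|_2\le\epsilon_1\sum_{g\in\mathcal{J}}\|\boldsymbol{z}_g\|_2+\epsilon_2\|\boldsymbol{z}_{\mathcal{T}(\mathcal{J})}\|_2\Big\}.$$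
   Formalization: The constant may depend on δ (λ grows as δ→0, the rate does not) and, in (1), on ρ>1 with p/k* ≥ ρ (at p=k* the stated rate is 0); also σ>0, k*,s*≥1, nonempty groups, random X independent of the noise, measurable estimators; constant stated per sample-space type. *)

theory Defs
  imports
    "HOL-Probability.Probability"
    "Jordan_Normal_Form.Spectral_Radius"
    "Jordan_Normal_Form.DL_Submatrix"
begin

(* From here on, $ and \<bullet> are the operations on dimension-indexed vectors ('a vec). *)
unbundle no vec_syntax
no_notation inner (infix \<open>\<bullet>\<close> 70)

section \<open>Vectors, matrices, norms\<close>

(* Coordinates are indexed from 0: {..<p} and {..<G} stand for {1,...,p} and {1,...,G}. *)

definition l1_on :: "nat set \<Rightarrow> real vec \<Rightarrow> real" where
  "l1_on S z = (\<Sum>j\<in>S. \<bar>z $ j\<bar>)"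

definition l2_on :: "nat set \<Rightarrow> real vec \<Rightarrow> real" where
  "l2_on S z = L2_set (\<lambda>j. z $ j) S"

abbreviation l1_norm :: "real vec \<Rightarrow> real" where
  "l1_norm z \<equiv> l1_on {..<dim_vec z} z"

abbreviation l2_norm :: "real vec \<Rightarrow> real" where
  "l2_norm z \<equiv> l2_on {..<dim_vec z} z"

definition supp :: "real vec \<Rightarrow> nat set" where
  "supp z = {j. j < dim_vec z \<and> z $ j \<noteq> 0}"

(* The highest eigenvalue of a real symmetric matrix of dimension at least 1; only real
   eigenvalues are considered, and for such a matrix there are finitely many and at least one. *)
definition mu_max :: "real mat \<Rightarrow> real" where
  "mu_max A = Max (spectrum A)"

definition columns_of :: "real mat \<Rightarrow> nat set \<Rightarrow> real mat" where
  "columns_of X J = submatrix X UNIV J"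

section \<open>The sub-Gaussian linear model\<close>

definition random_vec :: "'w measure \<Rightarrow> nat \<Rightarrow> ('w \<Rightarrow> real vec) \<Rightarrow> bool" where
  "random_vec M n v \<longleftrightarrow>
     (\<forall>w\<in>space M. v w \<in> carrier_vec n) \<and>
     (\<forall>i<n. (\<lambda>w. v w $ i) \<in> borel_measurable M)"

definition random_mat :: "'w measure \<Rightarrow> nat \<Rightarrow> nat \<Rightarrow> ('w \<Rightarrow> real mat) \<Rightarrow> bool" where
  "random_mat M n p X \<longleftrightarrow>
     (\<forall>w\<in>space M. X w \<in> carrier_mat n p) \<and>
     (\<forall>i<n. \<forall>j<p. (\<lambda>w. X w $$ (i, j)) \<in> borel_measurable M)"

(* Integrability is explicit because the Bochner integral of a non-integrable function is 0.
   Integrability of xi itself follows from that of the exponentials. *)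
definition sub_gaussian :: "'w measure \<Rightarrow> real \<Rightarrow> ('w \<Rightarrow> real) \<Rightarrow> bool" where
  "sub_gaussian M \<sigma> \<xi> \<longleftrightarrow>
     \<xi> \<in> borel_measurable M \<and>
     (\<integral>w. \<xi> w \<partial>M) = 0 \<and>
     (\<forall>t. integrable M (\<lambda>w. exp (t * \<xi> w)) \<and>
          (\<integral>w. exp (t * \<xi> w) \<partial>M) \<le> exp (\<sigma>\<^sup>2 * t\<^sup>2 / 2))"

(* The model matrix may be random, in which case it is independent of the noise;
   a deterministic matrix is a constant X, for which the independence holds trivially. *)
definition sub_gaussian_linear_model ::
  "'w measure \<Rightarrow> nat \<Rightarrow> nat \<Rightarrow> real \<Rightarrow> ('w \<Rightarrow> real mat) \<Rightarrow> real vec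
    \<Rightarrow> ('w \<Rightarrow> real vec) \<Rightarrow> ('w \<Rightarrow> real vec) \<Rightarrow> bool" where
  "sub_gaussian_linear_model M n p \<sigma> X \<beta> \<epsilon> y \<longleftrightarrow>
     prob_space M \<and> 0 < n \<and> 0 < \<sigma> \<and>
     random_mat M n p X \<and> \<beta> \<in> carrier_vec p \<and> random_vec M n \<epsilon> \<and>
     (\<forall>i<n. sub_gaussian M \<sigma> (\<lambda>w. \<epsilon> w $ i)) \<and>
     prob_space.indep_vars M (\<lambda>_. borel) (\<lambda>i w. \<epsilon> w $ i) {..<n} \<and>
     prob_space.indep_set M
       (sets (vimage_algebra (space M) (\<lambda>w. \<lambda>ij\<in>{..<n} \<times> {..<p}. X w $$ ij)
          (Pi\<^sub>M ({..<n} \<times> {..<p}) (\<lambda>_. borel))))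
       (sets (vimage_algebra (space M) (\<lambda>w. \<lambda>i\<in>{..<n}. \<epsilon> w $ i)
          (Pi\<^sub>M {..<n} (\<lambda>_. borel)))) \<and>
     (\<forall>w\<in>space M. y w = X w *\<^sub>v \<beta> + \<epsilon> w)"

section \<open>Groups\<close>

definition group_partition :: "nat \<Rightarrow> nat \<Rightarrow> (nat \<Rightarrow> nat set) \<Rightarrow> bool" where
  "group_partition p G I \<longleftrightarrow>
     (\<forall>g<G. I g \<noteq> {}) \<and> disjoint_family_on I {..<G} \<and> (\<Union>g<G. I g) = {..<p}"

(* LEAST is with respect to inclusion; the least element exists by disjointness of the groups. *)
definition active_groups :: "nat \<Rightarrow> (nat \<Rightarrow> nat set) \<Rightarrow> real vec \<Rightarrow> nat set" where
  "active_groups G I \<beta> = (LEAST J. J \<subseteq> {..<G} \<and> supp \<beta> \<subseteq> (\<Union>g\<in>J. I g))"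

lemma active_groups_eq:
  assumes "group_partition p G I" and "\<beta> \<in> carrier_vec p"
  shows "active_groups G I \<beta> = {g. g < G \<and> I g \<inter> supp \<beta> \<noteq> {}}"
  unfolding active_groups_def
proof (rule Least_equality)
  have "supp \<beta> \<subseteq> (\<Union>g<G. I g)"
    using assms by (auto simp: group_partition_def supp_def)
  then show "{g. g < G \<and> I g \<inter> supp \<beta> \<noteq> {}} \<subseteq> {..<G} \<and>
      supp \<beta> \<subseteq> (\<Union>g\<in>{g. g < G \<and> I g \<inter> supp \<beta> \<noteq> {}}. I g)"
    by blast
next
  fix J assume J: "J \<subseteq> {..<G} \<and> supp \<beta> \<subseteq> (\<Union>g\<in>J. I g)"
  show "{g. g < G \<and> I g \<inter> supp \<beta> \<noteq> {}} \<le> J"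
  proof
    fix g assume "g \<in> {g. g < G \<and> I g \<inter> supp \<beta> \<noteq> {}}"
    then obtain j where g: "g < G" and j: "j \<in> I g" "j \<in> supp \<beta>" by blast
    from j J obtain h where h: "h \<in> J" "j \<in> I h" by blast
    have "disjoint_family_on I {..<G}" using assms by (simp add: group_partition_def)
    with g j h J have "g = h" unfolding disjoint_family_on_def by blast
    with h show "g \<in> J" by simp
  qed
qed

definition largest_groups_size :: "nat \<Rightarrow> (nat \<Rightarrow> nat set) \<Rightarrow> nat \<Rightarrow> nat" where
  "largest_groups_size G I s = sum_list (take s (rev (sort (map (\<lambda>g. card (I g)) [0..<G]))))"

section \<open>Cones and restricted eigenvalues\<close>

definition lasso_cone :: "nat \<Rightarrow> nat set \<Rightarrow> real \<Rightarrow> real \<Rightarrow> real vec set" where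
  "lasso_cone p S \<gamma>1 \<gamma>2 =
     {z \<in> carrier_vec p. l1_on ({..<p} - S) z \<le> \<gamma>1 * l1_on S z + \<gamma>2 * l2_on S z}"

definition group_cone ::
  "nat \<Rightarrow> nat \<Rightarrow> (nat \<Rightarrow> nat set) \<Rightarrow> nat set \<Rightarrow> real \<Rightarrow> real \<Rightarrow> real vec set" where
  "group_cone p G I J e1 e2 =
     {z \<in> carrier_vec p.
        (\<Sum>g\<in>{..<G} - J. l2_on (I g) z)
          \<le> e1 * (\<Sum>g\<in>J. l2_on (I g) z) + e2 * l2_on (\<Union>g\<in>J. I g) z}"

definition design_ratio :: "nat \<Rightarrow> real mat \<Rightarrow> real vec \<Rightarrow> real" where
  "design_ratio n X z =
     (z \<bullet> ((transpose_mat X * X) *\<^sub>v z)) / (real n * (l2_norm z)\<^sup>2)"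

(* Infima are taken in ereal, so that the infimum over an empty set (the cone of S = {}
   contains only 0) is \<infinity>. *)
definition lasso_re :: "nat \<Rightarrow> nat \<Rightarrow> nat \<Rightarrow> real \<Rightarrow> real mat \<Rightarrow> ereal" where
  "lasso_re n p k \<alpha> X =
     (INF S\<in>{S. S \<subseteq> {..<p} \<and> card S \<le> k}.
       INF z\<in>lasso_cone p S (\<alpha> / (\<alpha> - 1)) (sqrt (real k) / (\<alpha> - 1)) - {0\<^sub>v p}.
         ereal (design_ratio n X z))"

definition group_lasso_re ::
  "nat \<Rightarrow> nat \<Rightarrow> nat \<Rightarrow> (nat \<Rightarrow> nat set) \<Rightarrow> nat \<Rightarrow> real \<Rightarrow> real mat \<Rightarrow> ereal" where
  "group_lasso_re n p G I s \<alpha> X =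
     (INF J\<in>{J. J \<subseteq> {..<G} \<and> card J \<le> s}.
       INF z\<in>group_cone p G I J (\<alpha> / (\<alpha> - 1)) (sqrt (real s) / (\<alpha> - 1)) - {0\<^sub>v p}.
         ereal (design_ratio n X z))"

section \<open>Estimators\<close>

definition lasso_solution ::
  "nat \<Rightarrow> nat \<Rightarrow> real \<Rightarrow> real mat \<Rightarrow> real vec \<Rightarrow> real vec \<Rightarrow> bool" where
  "lasso_solution n p l X y b \<longleftrightarrow>
     is_arg_min (\<lambda>b. 1 / real n * (l2_norm (y - X *\<^sub>v b))\<^sup>2 + l * l1_norm b)
       (\<lambda>b. b \<in> carrier_vec p) b"

definition group_lasso_solution ::
  "nat \<Rightarrow> nat \<Rightarrow> nat \<Rightarrow> (nat \<Rightarrow> nat set) \<Rightarrow> real \<Rightarrow> real mat \<Rightarrow> real vec \<Rightarrow> real vec \<Rightarrow> bool" where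
  "group_lasso_solution n p G I l X y b \<longleftrightarrow>
     is_arg_min (\<lambda>b. 1 / real n * (l2_norm (y - X *\<^sub>v b))\<^sup>2 + l * (\<Sum>g<G. l2_on (I g) b))
       (\<lambda>b. b \<in> carrier_vec p) b"

definition lasso_lambda :: "nat \<Rightarrow> nat \<Rightarrow> nat \<Rightarrow> real \<Rightarrow> real \<Rightarrow> real \<Rightarrow> real" where
  "lasso_lambda n p k \<sigma> \<alpha> \<delta> =
     24 * \<alpha> * \<sigma> * sqrt (1 / real n * ln (2 * real p * exp 1 / real k) * ln (1 / \<delta>))"

definition group_lasso_lambda ::
  "nat \<Rightarrow> nat \<Rightarrow> nat \<Rightarrow> nat \<Rightarrow> real \<Rightarrow> real \<Rightarrow> real \<Rightarrow> real \<Rightarrow> real" where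
  "group_lasso_lambda n G s m \<sigma> \<alpha> \<gamma> \<delta> =
     24 * \<alpha> * \<sigma> * sqrt (1 / real n * ln (2 * real G * exp 1 / real s) * ln (2 / \<delta>))
     + 4 * \<alpha> * \<sigma> * sqrt (1 / real n * \<gamma> * (1 / real s) * real m)"

end

theory Submission
  imports Defs
begin

text \<open>The Lasso is the Group Lasso with singleton groups, so it suffices to treat groups.

  The heart of the proof is a uniform noise bound: with \<open>r g\<close> the Euclidean norm of \<open>h\<close> on group
  \<open>g\<close>, of size \<open>n g\<close>, and \<open>L = ln (2 e G / s)\<close>, almost surely for all \<open>h\<close> simultaneously
  \<open>\<epsilon> \<bullet> X h \<le> |X h|\<^sup>2 / 4 + \<sigma> (\<Sum>g. (sqrt (2 n L) + sqrt (n * n g)) r g) + W\<close>, where the random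
  variable \<open>W \<ge> 0\<close> does not depend on \<open>h\<close> and has expectation at most \<open>\<sigma>\<^sup>2 s\<close>. For a fixed \<open>h\<close>
  the exponential moment of \<open>t (\<epsilon> \<bullet> X h) - t\<^sup>2 \<sigma>\<^sup>2 |X h|\<^sup>2 / 2\<close> is at most \<open>1\<close>; so it is after averaging
  \<open>h\<close> over a prior that mixes Gaussian vectors over geometric counts in each group. Conversely the
  average dominates the value at every \<open>h\<close> up to a cost linear in the \<open>r g\<close>: round each \<open>r g\<close>
  to a multiple of a step size, using concavity, and shift the corresponding Gaussian.

  Inserting this into the basic inequality, on the set of the \<open>s\<close> groups with largest \<open>r g\<close>, either
  \<open>W\<close> is negligible, the error lies in the cone and the restricted eigenvalue bounds it
  deterministically, or the error is bounded by a multiple of \<open>W\<close>. Integrability and the bound on the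
  expectation follow without tail estimates.\<close>

section \<open>Gaussian integrals and rounding for quadratic functions\<close>

text \<open>The obstacle: the penalty level carries one fixed \<open>\<delta>\<close>, while the
  claim concerns an expectation, and an estimate on an event of probability
  \<open>1 - \<delta>\<close> says nothing off that event. So all remaining randomness is gathered
  in \<open>W\<close>, of bounded mean. As the error vector depends on the noise, the bound must
  hold for all \<open>h\<close> at once; averaging over the prior achieves this at a cost linear in
  the group norms, hence comparable to the penalty.

  Origin of the constants: \<open>t = 1 / (2 \<sigma>^2)\<close> turns the compensator into
  \<open>1/4 |X h|^2\<close>; the basic inequality multiplies it by \<open>2 / n\<close>, so that
  half of \<open>|X h|^2 / n\<close> survives. The geometric ratio
  \<open>\<theta> = exp (- L) = s / (2 e G)\<close> makes one count cost \<open>L\<close>, while the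
  normalisation \<open>(1 - \<theta>)^G\<close> costs only \<open>s / 2\<close>; with
  \<open>ln z \<le> z - 1\<close> this gives the mean of \<open>W\<close>. After the factor
  \<open>2 / n\<close> the noise takes \<open>3/4\<close> of \<open>lam / \<alpha>\<close>, and the
  last quarter is the slack that absorbs \<open>W\<close>.\<close>

definition lin :: "nat \<Rightarrow> (nat \<Rightarrow> nat \<Rightarrow> real) \<Rightarrow> (nat \<Rightarrow> real) \<Rightarrow> nat \<Rightarrow> real" where
  "lin p A h i = (\<Sum>j<p. A i j * h j)"

text \<open>With \<open>K = t^2 * \<sigma>^2\<close>, \<open>A\<close> the design and
  \<open>b\<close> equal to \<open>t\<close> times the transposed design applied to the noise, this
  is the exponent of the compensated exponential moment. Vectors are plain functions here, which
  suits product measures and function update.\<close>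

definition quad :: "nat \<Rightarrow> nat \<Rightarrow> real \<Rightarrow> (nat \<Rightarrow> nat \<Rightarrow> real) \<Rightarrow> (nat \<Rightarrow> real) \<Rightarrow> (nat \<Rightarrow> real) \<Rightarrow> real" where
  "quad n p K A b h = (\<Sum>j<p. b j * h j) - K / 2 * (\<Sum>i<n. (lin p A h i)\<^sup>2)"

lemma lin_cong: "(\<And>j. j < p \<Longrightarrow> h j = h' j) \<Longrightarrow> lin p A h i = lin p A h' i"
  unfolding lin_def by (intro sum.cong) auto

lemma quad_cong: "(\<And>j. j < p \<Longrightarrow> h j = h' j) \<Longrightarrow> quad n p K A b h = quad n p K A b h'"
  unfolding quad_def using lin_cong[of p h h'] by (auto intro!: sum.cong arg_cong2[of _ _ _ _ "(-)"])

lemma sum_fun_upd: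
  fixes f :: "nat \<Rightarrow> real"
  assumes "j < p"
  shows "(\<Sum>i<p. f i * (h(j := x)) i) = (\<Sum>i<p. f i * (h(j := 0)) i) + f j * x"
proof -
  have "(\<Sum>i<p. f i * (h(j := x)) i) = f j * x + (\<Sum>i\<in>{..<p} - {j}. f i * h i)" for x
    using assms by (subst sum.remove[of _ j]) (auto intro!: sum.cong)
  from this[of x] this[of 0] show ?thesis by simp
qed

text \<open>Only the curvature is spelled out, since it alone enters the costs. It is free of the
  other coordinates, so losses incurred coordinate by coordinate simply add up.\<close>

lemma quad_fun_upd:
  assumes j: "j < p"
  shows "\<exists>\<alpha> \<beta>. \<forall>x.
    quad n p K A b (h(j := x)) = \<alpha> + \<beta> * x - K * (\<Sum>i<n. (A i j)\<^sup>2) / 2 * x\<^sup>2"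
proof (intro exI allI)
  fix x
  let ?h = "h(j := 0)"
  have l: "lin p A (h(j := x)) i = lin p A ?h i + A i j * x" for i
    unfolding lin_def by (rule sum_fun_upd[OF j])
  have "(\<Sum>i<n. (lin p A (h(j := x)) i)\<^sup>2) =
      (\<Sum>i<n. (lin p A ?h i)\<^sup>2) + 2 * x * (\<Sum>i<n. lin p A ?h i * A i j) + (\<Sum>i<n. (A i j)\<^sup>2) * x\<^sup>2"
    unfolding l power2_sum sum.distrib
    by (simp add: sum_distrib_left sum_distrib_right power_mult_distrib algebra_simps)
  then show "quad n p K A b (h(j := x)) =
      ((\<Sum>i<p. b i * ?h i) - K / 2 * (\<Sum>i<n. (lin p A ?h i)\<^sup>2))
      + (b j - K * (\<Sum>i<n. lin p A ?h i * A i j)) * x - K * (\<Sum>i<n. (A i j)\<^sup>2) / 2 * x\<^sup>2"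
    unfolding quad_def sum_fun_upd[OF j, of b h x] by (simp add: algebra_simps)
qed

section \<open>Averages of exponentials of quadratics over a standard Gaussian vector\<close>

abbreviation std_normal :: "real measure" where
  "std_normal \<equiv> density lborel std_normal_density"

text \<open>This is the Gibbs variational inequality for the shifted law \<open>N(u, 1)\<close>: the
  mean of the quadratic under it is its value at \<open>u\<close> minus \<open>D / 2\<close>, and
  its relative entropy to \<open>N(0, 1)\<close> is \<open>u^2 / 2\<close>. Here it is read off the
  exact value of the integral, found by completing the square.\<close>

lemma gaussian_integral_exp_quadratic:
  assumes D: "D \<ge> 0"
  shows "ennreal (exp (\<alpha> + \<beta> * u - D / 2 * u\<^sup>2 - (D + u\<^sup>2) / 2))
    \<le> (\<integral>\<^sup>+x. ennreal (exp (\<alpha> + \<beta> * x - D / 2 * x\<^sup>2)) \<partial>std_normal)"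
proof -
  define E where "E = 1 + D"
  have E: "E \<ge> 1" using D by (simp add: E_def)
  define c where "c = exp (\<alpha> + \<beta>\<^sup>2 / (2 * E)) / sqrt E"
  have c0: "c \<ge> 0" using E by (simp add: c_def)
  have eq: "std_normal_density x * exp (\<alpha> + \<beta> * x - D / 2 * x\<^sup>2) = c * normal_density (\<beta> / E) (1 / sqrt E) x" for x
  proof -
    have s: "(1 / sqrt E)\<^sup>2 = 1 / E" using E by (simp add: power_divide)
    have "- x\<^sup>2 / 2 + (\<alpha> + \<beta> * x - D / 2 * x\<^sup>2) = \<alpha> + \<beta> * x - E / 2 * x\<^sup>2"
      by (simp add: E_def field_simps)
    also have "\<dots> = \<alpha> + \<beta>\<^sup>2 / (2 * E) - (x - \<beta> / E)\<^sup>2 / (2 * (1 / E))"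
      using E by (simp add: power2_eq_square field_simps)
    finally have e: "- x\<^sup>2 / 2 + (\<alpha> + \<beta> * x - D / 2 * x\<^sup>2) = \<alpha> + \<beta>\<^sup>2 / (2 * E) - (x - \<beta> / E)\<^sup>2 / (2 * (1 / E))" .
    have "std_normal_density x * exp (\<alpha> + \<beta> * x - D / 2 * x\<^sup>2)
      = 1 / sqrt (2 * pi) * exp (- x\<^sup>2 / 2 + (\<alpha> + \<beta> * x - D / 2 * x\<^sup>2))"
      by (simp only: std_normal_density_def exp_add mult.assoc)
    also have "\<dots> = 1 / sqrt (2 * pi) * (exp (\<alpha> + \<beta>\<^sup>2 / (2 * E)) * exp (- (x - \<beta> / E)\<^sup>2 / (2 * (1 / E))))"
      unfolding e diff_conv_add_uminus[of "\<alpha> + \<beta>\<^sup>2 / (2 * E)"] exp_add by simp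
    also have "\<dots> = c * normal_density (\<beta> / E) (1 / sqrt E) x"
      unfolding normal_density_def s c_def using E by (simp add: real_sqrt_divide real_sqrt_mult)
    finally show ?thesis .
  qed
  have "(\<integral>\<^sup>+x. ennreal (exp (\<alpha> + \<beta> * x - D / 2 * x\<^sup>2)) \<partial>std_normal)
      = (\<integral>\<^sup>+x. ennreal (c * normal_density (\<beta> / E) (1 / sqrt E) x) \<partial>lborel)"
    by (subst nn_integral_density) (auto simp: eq[symmetric] ennreal_mult'')
  also have "\<dots> = ennreal c"
    using E c0 by (subst nn_integral_eq_integral) auto
  finally have int: "(\<integral>\<^sup>+x. ennreal (exp (\<alpha> + \<beta> * x - D / 2 * x\<^sup>2)) \<partial>std_normal) = ennreal c" .
  \<comment> \<open>Two losses against the exact value \<open>c\<close>: the maximum of a parabola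
    is replaced by its value at \<open>u\<close>, and \<open>sqrt (1 + D)\<close> by
    \<open>exp (D / 2)\<close>.\<close>
  have "0 \<le> (\<beta> - E * u)\<^sup>2 / (2 * E)" using E by simp
  also have "\<dots> = \<beta>\<^sup>2 / (2 * E) - \<beta> * u + E * u\<^sup>2 / 2"
    using E by (simp add: power2_eq_square field_simps)
  finally have q: "\<beta> * u - E * u\<^sup>2 / 2 \<le> \<beta>\<^sup>2 / (2 * E)" by simp
  have "sqrt E \<le> sqrt (exp D)" using exp_ge_add_one_self[of D] by (simp add: E_def)
  also have "\<dots> = exp (D / 2)" by (rule real_sqrt_unique) (auto simp: power2_eq_square exp_add[symmetric])
  finally have s: "sqrt E \<le> exp (D / 2)" .
  have "exp (\<alpha> + \<beta> * u - D / 2 * u\<^sup>2 - (D + u\<^sup>2) / 2) = exp (\<alpha> + (\<beta> * u - E * u\<^sup>2 / 2)) / exp (D / 2)"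
    by (simp add: E_def exp_diff[symmetric] field_simps)
  also have "\<dots> \<le> exp (\<alpha> + \<beta>\<^sup>2 / (2 * E)) / sqrt E"
    using q s E by (intro frac_le) auto
  finally show ?thesis unfolding int c_def[symmetric] by (rule ennreal_leI)
qed

lemma prob_space_std_normal: "prob_space std_normal"
  by (rule prob_space_normal_density) simp

lemma quad_measurable_PiM [measurable]:
  "(\<lambda>x. quad n p K A b (\<lambda>j. if j \<in> I then x j else z j)) \<in> borel_measurable (Pi\<^sub>M I (\<lambda>_. std_normal))"
proof -
  have [measurable]: "(\<lambda>x. if j \<in> I then x j else z j) \<in> borel_measurable (Pi\<^sub>M I (\<lambda>_. std_normal))" for j
    by (cases "j \<in> I") (auto intro!: measurable_compose[OF measurable_component_singleton])
  show ?thesis unfolding quad_def lin_def by measurable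
qed

lemma exp_quad_measurable_PiM:
  "(\<lambda>x. ennreal (exp (quad n p K A b (\<lambda>j. if j \<in> I then x j else z j))))
    \<in> borel_measurable (Pi\<^sub>M I (\<lambda>_. std_normal))"
  by measurable

text \<open>Coordinates outside \<open>I\<close> are frozen at \<open>z\<close>. The one-dimensional
  bound is applied to the new coordinate first, as the outer integral, and the induction hypothesis
  under it; this works because the cost of the old coordinates does not involve the value of the new
  one.\<close>

lemma gaussian_integral_exp_quad_aux:
  assumes K: "K \<ge> 0" and I: "finite I" "I \<subseteq> {..<p}"
  shows "ennreal (exp (quad n p K A b z - (\<Sum>j\<in>I. (K * (\<Sum>i<n. (A i j)\<^sup>2) + (z j)\<^sup>2) / 2)))
    \<le> (\<integral>\<^sup>+x. ennreal (exp (quad n p K A b (\<lambda>j. if j \<in> I then x j else z j))) \<partial>Pi\<^sub>M I (\<lambda>_. std_normal))"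
  using I
proof (induction I arbitrary: z rule: finite_induct)
  case empty
  interpret product_prob_space "\<lambda>_::nat. std_normal" "{}"
    unfolding product_prob_space_def product_sigma_finite_def product_prob_space_axioms_def
    by (auto intro: prob_space_std_normal prob_space_imp_sigma_finite)
  show ?case by (simp add: PiM_empty nn_integral_count_space_finite)
next
  case (insert k I)
  interpret product_sigma_finite "\<lambda>_::nat. std_normal"
    unfolding product_sigma_finite_def
    by (auto intro: prob_space_std_normal prob_space_imp_sigma_finite)
  have k: "k < p" using insert by auto
  define f where "f x = ennreal (exp (quad n p K A b (\<lambda>j. if j \<in> insert k I then x j else z j)))" for x
  have f: "f \<in> borel_measurable (Pi\<^sub>M (insert k I) (\<lambda>_. std_normal))"
    unfolding f_def[abs_def] by (rule exp_quad_measurable_PiM)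
  let ?D = "K * (\<Sum>i<n. (A i k)\<^sup>2)"
  let ?c = "\<Sum>j\<in>I. (K * (\<Sum>i<n. (A i j)\<^sup>2) + (z j)\<^sup>2) / 2"
  obtain \<alpha> \<beta> where q: "\<And>y. quad n p K A b (z(k := y)) = \<alpha> + \<beta> * y - ?D / 2 * y\<^sup>2"
    using quad_fun_upd[OF k, of n K A b z] by auto
  have qz: "quad n p K A b z = \<alpha> + \<beta> * z k - ?D / 2 * (z k)\<^sup>2" using q[of "z k"] by simp
  have "ennreal (exp (quad n p K A b z - (\<Sum>j\<in>insert k I. (K * (\<Sum>i<n. (A i j)\<^sup>2) + (z j)\<^sup>2) / 2)))
      = ennreal (exp ((\<alpha> - ?c) + \<beta> * z k - ?D / 2 * (z k)\<^sup>2 - (?D + (z k)\<^sup>2) / 2))"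
    using insert.hyps by (simp add: qz algebra_simps)
  also have "\<dots> \<le> (\<integral>\<^sup>+y. ennreal (exp ((\<alpha> - ?c) + \<beta> * y - ?D / 2 * y\<^sup>2)) \<partial>std_normal)"
    by (rule gaussian_integral_exp_quadratic) (simp add: K sum_nonneg)
  also have "\<dots> \<le> (\<integral>\<^sup>+y. (\<integral>\<^sup>+x. ennreal (exp (quad n p K A b
      (\<lambda>j. if j \<in> insert k I then (x(k := y)) j else z j))) \<partial>Pi\<^sub>M I (\<lambda>_. std_normal)) \<partial>std_normal)"
  proof (rule nn_integral_mono)
    fix y
    have c: "(\<Sum>j\<in>I. (K * (\<Sum>i<n. (A i j)\<^sup>2) + ((z(k := y)) j)\<^sup>2) / 2) = ?c"
      using insert.hyps by (intro sum.cong) auto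
    have "(\<lambda>j. if j \<in> insert k I then (x(k := y)) j else z j) = (\<lambda>j. if j \<in> I then x j else (z(k := y)) j)" for x
      using insert.hyps by auto
    with insert.IH[of "z(k := y)"] insert.prems
    show "ennreal (exp ((\<alpha> - ?c) + \<beta> * y - ?D / 2 * y\<^sup>2)) \<le> (\<integral>\<^sup>+x. ennreal (exp (quad n p K A b
      (\<lambda>j. if j \<in> insert k I then (x(k := y)) j else z j))) \<partial>Pi\<^sub>M I (\<lambda>_. std_normal))"
      unfolding c q by (simp add: algebra_simps)
  qed
  also have "\<dots> = (\<integral>\<^sup>+y. (\<integral>\<^sup>+x. f (x(k := y)) \<partial>Pi\<^sub>M I (\<lambda>_. std_normal)) \<partial>std_normal)"
    by (simp only: f_def)
  also have "\<dots> = integral\<^sup>N (Pi\<^sub>M (insert k I) (\<lambda>_. std_normal)) f"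
    by (rule product_nn_integral_insert_rev[OF insert.hyps f, symmetric])
  finally have "ennreal (exp (quad n p K A b z - (\<Sum>j\<in>insert k I. (K * (\<Sum>i<n. (A i j)\<^sup>2) + (z j)\<^sup>2) / 2)))
    \<le> integral\<^sup>N (Pi\<^sub>M (insert k I) (\<lambda>_. std_normal)) f" .
  then have "ennreal (exp (quad n p K A b z - (\<Sum>j\<in>insert k I. (K * (\<Sum>i<n. (A i j)\<^sup>2) + (z j)\<^sup>2) / 2)))
    \<le> (\<integral>\<^sup>+x. ennreal (exp (quad n p K A b (\<lambda>j. if j \<in> insert k I then x j else z j))) \<partial>Pi\<^sub>M (insert k I) (\<lambda>_. std_normal))"
    unfolding f_def[abs_def] .
  then show ?case .
qed

lemma gaussian_integral_exp_quad:
  assumes "K \<ge> 0"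
  shows "ennreal (exp (quad n p K A b z - (\<Sum>j<p. (K * (\<Sum>i<n. (A i j)\<^sup>2) + (z j)\<^sup>2) / 2)))
    \<le> (\<integral>\<^sup>+x. ennreal (exp (quad n p K A b x)) \<partial>Pi\<^sub>M {..<p} (\<lambda>_. std_normal))"
proof -
  have "quad n p K A b (\<lambda>j. if j \<in> {..<p} then x j else z j) = quad n p K A b x" for x
    by (rule quad_cong) simp
  with gaussian_integral_exp_quad_aux[OF assms finite_lessThan subset_refl, of n p A b z]
  show ?thesis by simp
qed

text \<open>\<open>y\<close> is a convex combination of two grid neighbours, and there the quadratic
  exceeds its chord by exactly \<open>D / 2 * \<eta>^2 * t * (1 - t)\<close>, so the better
  neighbour loses no more than that. A loss linear in \<open>y\<close>, rather than constant,
  matters: a group with \<open>y = 0\<close> must cost nothing.\<close>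

lemma concave_quadratic_round:
  fixes y \<eta> D :: real
  assumes "y \<ge> 0" "\<eta> > 0" "D \<ge> 0"
  obtains k :: nat where
    "\<alpha> + \<beta> * y - D / 2 * y\<^sup>2 - D / 2 * \<eta> * y \<le> \<alpha> + \<beta> * (\<eta> * real k) - D / 2 * (\<eta> * real k)\<^sup>2"
proof -
  define m where "m = nat \<lfloor>y / \<eta>\<rfloor>"
  define t where "t = y / \<eta> - real m"
  have m: "real m = of_int \<lfloor>y / \<eta>\<rfloor>" using assms by (simp add: m_def)
  have t: "0 \<le> t" "t < 1" unfolding t_def m by linarith+
  have y: "y = \<eta> * (real m + t)" using assms by (simp add: t_def)
  let ?q = "\<lambda>x. \<alpha> + \<beta> * x - D / 2 * x\<^sup>2"
  have eq: "?q y = (1 - t) * ?q (\<eta> * real m) + t * ?q (\<eta> * real (Suc m)) + D / 2 * \<eta>\<^sup>2 * (t * (1 - t))"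
    unfolding y by (simp add: power2_eq_square field_simps)
  have "t * (1 - t) \<le> 1 * (real m + t)" using t by (auto simp: algebra_simps)
  then have "D / 2 * \<eta>\<^sup>2 * (t * (1 - t)) \<le> D / 2 * \<eta>\<^sup>2 * (real m + t)"
    using assms by (intro mult_left_mono) auto
  also have "\<dots> = D / 2 * \<eta> * y" unfolding y by (simp add: power2_eq_square)
  finally have le: "?q y - D / 2 * \<eta> * y \<le> (1 - t) * ?q (\<eta> * real m) + t * ?q (\<eta> * real (Suc m))"
    using eq by simp
  define M where "M = max (?q (\<eta> * real m)) (?q (\<eta> * real (Suc m)))"
  have "(1 - t) * ?q (\<eta> * real m) + t * ?q (\<eta> * real (Suc m)) \<le> (1 - t) * M + t * M"
    using t unfolding M_def by (intro add_mono mult_left_mono max.cobounded1 max.cobounded2) simp_all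
  also have "\<dots> = M" by (simp add: algebra_simps)
  finally have "?q y - D / 2 * \<eta> * y \<le> M" using le by linarith
  moreover have "M = ?q (\<eta> * real m) \<or> M = ?q (\<eta> * real (Suc m))" unfolding M_def by linarith
  ultimately show ?thesis using that by metis
qed

text \<open>Coordinates below \<open>m\<close> are already on the grid. Rounding the next one with
  all others frozen is a one-dimensional problem of curvature at most \<open>K * N\<close>.\<close>

lemma quad_round_aux:
  assumes K: "K \<ge> 0" and r: "\<And>g. g < p \<Longrightarrow> r g \<ge> 0" and N: "\<And>g. g < p \<Longrightarrow> (\<Sum>i<n. (A i g)\<^sup>2) \<le> N"
    and \<eta>: "\<eta> > 0" and m: "m \<le> p"
  shows "\<exists>k :: nat \<Rightarrow> nat. quad n p K A b r - K * N / 2 * \<eta> * (\<Sum>g<m. r g)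
    \<le> quad n p K A b (\<lambda>g. if g < m then \<eta> * real (k g) else r g)"
  using m
proof (induction m)
  case 0
  then show ?case by simp
next
  case (Suc m)
  then obtain k where k: "quad n p K A b r - K * N / 2 * \<eta> * (\<Sum>g<m. r g)
    \<le> quad n p K A b (\<lambda>g. if g < m then \<eta> * real (k g) else r g)" by auto
  have m: "m < p" using Suc by simp
  let ?h = "\<lambda>g. if g < m then \<eta> * real (k g) else r g"
  let ?S = "\<Sum>i<n. (A i m)\<^sup>2"
  obtain \<alpha> \<beta> where q: "\<And>x. quad n p K A b (?h(m := x)) = \<alpha> + \<beta> * x - K * ?S / 2 * x\<^sup>2"
    using quad_fun_upd[OF m, of n K A b ?h] by auto
  have h: "?h(m := r m) = ?h" by auto
  obtain l :: nat where l: "\<alpha> + \<beta> * r m - K * ?S / 2 * (r m)\<^sup>2 - K * ?S / 2 * \<eta> * r m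
      \<le> \<alpha> + \<beta> * (\<eta> * real l) - K * ?S / 2 * (\<eta> * real l)\<^sup>2"
    by (rule concave_quadratic_round[of "r m" \<eta> "K * ?S" \<alpha> \<beta>]) (use r[OF m] \<eta> K in \<open>simp_all add: sum_nonneg\<close>)
  have "K * ?S / 2 * \<eta> * r m \<le> K * N / 2 * \<eta> * r m"
    using K \<eta> r[OF m] N[OF m] by (intro mult_right_mono divide_right_mono mult_left_mono) auto
  moreover have "quad n p K A b ?h = \<alpha> + \<beta> * r m - K * ?S / 2 * (r m)\<^sup>2" using q[of "r m"] h by simp
  moreover have "K * N / 2 * \<eta> * (\<Sum>g<Suc m. r g) = K * N / 2 * \<eta> * (\<Sum>g<m. r g) + K * N / 2 * \<eta> * r m"
    by (simp add: algebra_simps)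
  ultimately have "quad n p K A b r - K * N / 2 * \<eta> * (\<Sum>g<Suc m. r g) \<le> quad n p K A b (?h(m := \<eta> * real l))"
    using l k unfolding q by linarith
  moreover have "?h(m := \<eta> * real l) = (\<lambda>g. if g < Suc m then \<eta> * real ((k(m := l)) g) else r g)"
    by (auto simp: fun_eq_iff less_Suc_eq)
  ultimately show ?case by (intro exI[of _ "k(m := l)"]) simp
qed

lemma quad_round:
  assumes "K \<ge> 0" "\<And>g. g < p \<Longrightarrow> r g \<ge> 0" "\<And>g. g < p \<Longrightarrow> (\<Sum>i<n. (A i g)\<^sup>2) \<le> N" "\<eta> > 0"
  obtains k :: "nat \<Rightarrow> nat" where
    "quad n p K A b r - K * N / 2 * \<eta> * (\<Sum>g<p. r g) \<le> quad n p K A b (\<lambda>g. \<eta> * real (k g))"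
proof -
  have "\<exists>k :: nat \<Rightarrow> nat. quad n p K A b r - K * N / 2 * \<eta> * (\<Sum>g<p. r g)
    \<le> quad n p K A b (\<lambda>g. if g < p then \<eta> * real (k g) else r g)"
    by (rule quad_round_aux) (use assms in auto)
  then obtain k :: "nat \<Rightarrow> nat" where "quad n p K A b r - K * N / 2 * \<eta> * (\<Sum>g<p. r g)
    \<le> quad n p K A b (\<lambda>g. if g < p then \<eta> * real (k g) else r g)" ..
  also have "quad n p K A b (\<lambda>g. if g < p then \<eta> * real (k g) else r g) = quad n p K A b (\<lambda>g. \<eta> * real (k g))"
    by (rule quad_cong) simp
  finally show ?thesis by (rule that)
qed

section \<open>The mixture prior\<close>

text \<open>The prior of a PAC-Bayes argument: the variance in a group and the logarithm of the weight are both
  proportional to the count \<open>k g\<close>, so that the cost of shifting the mean in a group is linear in the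
  Euclidean norm of the shift.\<close>

definition mix_scale :: "(nat \<Rightarrow> nat) \<Rightarrow> (nat \<Rightarrow> real) \<Rightarrow> real \<Rightarrow> (nat \<Rightarrow> nat) \<Rightarrow> nat \<Rightarrow> real" where
  "mix_scale gr v \<eta> k j = sqrt (real (k (gr j)) * v (gr j)) * \<eta>"

text \<open>\<open>geometric_pmf\<close> takes a success probability, so \<open>1 - \<theta>\<close>
  gives a count \<open>k\<close> the weight \<open>(1 - \<theta>) * \<theta> ^ k\<close>: each unit
  costs \<open>ln (1 / \<theta>)\<close>.\<close>

definition geometric_counts :: "nat \<Rightarrow> real \<Rightarrow> (nat \<Rightarrow> nat) pmf" where
  "geometric_counts G \<theta> = Pi_pmf {..<G} 0 (\<lambda>_. geometric_pmf (1 - \<theta>))"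

text \<open>Taken in \<open>ennreal\<close>, so that it makes sense for every \<open>A\<close> and
  \<open>b\<close>; for the noise it is finite only almost surely.\<close>

definition mix_exp ::
  "nat \<Rightarrow> nat \<Rightarrow> real \<Rightarrow> nat \<Rightarrow> (nat \<Rightarrow> nat) \<Rightarrow> real \<Rightarrow> (nat \<Rightarrow> real) \<Rightarrow> real
    \<Rightarrow> (nat \<Rightarrow> nat \<Rightarrow> real) \<Rightarrow> (nat \<Rightarrow> real) \<Rightarrow> ennreal" where
  "mix_exp n p K G gr \<theta> v \<eta> A b =
     (\<integral>\<^sup>+k. (\<integral>\<^sup>+x. ennreal (exp (quad n p K A b (\<lambda>j. mix_scale gr v \<eta> k j * x j)))
        \<partial>Pi\<^sub>M {..<p} (\<lambda>_. std_normal)) \<partial>measure_pmf (geometric_counts G \<theta>))"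

lemma quad_scale: "quad n p K A b (\<lambda>j. c j * x j) = quad n p K (\<lambda>i j. A i j * c j) (\<lambda>j. b j * c j) x"
  unfolding quad_def lin_def by (simp add: mult.assoc)

lemma sum_groups:
  fixes f :: "nat \<Rightarrow> real" and gr :: "nat \<Rightarrow> nat"
  assumes gr: "\<And>j. j < p \<Longrightarrow> gr j < G"
  shows "(\<Sum>j<p. f j) = (\<Sum>g<G. \<Sum>j | j < p \<and> gr j = g. f j)"
proof -
  have "(\<Sum>g<G. \<Sum>j | j < p \<and> gr j = g. f j) = (\<Sum>g<G. sum f {x. x \<in> {..<p} \<and> gr x = g})" by simp
  also have "\<dots> = sum f {..<p}" using gr by (intro sum.group) auto
  finally show ?thesis by simp
qed

text \<open>For fixed directions \<open>u\<close>, the quadratic in \<open>p\<close> coordinates is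
  one in the \<open>G\<close> group radii. A cost linear in the radii merely changes its linear
  coefficient, so it can be carried through the rounding.\<close>

lemma quad_groups:
  assumes gr: "\<And>j. j < p \<Longrightarrow> gr j < G"
  shows "quad n p K A b (\<lambda>j. r (gr j) * u j) - (\<Sum>g<G. d g * r g) =
    quad n G K (\<lambda>i g. \<Sum>j | j < p \<and> gr j = g. A i j * u j)
      (\<lambda>g. (\<Sum>j | j < p \<and> gr j = g. b j * u j) - d g) r"
proof -
  have s: "(\<Sum>j<p. f j * (r (gr j) * u j)) = (\<Sum>g<G. (\<Sum>j | j < p \<and> gr j = g. f j * u j) * r g)"
    for f :: "nat \<Rightarrow> real"
    by (subst sum_groups[OF gr]) (auto simp: sum_distrib_left mult_ac intro!: sum.cong)
  have "lin p A (\<lambda>j. r (gr j) * u j) i = lin G (\<lambda>i g. \<Sum>j | j < p \<and> gr j = g. A i j * u j) r i" for i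
    unfolding lin_def by (rule s)
  then show ?thesis unfolding quad_def by (simp add: s left_diff_distrib sum_subtractf)
qed

definition group_norm :: "nat \<Rightarrow> (nat \<Rightarrow> nat) \<Rightarrow> (nat \<Rightarrow> real) \<Rightarrow> nat \<Rightarrow> real" where
  "group_norm p gr h g = sqrt (\<Sum>j | j < p \<and> gr j = g. (h j)\<^sup>2)"

lemma nn_integral_pmf_ge: "ennreal (pmf P k) * f k \<le> (\<integral>\<^sup>+x. f x \<partial>measure_pmf P)"
  unfolding nn_integral_measure_pmf by (rule nn_integral_ge_point) simp

lemma pmf_geometric_counts:
  assumes "0 < \<theta>" "\<theta> < 1" "\<And>g. g \<ge> G \<Longrightarrow> k g = 0"
  shows "pmf (geometric_counts G \<theta>) k = (1 - \<theta>) ^ G * \<theta> ^ (\<Sum>g<G. k g)"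
proof -
  have "pmf (geometric_counts G \<theta>) k = (\<Prod>g<G. \<theta> ^ k g * (1 - \<theta>))"
    unfolding geometric_counts_def using assms by (subst pmf_Pi') auto
  then show ?thesis by (simp add: prod.distrib power_sum)
qed

text \<open>In each group \<open>h\<close> is a radius times a direction, and the radii are rounded
  to \<open>\<eta> * k g\<close>. In the mixture component with counts \<open>k\<close>, reaching
  the rounded point takes a Gaussian shift of squared length at most \<open>k g / v g\<close>, the
  Gaussian spread adds \<open>K * N * v g * \<eta>^2 * k g\<close> per coordinate (both are halved
  in the exponent), and the weight contributes \<open>\<theta> ^ k g\<close>. All are linear in
  \<open>k g\<close>, and \<open>d g\<close> is the price of one count.\<close>

lemma mix_exp_lower:
  fixes N :: real
  assumes K: "K \<ge> 0" and \<theta>: "0 < \<theta>" "\<theta> < 1" and \<eta>: "\<eta> > 0" and v: "\<And>g. g < G \<Longrightarrow> v g > 0"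
    and gr: "\<And>j. j < p \<Longrightarrow> gr j < G"
    and N: "\<And>g u. g < G \<Longrightarrow> (\<Sum>i<n. (\<Sum>j | j < p \<and> gr j = g. A i j * u j)\<^sup>2)
       \<le> N * (\<Sum>j | j < p \<and> gr j = g. (u j)\<^sup>2)"
    and N0: "N \<ge> 0"
  defines "d \<equiv> \<lambda>g. ln (1 / \<theta>) + (1 / v g + K * N * real (card {j. j < p \<and> gr j = g}) * v g * \<eta>\<^sup>2) / 2"
  shows "ennreal ((1 - \<theta>) ^ G * exp (quad n p K A b h - (\<Sum>g<G. (d g / \<eta> + K * N / 2 * \<eta>) * group_norm p gr h g)))
     \<le> mix_exp n p K G gr \<theta> v \<eta> A b"
proof -
  let ?I = "\<lambda>g. {j. j < p \<and> gr j = g}"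
  define r where "r = group_norm p gr h"
  have r0: "r g \<ge> 0" for g unfolding r_def group_norm_def by (simp add: sum_nonneg)
  have r2: "(r g)\<^sup>2 = (\<Sum>j\<in>?I g. (h j)\<^sup>2)" for g
    unfolding r_def group_norm_def by (simp add: sum_nonneg)
  \<comment> \<open>Where the radius is zero, division by zero makes \<open>u\<close> zero; this
    keeps both \<open>hu\<close> and \<open>u1\<close> true.\<close>
  define u where "u j = h j / r (gr j)" for j
  have hu: "h j = r (gr j) * u j" if "j < p" for j
  proof (cases "r (gr j) = 0")
    case True
    then have "(\<Sum>j\<in>?I (gr j). (h j)\<^sup>2) = 0" using r2[of "gr j"] by simp
    then have "(h j)\<^sup>2 = 0" using that by (subst (asm) sum_nonneg_eq_0_iff) auto
    then show ?thesis using True by simp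
  qed (simp add: u_def)
  have u1: "(\<Sum>j\<in>?I g. (u j)\<^sup>2) \<le> 1" for g
  proof -
    have "(\<Sum>j\<in>?I g. (u j)\<^sup>2) = (\<Sum>j\<in>?I g. (h j)\<^sup>2) / (r g)\<^sup>2"
      unfolding u_def sum_divide_distrib by (intro sum.cong) (auto simp: power_divide)
    also have "\<dots> \<le> 1" by (simp add: r2[symmetric])
    finally show ?thesis .
  qed
  \<comment> \<open>The group bound tested on a unit vector. It controls the spread of the
    Gaussians, while \<open>A'N\<close> controls the curvature in the radii.\<close>
  have col: "(\<Sum>i<n. (A i j)\<^sup>2) \<le> N" if "j < p" for j
  proof -
    have "(\<Sum>l\<in>?I (gr j). A i l * (if l = j then 1 else 0)) = A i j" for i
      using that by (simp add: if_distrib sum.delta cong: if_cong)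
    moreover have "(\<Sum>l\<in>?I (gr j). (if l = j then 1 else (0::real))\<^sup>2) = 1"
      using that by (simp add: if_distrib[of "\<lambda>x. x\<^sup>2"] sum.delta cong: if_cong)
    ultimately show ?thesis using N[OF gr[OF that], of "\<lambda>l. if l = j then 1 else 0"] by simp
  qed
  define A' where "A' i g = (\<Sum>j\<in>?I g. A i j * u j)" for i g
  \<comment> \<open>The price of the counts enters the linear coefficient before rounding. The
    rounded point is then compared together with its own price, and \<open>\<eta> * k g\<close> need
    not be related to \<open>r g\<close>.\<close>
  define b' where "b' g = (\<Sum>j\<in>?I g. b j * u j) - d g / \<eta>" for g
  have A'N: "(\<Sum>i<n. (A' i g)\<^sup>2) \<le> N" if "g < G" for g
  proof -
    have "(\<Sum>i<n. (A' i g)\<^sup>2) \<le> N * (\<Sum>j\<in>?I g. (u j)\<^sup>2)"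
      unfolding A'_def using N[OF that] .
    also have "\<dots> \<le> N * 1" using u1 N0 by (intro mult_left_mono)
    finally show ?thesis by simp
  qed
  have q: "quad n p K A b (\<lambda>j. s (gr j) * u j) - (\<Sum>g<G. d g / \<eta> * s g) = quad n G K A' b' s" for s
    using quad_groups[OF gr, where d = "\<lambda>g. d g / \<eta>"] unfolding A'_def[abs_def] b'_def[abs_def] by simp
  obtain l where l: "quad n G K A' b' r - K * N / 2 * \<eta> * (\<Sum>g<G. r g) \<le> quad n G K A' b' (\<lambda>g. \<eta> * real (l g))"
    by (rule quad_round[where n = n and b = b', OF K r0 A'N \<eta>]) blast
  \<comment> \<open>Off the groups the count is the default of \<open>geometric_counts\<close>; any
    other value there would have weight zero.\<close>
  define k where "k g = (if g < G then l g else 0)" for g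
  have k: "quad n G K A' b' (\<lambda>g. \<eta> * real (l g)) = quad n G K A' b' (\<lambda>g. \<eta> * real (k g))"
    by (rule quad_cong) (simp add: k_def)
  have hq: "quad n p K A b (\<lambda>j. r (gr j) * u j) = quad n p K A b h"
    by (rule quad_cong) (simp add: hu)
  \<comment> \<open>The shift that \<open>mix_scale\<close> turns into
    \<open>\<eta> * k * u\<close>; for a zero count both factors vanish.\<close>
  define z where "z j = sqrt (real (k (gr j)) / v (gr j)) * u j" for j
  let ?c = "mix_scale gr v \<eta> k"
  have cz: "?c j * z j = \<eta> * real (k (gr j)) * u j" if "j < p" for j
  proof -
    have "v (gr j) > 0" using v gr that by simp
    then have "sqrt (real (k (gr j)) * v (gr j)) * sqrt (real (k (gr j)) / v (gr j)) = real (k (gr j))"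
      by (simp add: real_sqrt_mult[symmetric])
    then show ?thesis unfolding mix_scale_def z_def by (simp add: mult.assoc mult.left_commute)
  qed
  have qz: "quad n p K (\<lambda>i j. A i j * ?c j) (\<lambda>j. b j * ?c j) z = quad n p K A b (\<lambda>j. \<eta> * real (k (gr j)) * u j)"
    unfolding quad_scale[symmetric] by (rule quad_cong) (simp add: cz)
  have cost: "(\<Sum>j<p. (K * (\<Sum>i<n. (A i j * ?c j)\<^sup>2) + (z j)\<^sup>2) / 2) \<le> (\<Sum>g<G. real (k g) * (d g - ln (1 / \<theta>)))"
  proof -
    have "(\<Sum>j<p. (K * (\<Sum>i<n. (A i j * ?c j)\<^sup>2) + (z j)\<^sup>2) / 2)
      = (\<Sum>g<G. \<Sum>j\<in>?I g. (K * (\<Sum>i<n. (A i j * ?c j)\<^sup>2) + (z j)\<^sup>2) / 2)"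
      by (rule sum_groups) (rule gr)
    also have "\<dots> \<le> (\<Sum>g<G. real (k g) * (d g - ln (1 / \<theta>)))"
  proof (rule sum_mono)
    fix g assume g: "g \<in> {..<G}"
    then have vg: "v g > 0" using v by simp
    have "(\<Sum>j\<in>?I g. (K * (\<Sum>i<n. (A i j * ?c j)\<^sup>2) + (z j)\<^sup>2) / 2)
      \<le> (\<Sum>j\<in>?I g. (K * (N * (real (k g) * v g * \<eta>\<^sup>2)) + real (k g) / v g * (u j)\<^sup>2) / 2)"
    proof (rule sum_mono)
      fix j assume j: "j \<in> ?I g"
      have "(\<Sum>i<n. (A i j * ?c j)\<^sup>2) = (\<Sum>i<n. (A i j)\<^sup>2) * (real (k g) * v g * \<eta>\<^sup>2)"
        unfolding mix_scale_def sum_distrib_right using j vg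
        by (intro sum.cong) (auto simp: power_mult_distrib)
      also have "\<dots> \<le> N * (real (k g) * v g * \<eta>\<^sup>2)"
        using col j vg by (intro mult_right_mono) auto
      finally have "K * (\<Sum>i<n. (A i j * ?c j)\<^sup>2) \<le> K * (N * (real (k g) * v g * \<eta>\<^sup>2))"
        using K by (intro mult_left_mono)
      moreover have "(z j)\<^sup>2 = real (k g) / v g * (u j)\<^sup>2"
        unfolding z_def using j vg by (simp add: power_mult_distrib)
      ultimately show "(K * (\<Sum>i<n. (A i j * ?c j)\<^sup>2) + (z j)\<^sup>2) / 2
        \<le> (K * (N * (real (k g) * v g * \<eta>\<^sup>2)) + real (k g) / v g * (u j)\<^sup>2) / 2" by simp
    qed
    also have "\<dots> = (real (card (?I g)) * (K * (N * (real (k g) * v g * \<eta>\<^sup>2))) + real (k g) / v g * (\<Sum>j\<in>?I g. (u j)\<^sup>2)) / 2"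
      by (simp add: sum.distrib sum_divide_distrib[symmetric] sum_distrib_left)
    also have "\<dots> \<le> (real (card (?I g)) * (K * (N * (real (k g) * v g * \<eta>\<^sup>2))) + real (k g) / v g * 1) / 2"
      using u1 vg by (intro divide_right_mono add_left_mono mult_left_mono) auto
    also have "\<dots> = real (k g) * (d g - ln (1 / \<theta>))"
      by (simp add: d_def field_simps)
    finally show "(\<Sum>j\<in>?I g. (K * (\<Sum>i<n. (A i j * ?c j)\<^sup>2) + (z j)\<^sup>2) / 2) \<le> real (k g) * (d g - ln (1 / \<theta>))" .
  qed
    finally show ?thesis .
  qed
  have th: "exp (- (\<Sum>g<G. real (k g) * ln (1 / \<theta>))) = \<theta> ^ (\<Sum>g<G. k g)"
    using \<theta> by (simp add: ln_div sum_negf exp_sum exp_of_nat_mult power_sum)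
  have "quad n p K A b h - (\<Sum>g<G. (d g / \<eta> + K * N / 2 * \<eta>) * r g)
      = quad n G K A' b' r - K * N / 2 * \<eta> * (\<Sum>g<G. r g)"
    unfolding q[of r, symmetric] hq by (simp add: distrib_right sum.distrib sum_distrib_left)
  also have "\<dots> \<le> quad n p K A b (\<lambda>j. \<eta> * real (k (gr j)) * u j) - (\<Sum>g<G. d g / \<eta> * (\<eta> * real (k g)))"
    using l unfolding k q[symmetric] .
  also have "(\<Sum>g<G. d g / \<eta> * (\<eta> * real (k g))) = (\<Sum>g<G. real (k g) * (d g - ln (1 / \<theta>))) + (\<Sum>g<G. real (k g) * ln (1 / \<theta>))"
    using \<eta> by (simp add: sum.distrib[symmetric] algebra_simps)
  finally have "quad n p K A b h - (\<Sum>g<G. (d g / \<eta> + K * N / 2 * \<eta>) * r g)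
      \<le> (quad n p K (\<lambda>i j. A i j * ?c j) (\<lambda>j. b j * ?c j) z
        - (\<Sum>j<p. (K * (\<Sum>i<n. (A i j * ?c j)\<^sup>2) + (z j)\<^sup>2) / 2)) + - (\<Sum>g<G. real (k g) * ln (1 / \<theta>))"
    using cost unfolding qz by linarith
  then have "exp (quad n p K A b h - (\<Sum>g<G. (d g / \<eta> + K * N / 2 * \<eta>) * r g))
      \<le> \<theta> ^ (\<Sum>g<G. k g) * exp (quad n p K (\<lambda>i j. A i j * ?c j) (\<lambda>j. b j * ?c j) z
        - (\<Sum>j<p. (K * (\<Sum>i<n. (A i j * ?c j)\<^sup>2) + (z j)\<^sup>2) / 2))" (is "?E \<le> _ * ?F")
    unfolding th[symmetric] exp_add[symmetric] by simp
  then have "(1 - \<theta>) ^ G * ?E \<le> (1 - \<theta>) ^ G * (\<theta> ^ (\<Sum>g<G. k g) * ?F)"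
    using \<theta> by (intro mult_left_mono) auto
  also have "\<dots> = pmf (geometric_counts G \<theta>) k * ?F"
    using \<theta> by (subst pmf_geometric_counts) (auto simp: k_def)
  finally have "ennreal ((1 - \<theta>) ^ G * ?E) \<le> ennreal (pmf (geometric_counts G \<theta>) k) * ennreal ?F"
    by (simp add: ennreal_mult[symmetric] ennreal_leI)
  also have "\<dots> \<le> ennreal (pmf (geometric_counts G \<theta>) k)
      * (\<integral>\<^sup>+x. ennreal (exp (quad n p K A b (\<lambda>j. ?c j * x j))) \<partial>Pi\<^sub>M {..<p} (\<lambda>_. std_normal))"
    unfolding quad_scale by (intro mult_left_mono gaussian_integral_exp_quad K) simp
  \<comment> \<open>Of the whole mixture over counts only the single component \<open>k\<close> is
    kept.\<close>
  also have "\<dots> \<le> mix_exp n p K G gr \<theta> v \<eta> A b"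
    unfolding mix_exp_def by (rule nn_integral_pmf_ge)
  finally show ?thesis unfolding r_def .
qed

section \<open>Exponential moments of the noise\<close>

text \<open>Independence factorises the expectation. In each factor the subtracted term cancels
  exactly the sub-Gaussian bound at \<open>t * v i\<close>.\<close>

lemma (in prob_space) sub_gaussian_mgf:
  fixes n :: nat
  assumes sub: "\<And>i. i < n \<Longrightarrow> sub_gaussian M \<sigma> (\<epsilon> i)"
    and ind: "indep_vars (\<lambda>_. borel) \<epsilon> {..<n}"
  shows "(\<integral>\<^sup>+w. ennreal (exp (t * (\<Sum>i<n. \<epsilon> i w * v i) - t\<^sup>2 * \<sigma>\<^sup>2 / 2 * (\<Sum>i<n. (v i)\<^sup>2))) \<partial>M) \<le> 1"
proof -
  define Y where "Y i x = ennreal (exp (t * v i * x - t\<^sup>2 * \<sigma>\<^sup>2 / 2 * (v i)\<^sup>2))" for i and x :: real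
  have eq: "ennreal (exp (t * (\<Sum>i<n. \<epsilon> i w * v i) - t\<^sup>2 * \<sigma>\<^sup>2 / 2 * (\<Sum>i<n. (v i)\<^sup>2))) = (\<Prod>i<n. Y i (\<epsilon> i w))" for w
  proof -
    have s: "t * (\<Sum>i<n. \<epsilon> i w * v i) - t\<^sup>2 * \<sigma>\<^sup>2 / 2 * (\<Sum>i<n. (v i)\<^sup>2)
      = (\<Sum>i<n. t * v i * \<epsilon> i w - t\<^sup>2 * \<sigma>\<^sup>2 / 2 * (v i)\<^sup>2)"
      by (simp add: sum_subtractf sum_distrib_left mult_ac)
    show ?thesis unfolding s Y_def by (subst exp_sum) (simp_all add: prod_ennreal)
  qed
  have "indep_vars (\<lambda>_. borel) (\<lambda>i w. Y i (\<epsilon> i w)) {..<n}"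
    by (rule indep_vars_compose2[OF ind]) (simp add: Y_def[abs_def])
  then have "(\<integral>\<^sup>+w. (\<Prod>i<n. Y i (\<epsilon> i w)) \<partial>M) = (\<Prod>i<n. \<integral>\<^sup>+w. Y i (\<epsilon> i w) \<partial>M)"
    by (intro indep_vars_nn_integral) auto
  also have "\<dots> \<le> (\<Prod>i<n. 1)"
  proof (rule prod_mono_ennreal)
    fix i assume "i \<in> {..<n}"
    then have s: "sub_gaussian M \<sigma> (\<epsilon> i)" using sub by simp
    then have int: "integrable M (\<lambda>w. exp (t * v i * \<epsilon> i w))"
      and le: "(\<integral>w. exp (t * v i * \<epsilon> i w) \<partial>M) \<le> exp (\<sigma>\<^sup>2 * (t * v i)\<^sup>2 / 2)"
      unfolding sub_gaussian_def by blast+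
    have [measurable]: "\<epsilon> i \<in> borel_measurable M" using s by (simp add: sub_gaussian_def)
    have "(\<integral>\<^sup>+w. Y i (\<epsilon> i w) \<partial>M)
      = (\<integral>\<^sup>+w. ennreal (exp (- (t\<^sup>2 * \<sigma>\<^sup>2 / 2 * (v i)\<^sup>2))) * ennreal (exp (t * v i * \<epsilon> i w)) \<partial>M)"
      unfolding Y_def by (simp add: ennreal_mult[symmetric] exp_add[symmetric])
    also have "\<dots> = ennreal (exp (- (t\<^sup>2 * \<sigma>\<^sup>2 / 2 * (v i)\<^sup>2))) * ennreal (\<integral>w. exp (t * v i * \<epsilon> i w) \<partial>M)"
      using int by (subst nn_integral_cmult) (auto simp: nn_integral_eq_integral)
    also have "\<dots> \<le> ennreal (exp (- (t\<^sup>2 * \<sigma>\<^sup>2 / 2 * (v i)\<^sup>2))) * ennreal (exp (\<sigma>\<^sup>2 * (t * v i)\<^sup>2 / 2))"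
      by (intro mult_left_mono ennreal_leI le) simp
    also have "\<dots> = 1"
      by (simp add: ennreal_mult[symmetric] exp_add[symmetric] power_mult_distrib mult_ac)
    finally show "(\<integral>\<^sup>+w. Y i (\<epsilon> i w) \<partial>M) \<le> 1" .
  qed
  finally show ?thesis unfolding eq by simp
qed

section \<open>The exponential moment for a random design and its mixture\<close>

definition noise_quad :: "nat \<Rightarrow> nat \<Rightarrow> real \<Rightarrow> real \<Rightarrow> real mat \<Rightarrow> real vec \<Rightarrow> (nat \<Rightarrow> real) \<Rightarrow> real" where
  "noise_quad n p \<sigma> t X e h =
     quad n p (t\<^sup>2 * \<sigma>\<^sup>2) (\<lambda>i j. X $$ (i, j)) (\<lambda>j. t * (\<Sum>i<n. e $ i * X $$ (i, j))) h"

lemma noise_quad_eq: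
  "noise_quad n p \<sigma> t X e h = t * (\<Sum>i<n. e $ i * lin p (\<lambda>i j. X $$ (i, j)) h i)
     - t\<^sup>2 * \<sigma>\<^sup>2 / 2 * (\<Sum>i<n. (lin p (\<lambda>i j. X $$ (i, j)) h i)\<^sup>2)"
proof -
  have "(\<Sum>i<n. e $ i * lin p (\<lambda>i j. X $$ (i, j)) h i) = (\<Sum>i<n. \<Sum>j<p. e $ i * X $$ (i, j) * h j)"
    unfolding lin_def by (simp add: sum_distrib_left mult.assoc)
  also have "\<dots> = (\<Sum>j<p. \<Sum>i<n. e $ i * X $$ (i, j) * h j)" by (rule sum.swap)
  finally show ?thesis
    unfolding noise_quad_def quad_def by (simp add: sum_distrib_left sum_distrib_right mult.assoc)
qed

text \<open>Independence of design and noise makes their joint law a product. By Fubini the design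
  may be frozen at \<open>x\<close>, and the moment bound for the noise applies with
  \<open>v\<close> the image of \<open>h\<close> under \<open>x\<close>.\<close>

lemma noise_quad_exp_le_1:
  assumes model: "sub_gaussian_linear_model M n p \<sigma> X \<beta> \<epsilon> y"
  shows "(\<integral>\<^sup>+w. ennreal (exp (noise_quad n p \<sigma> t (X w) (\<epsilon> w) h)) \<partial>M) \<le> 1"
proof -
  interpret prob_space M using model by (simp add: sub_gaussian_linear_model_def)
  define PX where "PX = Pi\<^sub>M ({..<n} \<times> {..<p}) (\<lambda>_. borel :: real measure)"
  define PE where "PE = Pi\<^sub>M {..<n} (\<lambda>_. borel :: real measure)"
  define Xm where "Xm w = (\<lambda>ij\<in>{..<n} \<times> {..<p}. X w $$ ij)" for w
  define em where "em w = (\<lambda>i\<in>{..<n}. \<epsilon> w $ i)" for w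
  have Xmeas: "Xm \<in> measurable M PX"
    unfolding PX_def Xm_def using model
    by (intro measurable_restrict) (auto simp: sub_gaussian_linear_model_def random_mat_def)
  have emeas: "em \<in> measurable M PE"
    unfolding PE_def em_def using model
    by (intro measurable_restrict) (auto simp: sub_gaussian_linear_model_def random_vec_def)
  interpret PXs: prob_space "distr M PX Xm" by (rule prob_space_distr[OF Xmeas])
  interpret PEs: prob_space "distr M PE em" by (rule prob_space_distr[OF emeas])
  have ind: "indep_set (sets (vimage_algebra (space M) Xm PX)) (sets (vimage_algebra (space M) em PE))"
    using model unfolding sub_gaussian_linear_model_def PX_def PE_def Xm_def em_def by blast
  \<comment> \<open>It suffices to compare the two laws on measurable rectangles, where their
    equality is the independence of the generated sigma-algebras.\<close>
  have joint: "distr M PX Xm \<Otimes>\<^sub>M distr M PE em = distr M (PX \<Otimes>\<^sub>M PE) (\<lambda>w. (Xm w, em w))"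
  proof (rule pair_measure_eqI)
    fix A B assume "A \<in> sets (distr M PX Xm)" "B \<in> sets (distr M PE em)"
    then have A: "A \<in> sets PX" and B: "B \<in> sets PE" by auto
    have "prob ((Xm -` A \<inter> space M) \<inter> (em -` B \<inter> space M)) = prob (Xm -` A \<inter> space M) * prob (em -` B \<inter> space M)"
      by (rule indep_setD[OF ind]) (use A B in \<open>auto intro: in_vimage_algebra\<close>)
    moreover have "(\<lambda>w. (Xm w, em w)) -` (A \<times> B) \<inter> space M = (Xm -` A \<inter> space M) \<inter> (em -` B \<inter> space M)"
      by auto
    ultimately show "emeasure (distr M PX Xm) A * emeasure (distr M PE em) B
        = emeasure (distr M (PX \<Otimes>\<^sub>M PE) (\<lambda>w. (Xm w, em w))) (A \<times> B)"
      using A B Xmeas emeas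
      by (subst (1 2 3) emeasure_distr) (auto simp: emeasure_eq_measure ennreal_mult[symmetric])
  qed (auto intro: PXs.sigma_finite_measure_axioms PEs.sigma_finite_measure_axioms cong: sets_pair_measure_cong)
  define g where "g x e = ennreal (exp (t * (\<Sum>i<n. e i * (\<Sum>j<p. x (i, j) * h j))
     - t\<^sup>2 * \<sigma>\<^sup>2 / 2 * (\<Sum>i<n. (\<Sum>j<p. x (i, j) * h j)\<^sup>2)))" for x e
  have gm [measurable]: "case_prod g \<in> borel_measurable (PX \<Otimes>\<^sub>M PE)"
    unfolding g_def PX_def PE_def by measurable
  have "(\<integral>\<^sup>+w. ennreal (exp (noise_quad n p \<sigma> t (X w) (\<epsilon> w) h)) \<partial>M) = (\<integral>\<^sup>+w. g (Xm w) (em w) \<partial>M)"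
    unfolding noise_quad_eq lin_def g_def Xm_def em_def by (intro nn_integral_cong) auto
  also have "\<dots> = (\<integral>\<^sup>+z. case_prod g z \<partial>(distr M PX Xm \<Otimes>\<^sub>M distr M PE em))"
    unfolding joint using Xmeas emeas by (subst nn_integral_distr) auto
  also have "\<dots> = (\<integral>\<^sup>+x. \<integral>\<^sup>+e. g x e \<partial>distr M PE em \<partial>distr M PX Xm)"
    by (subst PEs.nn_integral_fst[symmetric]) (auto simp: measurable_cong_sets[OF sets_pair_measure_cong[OF sets_distr sets_distr] refl] gm)
  also have "\<dots> \<le> (\<integral>\<^sup>+x. 1 \<partial>distr M PX Xm)"
  proof (rule nn_integral_mono)
    fix x assume "x \<in> space (distr M PX Xm)"
    then have "g x \<in> borel_measurable PE" using measurable_Pair2[OF gm, of x] by simp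
    then have "(\<integral>\<^sup>+e. g x e \<partial>distr M PE em) = (\<integral>\<^sup>+w. g x (em w) \<partial>M)"
      using emeas by (intro nn_integral_distr) auto
    also have "\<dots> \<le> 1"
      using sub_gaussian_mgf[of n \<sigma> "\<lambda>i w. \<epsilon> w $ i" t "\<lambda>i. \<Sum>j<p. x (i, j) * h j"] model
      unfolding g_def em_def by (auto simp: sub_gaussian_linear_model_def cong: sum.cong_simp)
    finally show "(\<integral>\<^sup>+e. g x e \<partial>distr M PE em) \<le> 1" .
  qed
  also have "\<dots> = 1" using PXs.emeasure_space_1 by simp
  finally show ?thesis .
qed

definition noise_mix ::
  "nat \<Rightarrow> nat \<Rightarrow> real \<Rightarrow> real \<Rightarrow> nat \<Rightarrow> (nat \<Rightarrow> nat) \<Rightarrow> real \<Rightarrow> (nat \<Rightarrow> real) \<Rightarrow> real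
    \<Rightarrow> real mat \<Rightarrow> real vec \<Rightarrow> ennreal" where
  "noise_mix n p \<sigma> t G gr \<theta> v \<eta> X e =
     mix_exp n p (t\<^sup>2 * \<sigma>\<^sup>2) G gr \<theta> v \<eta> (\<lambda>i j. X $$ (i, j)) (\<lambda>j. t * (\<Sum>i<n. e $ i * X $$ (i, j)))"

text \<open>By Tonelli the expectation moves inside the averages over counts and Gaussians, where it
  is at most \<open>1\<close> for each fixed \<open>h\<close>.\<close>

lemma noise_mix:
  assumes model: "sub_gaussian_linear_model M n p \<sigma> X \<beta> \<epsilon> y"
  shows "(\<lambda>w. noise_mix n p \<sigma> t G gr \<theta> v \<eta> (X w) (\<epsilon> w)) \<in> borel_measurable M" (is ?meas)
    and "(\<integral>\<^sup>+w. noise_mix n p \<sigma> t G gr \<theta> v \<eta> (X w) (\<epsilon> w) \<partial>M) \<le> 1" (is ?le)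
proof -
  interpret prob_space M using model by (simp add: sub_gaussian_linear_model_def)
  define N where "N = Pi\<^sub>M {..<p} (\<lambda>_. std_normal)"
  interpret N: product_prob_space "\<lambda>_::nat. std_normal" "{..<p}"
    unfolding product_prob_space_def product_sigma_finite_def product_prob_space_axioms_def
    by (auto intro: prob_space_std_normal prob_space_imp_sigma_finite)
  interpret N: prob_space N unfolding N_def by (rule prob_space_PiM) (rule prob_space_std_normal)
  interpret MN: pair_sigma_finite M N ..
  define P where "P = geometric_counts G \<theta>"
  define f where "f k w x = ennreal (exp (noise_quad n p \<sigma> t (X w) (\<epsilon> w) (\<lambda>j. mix_scale gr v \<eta> k j * x j)))" for k w x
  have [measurable]: "(\<lambda>w. X w $$ (i, j)) \<in> borel_measurable M" if "i < n" "j < p" for i j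
    using model that by (auto simp: sub_gaussian_linear_model_def random_mat_def)
  have [measurable]: "(\<lambda>w. \<epsilon> w $ i) \<in> borel_measurable M" if "i < n" for i
    using model that by (auto simp: sub_gaussian_linear_model_def random_vec_def)
  have fm: "case_prod (f k) \<in> borel_measurable (M \<Otimes>\<^sub>M N)" for k
    unfolding f_def[abs_def] noise_quad_eq lin_def N_def by measurable
  define F where "F k w = (\<integral>\<^sup>+x. f k w x \<partial>N)" for k w
  have Fm [measurable]: "F k \<in> borel_measurable M" for k
    unfolding F_def[abs_def] by (rule N.borel_measurable_nn_integral[OF fm])
  \<comment> \<open>The average over counts becomes a sum over the countable support of
    \<open>P\<close>: measurability in \<open>w\<close> asks for a sigma-finite measure, which
    counting measure on all of \<open>nat \<Rightarrow> nat\<close> is not.\<close>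
  have eq: "noise_mix n p \<sigma> t G gr \<theta> v \<eta> (X w) (\<epsilon> w) = (\<integral>\<^sup>+k. ennreal (pmf P k) * F k w \<partial>count_space (set_pmf P))" for w
  proof -
    have "noise_mix n p \<sigma> t G gr \<theta> v \<eta> (X w) (\<epsilon> w) = (\<integral>\<^sup>+k. F k w \<partial>measure_pmf P)"
      unfolding noise_mix_def mix_exp_def F_def f_def noise_quad_def P_def N_def ..
    also have "\<dots> = (\<integral>\<^sup>+k. ennreal (pmf P k) * F k w \<partial>count_space UNIV)"
      by (rule nn_integral_measure_pmf)
    also have "\<dots> = (\<integral>\<^sup>+k. ennreal (pmf P k) * F k w \<partial>count_space (set_pmf P))"
      by (rule nn_integral_count_space_eq) (auto simp: set_pmf_iff)
    finally show ?thesis .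
  qed
  interpret C: sigma_finite_measure "count_space (set_pmf P)"
    by (rule sigma_finite_measure_count_space_countable) simp
  show ?meas
    unfolding eq
  proof (rule C.borel_measurable_nn_integral)
    have "(\<lambda>(k, w). ennreal (pmf P k) * F k w) \<in> borel_measurable (count_space (set_pmf P) \<Otimes>\<^sub>M M)"
      by (rule measurable_pair_measure_countable1) auto
    then show "(\<lambda>(w, k). ennreal (pmf P k) * F k w) \<in> borel_measurable (M \<Otimes>\<^sub>M count_space (set_pmf P))"
      by (subst measurable_pair_swap_iff) (simp add: case_prod_beta')
  qed
  have F1: "(\<integral>\<^sup>+w. F k w \<partial>M) \<le> 1" for k
  proof -
    have "(\<integral>\<^sup>+w. F k w \<partial>M) = (\<integral>\<^sup>+x. \<integral>\<^sup>+w. f k w x \<partial>M \<partial>N)"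
      unfolding F_def by (rule MN.Fubini'[OF fm, symmetric])
    also have "\<dots> \<le> (\<integral>\<^sup>+x. 1 \<partial>N)"
      unfolding f_def by (intro nn_integral_mono noise_quad_exp_le_1[OF model])
    also have "\<dots> = 1" using N.emeasure_space_1 by simp
    finally show ?thesis .
  qed
  have "(\<integral>\<^sup>+w. noise_mix n p \<sigma> t G gr \<theta> v \<eta> (X w) (\<epsilon> w) \<partial>M)
      = (\<integral>\<^sup>+k. \<integral>\<^sup>+w. ennreal (pmf P k) * F k w \<partial>M \<partial>count_space (set_pmf P))"
    unfolding eq by (rule nn_integral_count_space_nn_integral) auto
  also have "\<dots> \<le> (\<integral>\<^sup>+k. ennreal (pmf P k) \<partial>count_space (set_pmf P))"
  proof (rule nn_integral_mono)
    fix k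
    have "(\<integral>\<^sup>+w. ennreal (pmf P k) * F k w \<partial>M) = ennreal (pmf P k) * (\<integral>\<^sup>+w. F k w \<partial>M)"
      by (rule nn_integral_cmult[OF Fm])
    also have "\<dots> \<le> ennreal (pmf P k) * 1" by (intro mult_left_mono F1) simp
    finally have "(\<integral>\<^sup>+w. ennreal (pmf P k) * F k w \<partial>M) \<le> ennreal (pmf P k) * 1" .
    then show "(\<integral>\<^sup>+w. ennreal (pmf P k) * F k w \<partial>M) \<le> ennreal (pmf P k)" by simp
  qed
  also have "\<dots> = 1" by (simp add: nn_integral_pmf measure_pmf.emeasure_eq_1_AE AE_measure_pmf)
  finally show ?le .
qed

section \<open>Calibration of the prior and the uniform noise bound\<close>

text \<open>The step size \<open>\<eta>\<close> and the variances \<open>v\<close> balance the costs of \<open>mix_exp_lower\<close>.\<close>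

lemma mix_cost:
  fixes \<sigma> L n m :: real
  assumes pos: "\<sigma> > 0" "L > 0" "n > 0" "m > 0"
  defines "\<eta> \<equiv> 2 * \<sigma> * sqrt (2 * L / n)" and "v \<equiv> 1 / sqrt (2 * L * m)" and "t \<equiv> 1 / (2 * \<sigma>\<^sup>2)"
  shows "(L + (1 / v + t\<^sup>2 * \<sigma>\<^sup>2 * n * m * v * \<eta>\<^sup>2) / 2) / \<eta> + t\<^sup>2 * \<sigma>\<^sup>2 * n / 2 * \<eta>
    = t * (\<sigma> * (sqrt (2 * n * L) + sqrt (n * m)))"
proof -
  \<comment> \<open>In these roots the four costs are rational: the count and the rounding cost
    \<open>a * c / (4 * \<sigma>)\<close> each, the shift and the spread
    \<open>c * q / (4 * \<sigma>)\<close> each.\<close>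
  define a c q where "a = sqrt (2 * L)" and "c = sqrt n" and "q = sqrt m"
  have acq: "a > 0" "c > 0" "q > 0" using pos by (auto simp: a_def c_def q_def)
  have L: "L = a\<^sup>2 / 2" and n: "n = c\<^sup>2" and m: "m = q\<^sup>2" using pos by (auto simp: a_def c_def q_def)
  have e: "\<eta> = 2 * \<sigma> * a / c" unfolding \<eta>_def a_def c_def by (simp add: real_sqrt_divide)
  have v: "v = 1 / (a * q)" unfolding v_def a_def q_def by (simp add: real_sqrt_mult)
  have s1: "sqrt (2 * n * L) = c * a" unfolding c_def a_def by (simp add: real_sqrt_mult)
  have s2: "sqrt (n * m) = c * q" unfolding c_def q_def by (simp add: real_sqrt_mult)
  show ?thesis
    unfolding s1 s2 t_def e v using acq pos unfolding L n m
    by (simp add: field_simps power2_eq_square)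
qed

text \<open>Taking the logarithm of the mixture bound and dividing by \<open>t\<close> leaves a
  single residual free of \<open>h\<close>: the logarithm of the mixture plus that of the lost
  normalisation.\<close>

lemma noise_bound:
  assumes model: "sub_gaussian_linear_model M n p \<sigma> X \<beta> \<epsilon> y"
    and gr: "\<And>j. j < p \<Longrightarrow> gr j < G" and ne: "\<And>g. g < G \<Longrightarrow> \<exists>j<p. gr j = g"
    and s: "1 \<le> s" "s \<le> G"
    and op: "AE w in M. \<forall>g<G. \<forall>u. (\<Sum>i<n. (\<Sum>j | j < p \<and> gr j = g. X w $$ (i, j) * u j)\<^sup>2)
       \<le> real n * (\<Sum>j | j < p \<and> gr j = g. (u j)\<^sup>2)"
  defines "L \<equiv> ln (2 * real G * exp 1 / real s)"
  obtains W where "integrable M W" "(\<integral>w. W w \<partial>M) \<le> \<sigma>\<^sup>2 * real s"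
    "AE w in M. \<forall>h. (\<Sum>i<n. \<epsilon> w $ i * lin p (\<lambda>i j. X w $$ (i, j)) h i)
       \<le> 1 / 4 * (\<Sum>i<n. (lin p (\<lambda>i j. X w $$ (i, j)) h i)\<^sup>2) + W w
         + (\<Sum>g<G. \<sigma> * (sqrt (2 * real n * L) + sqrt (real n * real (card {j. j < p \<and> gr j = g}))) * group_norm p gr h g)"
proof -
  interpret prob_space M using model by (simp add: sub_gaussian_linear_model_def)
  have n: "n > 0" and \<sigma>: "\<sigma> > 0" using model by (auto simp: sub_gaussian_linear_model_def)
  define \<theta> where "\<theta> = real s / (2 * real G * exp 1)"
  have e2: "exp 1 \<ge> (2::real)" using exp_ge_add_one_self[of 1] by simp
  have G: "G > 0" using s by simp
  have \<theta>0: "\<theta> > 0" using s G by (simp add: \<theta>_def)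
  have "\<theta> \<le> real G / (2 * real G * exp 1)" unfolding \<theta>_def using s by (intro divide_right_mono) auto
  also have "\<dots> = 1 / (2 * exp 1)" using G by simp
  also have "\<dots> \<le> 1 / 2" using e2 by (simp add: field_simps)
  finally have \<theta>h: "\<theta> \<le> 1 / 2" .
  have L\<theta>: "L = ln (1 / \<theta>)" by (simp add: L_def \<theta>_def)
  have L: "L > 0" unfolding L\<theta> using \<theta>0 \<theta>h by simp
  define t where "t = 1 / (2 * \<sigma>\<^sup>2)"
  define \<eta> where "\<eta> = 2 * \<sigma> * sqrt (2 * L / real n)"
  define m where "m g = real (card {j. j < p \<and> gr j = g})" for g
  define v where "v g = 1 / sqrt (2 * L * m g)" for g
  have m0: "m g > 0" if "g < G" for g
  proof -
    have "{j. j < p \<and> gr j = g} \<noteq> {}" using ne[OF that] by auto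
    then show ?thesis unfolding m_def by (simp add: card_gt_0_iff)
  qed
  have t: "t > 0" using \<sigma> by (simp add: t_def)
  define T where "T g = \<sigma> * (sqrt (2 * real n * L) + sqrt (real n * m g))" for g
  define Z where "Z w = noise_mix n p \<sigma> t G gr \<theta> v \<eta> (X w) (\<epsilon> w)" for w
  have Zm [measurable]: "Z \<in> borel_measurable M" and Z1: "(\<integral>\<^sup>+w. Z w \<partial>M) \<le> 1"
    unfolding Z_def using noise_mix[OF model] by auto
  have Zfin: "AE w in M. Z w \<noteq> \<infinity>"
    using Z1 by (intro nn_integral_PInf_AE) (auto simp: top_unique)
  define z where "z w = enn2real (Z w)" for w
  have znn: "0 \<le> z w" for w by (simp add: z_def)
  have zm [measurable]: "z \<in> borel_measurable M" unfolding z_def by measurable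
  have zint: "(\<integral>\<^sup>+w. ennreal (z w) \<partial>M) = (\<integral>\<^sup>+w. Z w \<partial>M)"
    using Zfin by (intro nn_integral_cong_AE) (auto simp: z_def less_top[symmetric] elim!: eventually_mono)
  have zi: "integrable M z"
    using zint Z1 by (intro integrableI_nonneg) (auto simp: z_def le_less_trans)
  have "ennreal (\<integral>w. z w \<partial>M) = (\<integral>\<^sup>+w. ennreal (z w) \<partial>M)"
    using nn_integral_eq_integral[OF zi] znn by simp
  also have "\<dots> \<le> 1" using zint Z1 by simp
  finally have zE: "(\<integral>w. z w \<partial>M) \<le> 1" by (simp only: ennreal_le_1)
  define c where "c = real G * ln (1 / (1 - \<theta>))"
  have pw: "exp c = (1 / (1 - \<theta>)) ^ G" unfolding c_def using \<theta>h by (simp add: exp_of_nat_mult)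
  have key: "AE w in M. z w > 0 \<and> (\<forall>h. noise_quad n p \<sigma> t (X w) (\<epsilon> w) h - t * (\<Sum>g<G. T g * group_norm p gr h g) \<le> ln (z w) + c)"
    using op Zfin
  proof eventually_elim
    case (elim w)
    have low: "ennreal ((1 - \<theta>) ^ G * exp (noise_quad n p \<sigma> t (X w) (\<epsilon> w) h - t * (\<Sum>g<G. T g * group_norm p gr h g))) \<le> Z w" for h
    proof -
      have "(\<Sum>g<G. ((ln (1 / \<theta>) + (1 / v g + t\<^sup>2 * \<sigma>\<^sup>2 * real n * real (card {j. j < p \<and> gr j = g}) * v g * \<eta>\<^sup>2) / 2) / \<eta>
            + t\<^sup>2 * \<sigma>\<^sup>2 * real n / 2 * \<eta>) * group_norm p gr h g) = (\<Sum>g<G. t * T g * group_norm p gr h g)"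
        using mix_cost[OF \<sigma> L, of "real n"] n m0 unfolding T_def \<eta>_def v_def t_def m_def[symmetric] L\<theta>[symmetric]
        by (intro sum.cong refl arg_cong2[of _ _ _ _ "(*)"]) auto
      moreover have "ennreal ((1 - \<theta>) ^ G * exp (noise_quad n p \<sigma> t (X w) (\<epsilon> w) h
          - (\<Sum>g<G. ((ln (1 / \<theta>) + (1 / v g + t\<^sup>2 * \<sigma>\<^sup>2 * real n * real (card {j. j < p \<and> gr j = g}) * v g * \<eta>\<^sup>2) / 2) / \<eta>
            + t\<^sup>2 * \<sigma>\<^sup>2 * real n / 2 * \<eta>) * group_norm p gr h g))) \<le> Z w"
        unfolding Z_def noise_mix_def noise_quad_def
        by (rule mix_exp_lower) (use \<theta>0 \<theta>h \<sigma> L n m0 gr elim in \<open>auto simp: \<eta>_def v_def\<close>)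
      ultimately show ?thesis by (simp add: sum_distrib_left mult.assoc)
    qed
    have low': "(1 - \<theta>) ^ G * exp (noise_quad n p \<sigma> t (X w) (\<epsilon> w) h - t * (\<Sum>g<G. T g * group_norm p gr h g)) \<le> z w" for h
    proof -
      have "Z w = ennreal (z w)" using elim unfolding z_def by (simp add: less_top)
      with low[of h] have "ennreal ((1 - \<theta>) ^ G * exp (noise_quad n p \<sigma> t (X w) (\<epsilon> w) h
          - t * (\<Sum>g<G. T g * group_norm p gr h g))) \<le> ennreal (z w)" by (simp only:)
      then show ?thesis by (simp only: ennreal_le_iff[OF znn])
    qed
    have p0: "(1 - \<theta>) ^ G > 0" using \<theta>h by simp
    \<comment> \<open>Any \<open>h\<close> serves here, since each gives a positive lower bound for
      the mixture.\<close>
    have "0 < (1 - \<theta>) ^ G * exp (noise_quad n p \<sigma> t (X w) (\<epsilon> w) undefined - t * (\<Sum>g<G. T g * group_norm p gr undefined g))"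
      using p0 by simp
    then have z0: "z w > 0" using low'[of undefined] by linarith
    have "noise_quad n p \<sigma> t (X w) (\<epsilon> w) h - t * (\<Sum>g<G. T g * group_norm p gr h g) \<le> ln (z w) + c" for h
    proof -
      have "exp (noise_quad n p \<sigma> t (X w) (\<epsilon> w) h - t * (\<Sum>g<G. T g * group_norm p gr h g)) \<le> z w * exp c"
        using low'[of h] p0 unfolding pw by (simp add: field_simps power_divide)
      also have "\<dots> = exp (ln (z w) + c)" using z0 by (simp add: exp_add)
      finally show ?thesis by simp
    qed
    with z0 show ?case by blast
  qed
  \<comment> \<open>The factor \<open>2 * \<sigma>^2\<close> is \<open>1 / t\<close>.\<close>
  define W where "W w = 2 * \<sigma>\<^sup>2 * (ln (z w) + c)" for w
  have bnd: "AE w in M. 0 \<le> W w \<and> W w \<le> 2 * \<sigma>\<^sup>2 * (z w - 1 + c)"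
    using key
  proof eventually_elim
    case (elim w)
    \<comment> \<open>At \<open>h = 0\<close> the left side of \<open>key\<close> is zero.\<close>
    have "0 \<le> ln (z w) + c"
      using elim[THEN conjunct2, THEN spec, of "\<lambda>_. 0"]
      by (simp add: noise_quad_def quad_def lin_def group_norm_def)
    moreover have "ln (z w) \<le> z w - 1" using elim by (intro ln_le_minus_one) simp
    ultimately show ?case unfolding W_def by (auto intro!: mult_left_mono)
  qed
  have Wi: "integrable M W"
  proof (rule Bochner_Integration.integrable_bound)
    show "integrable M (\<lambda>w. 2 * \<sigma>\<^sup>2 * (z w - 1 + c))" using zi by simp
    show "W \<in> borel_measurable M" unfolding W_def by measurable
    show "AE w in M. norm (W w) \<le> norm (2 * \<sigma>\<^sup>2 * (z w - 1 + c))" using bnd by eventually_elim auto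
  qed
  \<comment> \<open>The \<open>G\<close> normalisation costs add up to at most
    \<open>2 * G * \<theta> = s / e\<close>.\<close>
  have c: "c \<le> real s / 2"
  proof -
    have "ln (1 / (1 - \<theta>)) \<le> 1 / (1 - \<theta>) - 1" using \<theta>h by (intro ln_le_minus_one) simp
    also have "\<dots> = \<theta> / (1 - \<theta>)" using \<theta>h by (simp add: field_simps)
    also have "\<dots> \<le> \<theta> / (1 / 2)" using \<theta>h \<theta>0 by (intro divide_left_mono) auto
    finally have "c \<le> real G * (2 * \<theta>)" unfolding c_def using G by (intro mult_left_mono) auto
    also have "\<dots> = real s / exp 1" unfolding \<theta>_def using G by simp
    also have "\<dots> \<le> real s / 2" using e2 by (intro divide_left_mono) auto
    finally show ?thesis .
  qed
  have "(\<integral>w. W w \<partial>M) \<le> (\<integral>w. 2 * \<sigma>\<^sup>2 * (z w - 1 + c) \<partial>M)"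
    using Wi zi bnd by (intro integral_mono_AE) (auto elim: eventually_mono)
  also have "\<dots> = 2 * \<sigma>\<^sup>2 * ((\<integral>w. z w \<partial>M) - 1 + c)"
    using zi by (simp add: prob_space)
  also have "\<dots> \<le> 2 * \<sigma>\<^sup>2 * (real s / 2)" using zE c by (intro mult_left_mono) auto
  finally have WE: "(\<integral>w. W w \<partial>M) \<le> \<sigma>\<^sup>2 * real s" by simp
  have "AE w in M. \<forall>h. (\<Sum>i<n. \<epsilon> w $ i * lin p (\<lambda>i j. X w $$ (i, j)) h i)
       \<le> 1 / 4 * (\<Sum>i<n. (lin p (\<lambda>i j. X w $$ (i, j)) h i)\<^sup>2) + W w + (\<Sum>g<G. T g * group_norm p gr h g)"
    using key
  proof eventually_elim
    case (elim w)
    show ?case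
    proof
      fix h
      let ?B = "\<Sum>i<n. \<epsilon> w $ i * lin p (\<lambda>i j. X w $$ (i, j)) h i"
      let ?Q = "\<Sum>i<n. (lin p (\<lambda>i j. X w $$ (i, j)) h i)\<^sup>2"
      let ?R = "\<Sum>g<G. T g * group_norm p gr h g"
      have "2 * \<sigma>\<^sup>2 * (t * ?B - t\<^sup>2 * \<sigma>\<^sup>2 / 2 * ?Q - t * ?R) \<le> W w"
        unfolding W_def using elim unfolding noise_quad_eq by (intro mult_left_mono) auto
      moreover have "2 * \<sigma>\<^sup>2 * (t * ?B - t\<^sup>2 * \<sigma>\<^sup>2 / 2 * ?Q - t * ?R) = ?B - 1 / 4 * ?Q - ?R"
        unfolding t_def using \<sigma> by (simp add: field_simps power2_eq_square)
      ultimately show "?B \<le> 1 / 4 * ?Q + W w + ?R" by linarith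
    qed
  qed
  then show ?thesis using that[OF Wi WE] unfolding T_def m_def by blast
qed

section \<open>The highest eigenvalue\<close>

text \<open>Any finite constant will do, so absolute values of the entries are summed; the added
  \<open>1\<close> keeps the constant positive even for a zero matrix.\<close>

lemma mat_quadratic_form_bound:
  fixes D :: "real mat"
  assumes D: "D \<in> carrier_mat d d"
  obtains K where "K > 0" "\<And>v. v \<in> carrier_vec d \<Longrightarrow> v \<bullet> (D *\<^sub>v v) \<le> K * (v \<bullet> v)"
proof
  let ?K = "1 + (\<Sum>i<d. \<Sum>j<d. \<bar>D $$ (i, j)\<bar>)"
  show "?K > 0" by (simp add: add_pos_nonneg sum_nonneg)
  fix v :: "real vec" assume v: "v \<in> carrier_vec d"
  have vv: "v \<bullet> v = (\<Sum>i<d. (v $ i)\<^sup>2)"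
    using v by (simp add: scalar_prod_def power2_eq_square atLeast0LessThan)
  have le: "(v $ i)\<^sup>2 \<le> v \<bullet> v" if "i < d" for i
    unfolding vv using that by (intro member_le_sum) auto
  have ab: "v $ i * v $ j * D $$ (i, j) \<le> \<bar>D $$ (i, j)\<bar> * (v \<bullet> v)" if "i < d" "j < d" for i j
  proof -
    have "\<bar>v $ i\<bar> * \<bar>v $ j\<bar> \<le> ((v $ i)\<^sup>2 + (v $ j)\<^sup>2) / 2"
      using sum_squares_bound[of "\<bar>v $ i\<bar>" "\<bar>v $ j\<bar>"] by simp
    also have "\<dots> \<le> v \<bullet> v" using le[of i] le[of j] that by simp
    finally have "\<bar>D $$ (i, j)\<bar> * (\<bar>v $ i\<bar> * \<bar>v $ j\<bar>) \<le> \<bar>D $$ (i, j)\<bar> * (v \<bullet> v)"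
      by (intro mult_left_mono) auto
    moreover have "v $ i * v $ j * D $$ (i, j) \<le> \<bar>v $ i * v $ j * D $$ (i, j)\<bar>" by simp
    ultimately show ?thesis by (simp add: abs_mult mult_ac)
  qed
  have "v \<bullet> (D *\<^sub>v v) = (\<Sum>i<d. \<Sum>j<d. v $ i * v $ j * D $$ (i, j))"
    using v D by (simp add: scalar_prod_def sum_distrib_left atLeast0LessThan mult_ac)
  also have "\<dots> \<le> (\<Sum>i<d. \<Sum>j<d. \<bar>D $$ (i, j)\<bar> * (v \<bullet> v))"
    by (intro sum_mono ab) auto
  also have "\<dots> = (\<Sum>i<d. \<Sum>j<d. \<bar>D $$ (i, j)\<bar>) * (v \<bullet> v)"
    by (simp add: sum_distrib_right)
  also have "\<dots> \<le> ?K * (v \<bullet> v)" by (intro mult_right_mono) (auto simp: vv sum_nonneg)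
  finally show "v \<bullet> (D *\<^sub>v v) \<le> ?K * (v \<bullet> v)" .
qed

text \<open>If \<open>m\<close> is the supremum of the Rayleigh quotients and is not an eigenvalue, then \<open>m I - A\<close> is
  positive semidefinite and invertible, hence bounded below by a positive multiple of the identity,
  which contradicts the choice of \<open>m\<close>. This avoids compactness of the unit sphere.\<close>

lemma quadratic_form_le_mu_max:
  fixes A :: "real mat"
  assumes A: "A \<in> carrier_mat d d" and sym: "transpose_mat A = A" and v: "v \<in> carrier_vec d"
  shows "v \<bullet> (A *\<^sub>v v) \<le> mu_max A * (v \<bullet> v)"
proof (cases "v = 0\<^sub>v d")
  case True
  then show ?thesis using A by simp
next
  case False
  have pos: "u \<bullet> u > 0" if "u \<in> carrier_vec d" "u \<noteq> 0\<^sub>v d" for u :: "real vec"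
  proof -
    have "\<exists>i<d. u $ i \<noteq> 0"
    proof (rule ccontr)
      assume "\<not> (\<exists>i<d. u $ i \<noteq> 0)"
      then have "u = 0\<^sub>v d" using that(1) by (intro eq_vecI) auto
      with that(2) show False ..
    qed
    then obtain i where i: "i < d" "u $ i \<noteq> 0" by blast
    have "u \<bullet> u = (\<Sum>i<d. (u $ i)\<^sup>2)"
      using that by (simp add: scalar_prod_def power2_eq_square atLeast0LessThan)
    also have "\<dots> > 0" using i by (intro sum_pos2[of _ i]) auto
    finally show ?thesis .
  qed
  obtain K where K: "K > 0" "\<And>v. v \<in> carrier_vec d \<Longrightarrow> v \<bullet> (A *\<^sub>v v) \<le> K * (v \<bullet> v)"
    using mat_quadratic_form_bound[OF A] by blast
  define R where "R = {u \<bullet> (A *\<^sub>v u) / (u \<bullet> u) | u. u \<in> carrier_vec d \<and> u \<noteq> 0\<^sub>v d}"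
  have bdd: "bdd_above R"
    unfolding R_def using K(2) pos by (intro bdd_aboveI[of _ K]) (auto simp: divide_le_eq)
  have ne: "R \<noteq> {}" using False v unfolding R_def by blast
  define m where "m = Sup R"
  have m: "u \<bullet> (A *\<^sub>v u) \<le> m * (u \<bullet> u)" if "u \<in> carrier_vec d" for u
  proof (cases "u = 0\<^sub>v d")
    case False
    then have "u \<bullet> (A *\<^sub>v u) / (u \<bullet> u) \<le> m"
      unfolding m_def using that by (intro cSup_upper bdd) (auto simp: R_def)
    then show ?thesis using pos[OF that False] by (simp add: divide_le_eq)
  qed (use A in simp)
  have "eigenvalue A m"
  proof (rule ccontr)
    assume no: "\<not> eigenvalue A m"
    define C where "C = m \<cdot>\<^sub>m 1\<^sub>m d - A"
    have C: "C \<in> carrier_mat d d" unfolding C_def by (rule minus_carrier_mat[OF A])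
    have Cu: "C *\<^sub>v u = m \<cdot>\<^sub>v u - A *\<^sub>v u" if "u \<in> carrier_vec d" for u
      using A that unfolding C_def by (subst minus_mult_distrib_mat_vec[of _ d d]) auto
    have Csym: "transpose_mat C = C"
    proof (rule eq_matI)
      fix i j assume "i < dim_row C" "j < dim_col C"
      then have ij: "i < d" "j < d" using C by auto
      have "A $$ (j, i) = A $$ (i, j)" using arg_cong[OF sym, of "\<lambda>B. B $$ (i, j)"] A ij by simp
      then show "transpose_mat C $$ (i, j) = C $$ (i, j)" using A ij C by (simp add: C_def)
    qed (use C in auto)
    have "det C \<noteq> 0"
    proof
      assume "det C = 0"
      then obtain u where u: "u \<in> carrier_vec d" "u \<noteq> 0\<^sub>v d" "C *\<^sub>v u = 0\<^sub>v d"
        using det_0_iff_vec_prod_zero_field[OF C] by blast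
      have "A *\<^sub>v u = m \<cdot>\<^sub>v u"
      proof (rule eq_vecI)
        fix i assume i: "i < dim_vec (m \<cdot>\<^sub>v u)"
        then have "(m \<cdot>\<^sub>v u - A *\<^sub>v u) $ i = 0" using u Cu[OF u(1)] by simp
        then show "(A *\<^sub>v u) $ i = (m \<cdot>\<^sub>v u) $ i" using i A u(1) by simp
      qed (use A u in auto)
      then have "eigenvector A u m" using u A by (simp add: eigenvector_def)
      then show False using no by (auto simp: eigenvalue_def)
    qed
    from det_non_zero_imp_unit[OF C this, of "()"] obtain D where D: "D \<in> carrier_mat d d" "C * D = 1\<^sub>m d"
      unfolding Units_def ring_mat_def by auto
    obtain L where L: "L > 0" "\<And>v. v \<in> carrier_vec d \<Longrightarrow> v \<bullet> (D *\<^sub>v v) \<le> L * (v \<bullet> v)"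
      using mat_quadratic_form_bound[OF D(1)] by blast
    have psd: "u \<bullet> (C *\<^sub>v u) = m * (u \<bullet> u) - u \<bullet> (A *\<^sub>v u)" if u: "u \<in> carrier_vec d" for u
      unfolding Cu[OF u] using u A by (subst scalar_prod_minus_distrib[of _ d]) auto
    have low: "u \<bullet> (A *\<^sub>v u) \<le> (m - 1 / L) * (u \<bullet> u)" if u: "u \<in> carrier_vec d" for u
    proof -
      define w where "w = D *\<^sub>v u"
      \<comment> \<open>Positivity of the form of \<open>C\<close> is tested at
        \<open>u - x\<close>, where \<open>x\<close> is the preimage of \<open>u\<close> under
        \<open>C\<close> divided by \<open>L\<close>. The cross terms give \<open>- 2 / L\<close>
        and the square at most \<open>1 / L\<close>, so the form of \<open>C\<close> at
        \<open>u\<close> is at least \<open>1 / L\<close> times the squared norm.\<close>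
      define x where "x = (1 / L) \<cdot>\<^sub>v w"
      have w: "w \<in> carrier_vec d" and x: "x \<in> carrier_vec d" using D u by (auto simp: w_def x_def)
      have Cw: "C *\<^sub>v w = u"
        unfolding w_def using D u C by (simp add: assoc_mult_mat_vec[symmetric, of _ d d _ d])
      have Cx: "C *\<^sub>v x = (1 / L) \<cdot>\<^sub>v u"
        unfolding x_def using C w by (simp add: mult_mat_vec Cw)
      have xCu: "x \<bullet> (C *\<^sub>v u) = (1 / L) * (u \<bullet> u)"
        using transpose_vec_mult_scalar[OF C u x] Csym Cx u by simp
      have wu: "w \<bullet> u \<le> L * (u \<bullet> u)"
        using L(2)[OF u] comm_scalar_prod[OF w u] by (simp add: w_def)
      have xu: "x \<bullet> u = (1 / L) * (w \<bullet> u)" unfolding x_def using w u by simp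
      have Cu': "C *\<^sub>v u \<in> carrier_vec d" using C u by simp
      have "(u - x) \<bullet> (C *\<^sub>v (u - x)) = (u - x) \<bullet> (C *\<^sub>v u - (1 / L) \<cdot>\<^sub>v u)"
        using C u x by (simp add: mult_minus_distrib_mat_vec Cx)
      also have "\<dots> = u \<bullet> (C *\<^sub>v u) - (1 / L) * (u \<bullet> u) - (x \<bullet> (C *\<^sub>v u) - (1 / L) * (x \<bullet> u))"
        using u x Cu' by (simp add: minus_scalar_prod_distrib[of _ d] scalar_prod_minus_distrib[of _ d] diff_divide_distrib)
      also have "\<dots> = u \<bullet> (C *\<^sub>v u) - 2 / L * (u \<bullet> u) + (1 / L)\<^sup>2 * (w \<bullet> u)"
        unfolding xCu xu by (simp add: power2_eq_square)
      also have "\<dots> \<le> u \<bullet> (C *\<^sub>v u) - 2 / L * (u \<bullet> u) + (1 / L)\<^sup>2 * (L * (u \<bullet> u))"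
        using wu by (intro add_left_mono mult_left_mono) auto
      also have "\<dots> = u \<bullet> (C *\<^sub>v u) - 1 / L * (u \<bullet> u)"
        using L(1) by (simp add: power2_eq_square field_simps)
      finally have "(u - x) \<bullet> (C *\<^sub>v (u - x)) \<le> u \<bullet> (C *\<^sub>v u) - 1 / L * (u \<bullet> u)" .
      moreover have "(u - x) \<bullet> (C *\<^sub>v (u - x)) \<ge> 0"
        using psd[of "u - x"] m[of "u - x"] u x by simp
      ultimately show ?thesis using psd[OF u] by (simp add: algebra_simps)
    qed
    have "Sup R \<le> m - 1 / L"
    proof (rule cSup_least[OF ne])
      fix r assume "r \<in> R"
      then obtain u where u: "u \<in> carrier_vec d" "u \<noteq> 0\<^sub>v d" "r = u \<bullet> (A *\<^sub>v u) / (u \<bullet> u)"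
        unfolding R_def by blast
      then show "r \<le> m - 1 / L" using low[OF u(1)] pos[OF u(1,2)] by (simp add: divide_le_eq)
    qed
    then show False using L(1) by (simp add: m_def[symmetric])
  qed
  then have "m \<in> spectrum A" by (simp add: spectrum_def)
  then have "m \<le> mu_max A" unfolding mu_max_def by (intro Max_ge card_finite_spectrum(1)[OF A])
  then have "m * (v \<bullet> v) \<le> mu_max A * (v \<bullet> v)" using pos[OF v False] by (intro mult_right_mono) auto
  with m[OF v] show ?thesis by linarith
qed

text \<open>Surjectivity comes from counting the smaller elements, injectivity then from
  cardinalities. It carries sums over \<open>I\<close> to sums over the column indices of a
  submatrix.\<close>

lemma bij_betw_pick:
  assumes "finite I"
  shows "bij_betw (pick I) {..<card I} I"
proof -
  have sub: "I \<subseteq> pick I ` {..<card I}"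
  proof
    fix i assume i: "i \<in> I"
    have "card {a \<in> I. a < i} < card I"
    proof (rule psubset_card_mono[OF assms])
      show "{a \<in> I. a < i} \<subset> I" using i less_irrefl by blast
    qed
    then have "pick I (card {a \<in> I. a < i}) \<in> pick I ` {..<card I}" by (intro imageI) (rule lessThan_iff[THEN iffD2])
    then show "i \<in> pick I ` {..<card I}" unfolding pick_card_in_set[OF i] .
  qed
  have "card (pick I ` {..<card I}) \<le> card I" using card_image_le[of "{..<card I}" "pick I"] by simp
  with sub have im: "I = pick I ` {..<card I}" by (intro card_seteq finite_imageI finite_lessThan)
  have "card (pick I ` {..<card I}) = card {..<card I}" using arg_cong[OF im, of card] by (simp only: card_lessThan)
  then have "inj_on (pick I) {..<card I}" by (intro eq_card_imp_inj_on finite_lessThan)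
  then show ?thesis unfolding bij_betw_def by (intro conjI im[symmetric])
qed

text \<open>The left side is the quadratic form of the Gram matrix of the selected columns. This
  turns the eigenvalue hypothesis into the coordinate form used by the noise bound, indexed by
  \<open>I\<close> itself.\<close>

lemma columns_of_quadratic_bound:
  assumes X: "X \<in> carrier_mat n p" and I: "I \<subseteq> {..<p}"
    and N: "mu_max (transpose_mat (columns_of X I) * columns_of X I) \<le> N"
  shows "(\<Sum>i<n. (\<Sum>j\<in>I. X $$ (i, j) * u j)\<^sup>2) \<le> N * (\<Sum>j\<in>I. (u j)\<^sup>2)"
proof -
  have fin: "finite I" using I finite_subset by blast
  define B where "B = columns_of X I"
  define d where "d = card I"
  have set: "{j. j < dim_col X \<and> j \<in> I} = I" "{i. i < dim_row X \<and> i \<in> UNIV} = {..<n}" using I X by auto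
  have B: "B \<in> carrier_mat n d"
    unfolding B_def columns_of_def d_def by (rule carrier_matI) (simp_all add: dim_submatrix set del: Collect_conj_eq UNIV_I)
  have Bij: "B $$ (i, l) = X $$ (i, pick I l)" if "i < n" "l < d" for i l
    using that unfolding B_def columns_of_def d_def
    by (subst submatrix_index) (simp_all add: set pick_UNIV del: UNIV_I)
  define v where "v = vec d (\<lambda>l. u (pick I l))"
  have v: "v \<in> carrier_vec d" by (simp add: v_def)
  have bij: "bij_betw (pick I) {..<d} I" unfolding d_def by (rule bij_betw_pick[OF fin])
  have vv: "v \<bullet> v = (\<Sum>j\<in>I. (u j)\<^sup>2)"
    using sum.reindex_bij_betw[OF bij, of "\<lambda>j. (u j)\<^sup>2"]
    by (simp add: v_def scalar_prod_def power2_eq_square atLeast0LessThan)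
  have Bv: "(B *\<^sub>v v) $ i = (\<Sum>j\<in>I. X $$ (i, j) * u j)" if "i < n" for i
    using sum.reindex_bij_betw[OF bij, of "\<lambda>j. X $$ (i, j) * u j"] that B
    by (simp add: v_def scalar_prod_def atLeast0LessThan Bij)
  have "(\<Sum>i<n. (\<Sum>j\<in>I. X $$ (i, j) * u j)\<^sup>2) = (B *\<^sub>v v) \<bullet> (B *\<^sub>v v)"
    using B by (simp add: scalar_prod_def[of "B *\<^sub>v v"] power2_eq_square atLeast0LessThan Bv
        del: index_mult_mat_vec)
  also have "\<dots> = v \<bullet> ((transpose_mat B * B) *\<^sub>v v)"
    using B v transpose_vec_mult_scalar[OF B v, of "B *\<^sub>v v"]
      comm_scalar_prod[of "transpose_mat B *\<^sub>v (B *\<^sub>v v)" d v]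
    by (simp add: assoc_mult_mat_vec[of _ d n _ d])
  also have "\<dots> \<le> mu_max (transpose_mat B * B) * (v \<bullet> v)"
    using B v by (intro quadratic_form_le_mu_max) (auto simp: transpose_mult[of _ d n _ d])
  also have "\<dots> \<le> N * (v \<bullet> v)"
    using N unfolding B_def[symmetric] by (intro mult_right_mono) (auto simp: vv sum_nonneg)
  finally show ?thesis unfolding vv .
qed

section \<open>Deterministic error bound\<close>

definition top_set :: "'a set \<Rightarrow> ('a \<Rightarrow> real) \<Rightarrow> 'a set \<Rightarrow> bool" where
  "top_set U r T \<longleftrightarrow> T \<subseteq> U \<and> (\<forall>g\<in>T. \<forall>g'\<in>U - T. r g' \<le> r g)"

lemma top_set_exists:
  assumes U: "finite U" and s: "s \<le> card U"
  obtains T where "top_set U r T" "card T = s"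
proof -
  have "\<exists>T. top_set U r T \<and> card T = s"
    using s
  proof (induction s)
    case 0
    then show ?case by (intro exI[of _ "{}"]) (simp add: top_set_def)
  next
    case (Suc s)
    then obtain T where T: "top_set U r T" "card T = s" by auto
    then have fT: "finite T" using U by (auto simp: top_set_def intro: finite_subset)
    have ne: "U - T \<noteq> {}"
    proof
      assume "U - T = {}"
      then have "card U \<le> card T" using fT by (intro card_mono) auto
      then show False using Suc.prems T by simp
    qed
    obtain m where m: "m \<in> U - T" "\<And>g. g \<in> U - T \<Longrightarrow> r g \<le> r m"
      using obtains_MAX[of "U - T" r] U ne by (metis Max_ge finite_Diff finite_imageI image_eqI)
    have "top_set U r (insert m T)" using T m by (auto simp: top_set_def)
    moreover have "card (insert m T) = Suc s" using fT m T by simp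
    ultimately show ?case by blast
  qed
  then show ?thesis using that by blast
qed

text \<open>\<open>S - T\<close> and \<open>T - S\<close> have the same size, and the least value on
  \<open>T - S\<close> separates the values on the two.\<close>

lemma sum_le_sum_top_set:
  assumes U: "finite U" and T: "top_set U r T" and S: "S \<subseteq> U" "card S = card T"
  shows "sum r S \<le> sum r T"
proof -
  have fin: "finite S" "finite T" using assms by (auto simp: top_set_def intro: finite_subset)
  have c: "card (S - T) = card (T - S)"
    using S(2) card_Diff_subset_Int[of S T] card_Diff_subset_Int[of T S] fin by (simp add: Int_commute)
  have "sum r (S - T) \<le> sum r (T - S)"
  proof (cases "T - S = {}")
    case True
    then have "S - T = {}" using c fin by (metis card_0_eq card.empty finite_Diff)
    with True show ?thesis by (metis order_refl)
  next
    case False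
    define \<rho> where "\<rho> = Min (r ` (T - S))"
    have "sum r (S - T) \<le> of_nat (card (S - T)) * \<rho>"
    proof (rule sum_bounded_above)
      fix g assume "g \<in> S - T"
      moreover have "\<rho> \<in> r ` (T - S)" unfolding \<rho>_def using False fin by (intro Min_in) auto
      ultimately show "r g \<le> \<rho>" using T S by (auto simp: top_set_def)
    qed
    also have "\<dots> \<le> sum r (T - S)"
      unfolding c by (rule sum_bounded_below) (use fin in \<open>auto simp: \<rho>_def\<close>)
    finally show ?thesis .
  qed
  then show ?thesis
    using sum.Int_Diff[OF fin(1), of r T] sum.Int_Diff[OF fin(2), of r S] by (simp add: Int_commute)
qed

lemma sum_le_sqrt_card:
  fixes r :: "'a \<Rightarrow> real"
  assumes "\<And>g. g \<in> T \<Longrightarrow> r g \<ge> 0"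
  shows "sum r T \<le> sqrt (real (card T)) * sqrt (\<Sum>g\<in>T. (r g)\<^sup>2)"
proof -
  have "sum r T = (\<Sum>g\<in>T. \<bar>1\<bar> * \<bar>r g\<bar>)" using assms by (intro sum.cong) auto
  also have "\<dots> \<le> L2_set (\<lambda>_. 1) T * L2_set r T" by (rule L2_set_mult_ineq)
  finally show ?thesis by (simp add: L2_set_def)
qed

text \<open>A value outside \<open>T\<close> lies below every value inside, hence below their
  quadratic mean.\<close>

lemma top_set_tail:
  assumes U: "finite U" and T: "top_set U r T" and r: "\<And>g. g \<in> U \<Longrightarrow> r g \<ge> 0" and g: "g \<in> U - T"
  shows "sqrt (real (card T)) * r g \<le> sqrt (\<Sum>g\<in>T. (r g)\<^sup>2)"
proof (rule real_le_rsqrt)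
  have "real (card T) * (r g)\<^sup>2 \<le> (\<Sum>g\<in>T. (r g)\<^sup>2)"
    by (rule sum_bounded_below) (use T r g in \<open>auto simp: top_set_def intro!: power_mono\<close>)
  then show "(sqrt (real (card T)) * r g)\<^sup>2 \<le> (\<Sum>g\<in>T. (r g)\<^sup>2)" by (simp add: power_mult_distrib)
qed

text \<open>The largest weights sit on \<open>A\<close>, the largest values on \<open>T\<close>, and
  the two sets are unrelated. Subtract the least weight \<open>\<mu>\<close> on \<open>A\<close>:
  the excess \<open>a - \<mu>\<close> can be positive only on \<open>A\<close>, where Cauchy-Schwarz
  applies and the norm over \<open>A\<close> is at most that over \<open>T\<close>; the constant
  part needs only \<open>\<mu> \<le> sqrt (m / s)\<close>. With group sizes as squared weights, the
  tail is thus charged an average size of the largest groups instead of the maximal size.\<close>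

lemma weighted_sum_bound:
  fixes r a :: "'a \<Rightarrow> real"
  assumes U: "finite U" and T: "top_set U r T" and A: "top_set U a A" and c: "card A = card T" "card T > 0"
    and r: "\<And>g. g \<in> U \<Longrightarrow> r g \<ge> 0" and a: "\<And>g. g \<in> U \<Longrightarrow> a g \<ge> 0"
    and m: "(\<Sum>g\<in>A. (a g)\<^sup>2) \<le> m"
  shows "(\<Sum>g\<in>U. a g * r g)
    \<le> sqrt (2 * m) * sqrt (\<Sum>g\<in>T. (r g)\<^sup>2) + sqrt (m / real (card T)) * (\<Sum>g\<in>U - T. r g)"
proof -
  let ?s = "real (card T)" and ?q = "sqrt (\<Sum>g\<in>T. (r g)\<^sup>2)"
  have sub: "T \<subseteq> U" "A \<subseteq> U" using T A by (auto simp: top_set_def)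
  have fin: "finite T" "finite A" using sub U by (auto intro: finite_subset)
  have neA: "A \<noteq> {}" using c by auto
  define \<mu> where "\<mu> = Min (a ` A)"
  have \<mu>in: "\<mu> \<in> a ` A" unfolding \<mu>_def using neA fin by (intro Min_in) auto
  have \<mu>A: "\<mu> \<le> a g" if "g \<in> A" for g unfolding \<mu>_def using that fin by (intro Min_le) auto
  have \<mu>0: "\<mu> \<ge> 0" using \<mu>in a sub by auto
  have \<mu>c: "a g \<le> \<mu>" if "g \<in> U - A" for g using \<mu>in A that by (auto simp: top_set_def)
  define V where "V = (\<Sum>g\<in>A. (a g - \<mu>)\<^sup>2)"
  have V0: "V \<ge> 0" by (simp add: V_def sum_nonneg)
  have sm: "?s * \<mu>\<^sup>2 \<le> m"
  proof -
    have "real (card A) * \<mu>\<^sup>2 \<le> (\<Sum>g\<in>A. (a g)\<^sup>2)"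
      by (rule sum_bounded_below) (use \<mu>A \<mu>0 in \<open>auto intro: power_mono\<close>)
    then show ?thesis using m c by simp
  qed
  \<comment> \<open>The mixed term in \<open>V\<close> is at least \<open>2 * s * \<mu>^2\<close>,
    so \<open>s * \<mu>^2\<close> and \<open>V\<close> share the budget \<open>m\<close>. Hence the
    coefficient \<open>sqrt (2 * m)\<close> below, and not \<open>2 * sqrt m\<close>.\<close>
  have "?s * \<mu> \<le> (\<Sum>g\<in>A. a g)" using sum_bounded_below[of A \<mu> a] \<mu>A c by simp
  then have "\<mu> * (?s * \<mu>) \<le> \<mu> * (\<Sum>g\<in>A. a g)" using \<mu>0 by (intro mult_left_mono)
  moreover have "V = (\<Sum>g\<in>A. (a g)\<^sup>2) - 2 * (\<mu> * (\<Sum>g\<in>A. a g)) + ?s * \<mu>\<^sup>2"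
    unfolding V_def using c
    by (simp add: power2_diff sum.distrib sum_subtractf sum_distrib_left mult_ac)
  ultimately have Vm: "?s * \<mu>\<^sup>2 + V \<le> m" using m by (simp add: power2_eq_square mult_ac)
  have "(sqrt ?s * \<mu> + sqrt V)\<^sup>2 \<le> 2 * (?s * \<mu>\<^sup>2 + V)"
    using sum_squares_bound[of "sqrt ?s * \<mu>" "sqrt V"] V0 by (simp add: power2_sum power_mult_distrib)
  then have "(sqrt ?s * \<mu> + sqrt V)\<^sup>2 \<le> 2 * m" using Vm by simp
  then have coef: "sqrt ?s * \<mu> + sqrt V \<le> sqrt (2 * m)" by (rule real_le_rsqrt)
  have mu: "\<mu> \<le> sqrt (m / ?s)" using sm c by (intro real_le_rsqrt) (simp add: le_divide_eq mult.commute)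
  have "(\<Sum>g\<in>U. (a g - \<mu>) * r g) = (\<Sum>g\<in>A. (a g - \<mu>) * r g) + (\<Sum>g\<in>U - A. (a g - \<mu>) * r g)"
    using sum.subset_diff[OF sub(2) U] by (metis add.commute)
  also have "(\<Sum>g\<in>U - A. (a g - \<mu>) * r g) \<le> 0"
    by (rule sum_nonpos) (use \<mu>c r in \<open>auto intro!: mult_nonpos_nonneg\<close>)
  also have "(\<Sum>g\<in>A. (a g - \<mu>) * r g) = (\<Sum>g\<in>A. \<bar>a g - \<mu>\<bar> * \<bar>r g\<bar>)"
    using \<mu>A r sub by (intro sum.cong) auto
  also have "\<dots> \<le> L2_set (\<lambda>g. a g - \<mu>) A * L2_set r A" by (rule L2_set_mult_ineq)
  also have "\<dots> \<le> sqrt V * ?q"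
  proof -
    have T2: "top_set U (\<lambda>g. (r g)\<^sup>2) T" using T r by (auto simp: top_set_def intro!: power_mono)
    show ?thesis unfolding L2_set_def V_def
      using sum_le_sum_top_set[OF U T2 sub(2) c(1)] by (intro mult_left_mono) (auto simp: sum_nonneg)
  qed
  finally have "(\<Sum>g\<in>U. (a g - \<mu>) * r g) \<le> sqrt V * ?q" by simp
  moreover have "(\<Sum>g\<in>U. a g * r g) = (\<Sum>g\<in>U. (a g - \<mu>) * r g) + \<mu> * (\<Sum>g\<in>U. r g)"
    by (simp add: sum_distrib_left sum.distrib[symmetric] algebra_simps)
  moreover have "\<mu> * (\<Sum>g\<in>U. r g) \<le> \<mu> * (sqrt ?s * ?q + (\<Sum>g\<in>U - T. r g))"
    using \<mu>0 sum.subset_diff[OF sub(1) U, of r] sum_le_sqrt_card[of T r] r sub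
    by (intro mult_left_mono) auto
  ultimately have "(\<Sum>g\<in>U. a g * r g) \<le> (sqrt ?s * \<mu> + sqrt V) * ?q + \<mu> * (\<Sum>g\<in>U - T. r g)"
    by (simp add: algebra_simps)
  also have "\<dots> \<le> sqrt (2 * m) * ?q + sqrt (m / ?s) * (\<Sum>g\<in>U - T. r g)"
    using coef mu r by (intro add_mono mult_right_mono) (auto intro!: sum_nonneg)
  finally show ?thesis .
qed

text \<open>Either the residual noise \<open>W\<close> is absorbed by the slack in \<open>lam\<close>, and the error lies in the cone
  of the \<open>s\<close> largest groups, or \<open>W\<close> already dominates the error.\<close>

lemma error_bound:
  fixes r :: "'a \<Rightarrow> real"
  assumes U: "finite U" and T: "top_set U r T" and S: "S \<subseteq> U" "card S = card T" and s: "card T > 0"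
    and r: "\<And>g. g \<in> U \<Longrightarrow> r g \<ge> 0"
    and pos: "n > 0" "\<alpha> \<ge> 2" "lam > 0" "\<kappa> > 0" "W \<ge> 0" "E \<ge> 0"
    and basic: "E / n \<le> 2 / n * B + lam * ((\<Sum>g\<in>S. r g) - (\<Sum>g\<in>U - S. r g))"
    and B: "B \<le> 1 / 4 * E + W + N"
    and N: "N \<le> 3 / 8 * (n * lam / \<alpha>) * (sqrt (card T) * sqrt (\<Sum>g\<in>T. (r g)\<^sup>2) + (\<Sum>g\<in>U - T. r g))"
    and re: "(\<Sum>g\<in>U - T. r g) \<le> \<alpha> / (\<alpha> - 1) * (\<Sum>g\<in>T. r g) + sqrt (card T) / (\<alpha> - 1) * sqrt (\<Sum>g\<in>T. (r g)\<^sup>2)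
      \<Longrightarrow> \<kappa> * (\<Sum>g\<in>U. (r g)\<^sup>2) \<le> E / n"
  shows "sqrt (\<Sum>g\<in>U. (r g)\<^sup>2) \<le> 3 * lam * sqrt (card T) / \<kappa> + 16 * \<alpha> * W / (n * lam * sqrt (card T))"
proof -
  define a b q H s' where "a = (\<Sum>g\<in>T. r g)" and "b = (\<Sum>g\<in>U - T. r g)"
    and "q = sqrt (\<Sum>g\<in>T. (r g)\<^sup>2)" and "H = (\<Sum>g\<in>U. (r g)\<^sup>2)" and "s' = sqrt (card T)"
  define F where "F = E / n"
  have basicF: "F \<le> 2 / n * B + lam * (sum r S - sum r (U - S))" using basic by (simp add: F_def)
  have sub: "T \<subseteq> U" using T by (simp add: top_set_def)
  have s0: "s' > 0" using s by (simp add: s'_def)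
  have q0: "q \<ge> 0" by (simp add: q_def sum_nonneg)
  have b0: "b \<ge> 0" unfolding b_def using r by (intro sum_nonneg) auto
  have H0: "H \<ge> 0" by (simp add: H_def sum_nonneg)
  have aq: "a \<le> s' * q" unfolding a_def q_def s'_def using r sub by (intro sum_le_sqrt_card) auto
  have qH: "q \<le> sqrt H" unfolding q_def H_def using U sub by (intro real_sqrt_le_mono sum_mono2) auto
  have tot: "sum r U = a + b" unfolding a_def b_def using sum.subset_diff[OF sub U, of r] by simp
  have totS: "sum r U = sum r S + sum r (U - S)" using sum.subset_diff[OF S(1) U, of r] by simp
  have SS: "sum r S \<le> a" unfolding a_def by (rule sum_le_sum_top_set[OF U T S])
  \<comment> \<open>The unknown set \<open>S\<close> is traded for \<open>T\<close>: with the total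
    fixed, the difference grows with the sum over the first set.\<close>
  have diff: "sum r S - sum r (U - S) \<le> a - b" using tot totS SS by linarith
  \<comment> \<open>Values off \<open>T\<close> are at most \<open>q / s'\<close>, so
    \<open>q\<close> and the tail sum \<open>b\<close> control the full norm.\<close>
  have Hq: "H \<le> q\<^sup>2 + q / s' * b"
  proof -
    have "H = (\<Sum>g\<in>T. (r g)\<^sup>2) + (\<Sum>g\<in>U - T. (r g)\<^sup>2)"
      unfolding H_def using sum.subset_diff[OF sub U, of "\<lambda>g. (r g)\<^sup>2"] by simp
    also have "(\<Sum>g\<in>T. (r g)\<^sup>2) = q\<^sup>2" by (simp add: q_def sum_nonneg)
    also have "(\<Sum>g\<in>U - T. (r g)\<^sup>2) \<le> (\<Sum>g\<in>U - T. q / s' * r g)"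
    proof (rule sum_mono)
      fix g assume g: "g \<in> U - T"
      have "r g \<le> q / s'"
        using top_set_tail[OF U T r g] s0 by (simp add: q_def s'_def le_divide_eq mult.commute)
      then have "r g * r g \<le> q / s' * r g" using r[of g] g by (intro mult_right_mono) auto
      then show "(r g)\<^sup>2 \<le> q / s' * r g" by (simp only: power2_eq_square)
    qed
    finally show ?thesis by (simp add: b_def sum_distrib_left)
  qed
  have "2 / n * B \<le> 2 / n * (1 / 4 * E + W + 3 / 8 * (n * lam / \<alpha>) * (s' * q + b))"
    using B N pos unfolding s'_def q_def b_def by (intro mult_left_mono) auto
  also have "\<dots> = F / 2 + 2 * W / n + 3 / 4 * (lam / \<alpha>) * (s' * q + b)"
    using pos by (simp add: F_def field_simps)
  \<comment> \<open>A quarter of \<open>E\<close> times \<open>2 / n\<close> is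
    \<open>F / 2\<close>; the other half of \<open>F\<close> stays on the left.\<close>
  finally have "F / 2 \<le> 2 * W / n + 3 / 4 * (lam / \<alpha>) * (s' * q + b) + lam * (a - b)"
    using basicF mult_left_mono[OF diff, of lam] pos by linarith
  also have "\<dots> = lam * (2 * W / (n * lam) + 3 / (4 * \<alpha>) * (s' * q + b) + (a - b))"
    using pos by (simp add: field_simps)
  finally have main: "F / 2 \<le> lam * (2 * W / (n * lam) + 3 / (4 * \<alpha>) * (s' * q + b) + (a - b))" .
  have "0 \<le> F / 2" using pos by (simp add: F_def)
  then have "0 \<le> lam * (2 * W / (n * lam) + 3 / (4 * \<alpha>) * (s' * q + b) + (a - b))" using main by (rule order_trans)
  then have zero: "0 \<le> 2 * W / (n * lam) + 3 / (4 * \<alpha>) * (s' * q + b) + (a - b)"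
    using pos by (simp add: zero_le_mult_iff)
  have \<alpha>: "3 / (4 * \<alpha>) \<le> 3 / 8" "1 / \<alpha> \<le> 1 / 2" using pos by (auto simp: field_simps)
  have sq: "s' * q \<ge> 0" using s0 q0 by simp
  show ?thesis
  \<comment> \<open>The noise takes \<open>3 / (4 * \<alpha>)\<close> of both \<open>s' * q\<close>
    and \<open>b\<close>. Below the threshold \<open>W\<close> adds at most the missing
    \<open>1 / (4 * \<alpha>)\<close> of \<open>s' * q\<close>, which produces exactly the cone
    constants \<open>\<alpha> / (\<alpha> - 1)\<close> and
    \<open>s' / (\<alpha> - 1)\<close>.\<close>
  proof (cases "2 * W / (n * lam) \<le> 1 / (4 * \<alpha>) * (s' * q)")
    case True
    have "1 / (4 * \<alpha>) * (s' * q) + 3 / (4 * \<alpha>) * (s' * q + b) = 1 / \<alpha> * (s' * q) + 3 / 4 * (1 / \<alpha> * b)"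
      using pos by (simp add: field_simps)
    moreover have "0 \<le> 1 / \<alpha> * b" using pos b0 by simp
    ultimately have "b - 1 / \<alpha> * b \<le> a + 1 / \<alpha> * (s' * q)" using zero True by linarith
    then have "\<alpha> * (b - 1 / \<alpha> * b) \<le> \<alpha> * (a + 1 / \<alpha> * (s' * q))"
      using pos by (intro mult_left_mono) auto
    then have "(\<alpha> - 1) * b \<le> \<alpha> * a + s' * q"
      using pos by (simp add: right_diff_distrib distrib_left left_diff_distrib)
    then have "b \<le> (\<alpha> * a + s' * q) / (\<alpha> - 1)" using pos by (simp add: le_divide_eq mult.commute)
    also have "\<dots> = \<alpha> / (\<alpha> - 1) * a + s' / (\<alpha> - 1) * q" by (simp add: add_divide_distrib)
    finally have "b \<le> \<alpha> / (\<alpha> - 1) * a + s' / (\<alpha> - 1) * q" .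
    then have "\<kappa> * H \<le> F" using re unfolding a_def b_def q_def s'_def H_def F_def by simp
    also have "\<dots> \<le> 2 * (lam * (1 / \<alpha> * (s' * q) + a))"
    proof -
      have "2 * W / (n * lam) + 3 / (4 * \<alpha>) * (s' * q + b) + (a - b) \<le> 1 / \<alpha> * (s' * q) + a"
      proof -
        have "3 / 4 * (1 / \<alpha> * b) \<le> b" using mult_right_mono[OF \<alpha>(2) b0] b0 by linarith
        then show ?thesis
          using True \<open>1 / (4 * \<alpha>) * (s' * q) + 3 / (4 * \<alpha>) * (s' * q + b) = _\<close> by linarith
      qed
      then have "lam * (2 * W / (n * lam) + 3 / (4 * \<alpha>) * (s' * q + b) + (a - b)) \<le> lam * (1 / \<alpha> * (s' * q) + a)"
        using pos by (intro mult_left_mono) auto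
      then show ?thesis using main by linarith
    qed
    also have "\<dots> \<le> 2 * (lam * (1 / 2 * (s' * q) + s' * q))"
      using \<alpha>(2) sq aq pos by (intro mult_left_mono add_mono mult_right_mono) auto
    also have "\<dots> \<le> 3 * lam * s' * sqrt H"
      using mult_left_mono[OF qH, of "3 * lam * s'"] pos s0 by (simp add: algebra_simps)
    finally have "\<kappa> * (sqrt H * sqrt H) \<le> 3 * lam * s' * sqrt H" using H0 by simp
    then have "(\<kappa> * sqrt H) * sqrt H \<le> (3 * lam * s') * sqrt H" by (simp add: mult_ac)
    then have "\<kappa> * sqrt H \<le> 3 * lam * s'"
    proof (cases "sqrt H = 0")
      case True
      then show ?thesis using pos s0 by simp
    next
      case False
      then have "sqrt H > 0" using H0 by simp
      with \<open>(\<kappa> * sqrt H) * sqrt H \<le> (3 * lam * s') * sqrt H\<close> show ?thesis by simp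
    qed
    then have "sqrt H \<le> 3 * lam * s' / \<kappa>" using pos by (simp add: field_simps)
    moreover have "0 \<le> 16 * \<alpha> * W / (n * lam * s')" using pos s0 by simp
    ultimately show ?thesis unfolding H_def s'_def by linarith
  next
    case False
    define R where "R = 8 * \<alpha> * W / (n * lam * s')"
    have R0: "R \<ge> 0" unfolding R_def using pos s0 by simp
    have sR0: "s' * R \<ge> 0" using R0 s0 by simp
    have sR: "s' * R = 8 * \<alpha> * W / (n * lam)" unfolding R_def using s0 by simp
    have "1 / (4 * \<alpha>) * (s' * q) \<le> 1 / (4 * \<alpha>) * (s' * R)" unfolding sR using False pos by (simp add: field_simps)
    then have "s' * q \<le> s' * R" using pos by (simp add: field_simps)
    then have qR: "q \<le> R" using s0 by simp
    have "2 * W / (n * lam) = 1 / \<alpha> * (s' * R / 4)" unfolding sR using pos by (simp add: field_simps)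
    also have "\<dots> \<le> 1 / 2 * (s' * R / 4)" using \<alpha>(2) s0 R0 by (intro mult_right_mono) auto
    finally have W: "2 * W / (n * lam) \<le> s' * R / 8" by simp
    have "3 / (4 * \<alpha>) * (s' * q + b) \<le> 3 / 8 * (s' * q + b)" using \<alpha>(1) sq b0 by (intro mult_right_mono) auto
    then have "b \<le> 3 * (s' * R)" using zero W aq \<open>s' * q \<le> s' * R\<close> sR0 by (simp add: distrib_left)
    have "q / s' * b \<le> R / s' * (3 * (s' * R))"
      using qR \<open>b \<le> 3 * (s' * R)\<close> s0 R0 b0 by (intro mult_mono divide_right_mono) auto
    also have "\<dots> = 3 * R\<^sup>2" using s0 by (simp add: power2_eq_square)
    finally have "H \<le> (2 * R)\<^sup>2" using Hq power_mono[OF qR q0, of 2] by (simp add: power_mult_distrib)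
    then have "sqrt H \<le> 2 * R" using R0 by (simp add: real_le_lsqrt)
    moreover have "0 \<le> 3 * lam * s' / \<kappa>" using pos s0 by simp
    ultimately show ?thesis unfolding H_def R_def s'_def by simp
  qed
qed

section \<open>Expected error of the Group Lasso\<close>

text \<open>The prior and the rounding ask for the group of a coordinate rather than the coordinates
  of a group, so the partition is inverted into a labelling.\<close>

lemma group_partition_index:
  assumes part: "group_partition p G I"
  obtains gr where "\<And>j. j < p \<Longrightarrow> gr j < G" "\<And>g. g < G \<Longrightarrow> I g = {j. j < p \<and> gr j = g}"
proof -
  have ex: "\<exists>g<G. j \<in> I g" if "j < p" for j
    using part that unfolding group_partition_def by blast
  define gr where "gr j = (SOME g. g < G \<and> j \<in> I g)" for j
  have gr: "gr j < G \<and> j \<in> I (gr j)" if "j < p" for j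
    unfolding gr_def using ex[OF that] by (rule someI_ex[of "\<lambda>g. g < G \<and> j \<in> I g"])
  have disj: "g = g'" if "g < G" "g' < G" "j \<in> I g" "j \<in> I g'" for g g' j
    using part that unfolding group_partition_def disjoint_family_on_def by blast
  have "I g = {j. j < p \<and> gr j = g}" if g: "g < G" for g
  proof (intro Set.set_eqI iffI)
    fix j assume j: "j \<in> I g"
    then have p: "j < p" using part g unfolding group_partition_def by blast
    have "gr j = g" by (rule disj[of _ _ j]) (use gr[OF p] g j in simp_all)
    with p show "j \<in> {j. j < p \<and> gr j = g}" by simp
  next
    fix j assume "j \<in> {j. j < p \<and> gr j = g}"
    then show "j \<in> I g" using gr[of j] by simp
  qed
  then show ?thesis using that gr by meson
qed

lemma mult_mat_vec_lin:
  assumes "A \<in> carrier_mat n p" "v \<in> carrier_vec p" "i < n"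
  shows "(A *\<^sub>v v) $ i = lin p (\<lambda>i j. A $$ (i, j)) (\<lambda>j. v $ j) i"
  using assms by (simp add: lin_def scalar_prod_def atLeast0LessThan)

lemma l2_norm_sq:
  "v \<in> carrier_vec n \<Longrightarrow> (l2_norm v)\<^sup>2 = (\<Sum>i<n. (v $ i)\<^sup>2)"
  by (simp add: l2_on_def L2_set_def sum_nonneg)

lemma design_ratio_eq:
  assumes X: "X \<in> carrier_mat n p" and z: "z \<in> carrier_vec p"
  shows "design_ratio n X z = (\<Sum>i<n. (lin p (\<lambda>i j. X $$ (i, j)) (\<lambda>j. z $ j) i)\<^sup>2) / (real n * (\<Sum>j<p. (z $ j)\<^sup>2))"
proof -
  have "z \<bullet> ((transpose_mat X * X) *\<^sub>v z) = (X *\<^sub>v z) \<bullet> (X *\<^sub>v z)"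
    using X z transpose_vec_mult_scalar[OF X z, of "X *\<^sub>v z"]
      comm_scalar_prod[of "transpose_mat X *\<^sub>v (X *\<^sub>v z)" p z]
    by (simp add: assoc_mult_mat_vec[of _ p n _ p])
  also have "\<dots> = (\<Sum>i<n. (lin p (\<lambda>i j. X $$ (i, j)) (\<lambda>j. z $ j) i)\<^sup>2)"
    using X by (simp add: scalar_prod_def[of "X *\<^sub>v z"] power2_eq_square atLeast0LessThan
        mult_mat_vec_lin[OF X z] del: index_mult_mat_vec)
  finally show ?thesis unfolding design_ratio_def l2_norm_sq[OF z] by simp
qed

text \<open>Multiplied out, the inequality holds at the zero vector too, which the infimum leaves
  out.\<close>

lemma group_lasso_re_le:
  assumes X: "X \<in> carrier_mat n p" and re: "ereal \<kappa> \<le> group_lasso_re n p G I s \<alpha> X"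
    and T: "T \<subseteq> {..<G}" "card T \<le> s" and n: "n > 0"
    and z: "z \<in> group_cone p G I T (\<alpha> / (\<alpha> - 1)) (sqrt (real s) / (\<alpha> - 1))"
  shows "\<kappa> * (\<Sum>j<p. (z $ j)\<^sup>2) \<le> (\<Sum>i<n. (lin p (\<lambda>i j. X $$ (i, j)) (\<lambda>j. z $ j) i)\<^sup>2) / real n"
proof (cases "z = 0\<^sub>v p")
  case True
  then show ?thesis by (simp add: lin_def)
next
  case False
  have zc: "z \<in> carrier_vec p" using z by (simp add: group_cone_def)
  have pos: "(\<Sum>j<p. (z $ j)\<^sup>2) > 0"
  proof -
    have "\<exists>j<p. z $ j \<noteq> 0"
    proof (rule ccontr)
      assume "\<not> (\<exists>j<p. z $ j \<noteq> 0)"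
      then have "z = 0\<^sub>v p" using zc by (intro eq_vecI) auto
      with False show False ..
    qed
    then obtain j where "j < p" "z $ j \<noteq> 0" by blast
    then show ?thesis by (intro sum_pos2[of _ j]) auto
  qed
  have "ereal \<kappa> \<le> ereal (design_ratio n X z)"
    using re unfolding group_lasso_re_def le_INF_iff using T z False by blast
  then show ?thesis
    unfolding design_ratio_eq[OF X zc] using pos n by (simp add: field_simps)
qed

text \<open>The objective at \<open>b\<close> is compared with that at \<open>\<beta>\<close>. Off
  \<open>J\<close> the vector \<open>\<beta>\<close> vanishes, so the penalty of \<open>b\<close>
  there is that of the error and enters with the favourable sign; on \<open>J\<close> the triangle
  inequality suffices.\<close>

lemma group_lasso_basic_inequality:
  assumes X: "X \<in> carrier_mat n p" and \<beta>: "\<beta> \<in> carrier_vec p" and \<epsilon>: "\<epsilon> \<in> carrier_vec n"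
    and y: "y = X *\<^sub>v \<beta> + \<epsilon>" and sol: "group_lasso_solution n p G I l X y b"
    and J: "J \<subseteq> {..<G}" "\<And>g j. g < G \<Longrightarrow> g \<notin> J \<Longrightarrow> j \<in> I g \<Longrightarrow> \<beta> $ j = 0" and l: "l \<ge> 0"
    and I: "\<And>g. g < G \<Longrightarrow> I g \<subseteq> {..<p}"
  defines "A \<equiv> \<lambda>i j. X $$ (i, j)"
  shows "(\<Sum>i<n. (lin p A (\<lambda>j. (b - \<beta>) $ j) i)\<^sup>2) / real n
     \<le> 2 / real n * (\<Sum>i<n. \<epsilon> $ i * lin p A (\<lambda>j. (b - \<beta>) $ j) i)
       + l * ((\<Sum>g\<in>J. l2_on (I g) (b - \<beta>)) - (\<Sum>g\<in>{..<G} - J. l2_on (I g) (b - \<beta>)))"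
proof -
  let ?h = "b - \<beta>" and ?l = "lin p A (\<lambda>j. (b - \<beta>) $ j)"
  have b: "b \<in> carrier_vec p" using sol by (simp add: group_lasso_solution_def is_arg_min_def)
  have h: "?h \<in> carrier_vec p" using b \<beta> by simp
  have Xh: "(X *\<^sub>v ?h) $ i = ?l i" if "i < n" for i
    unfolding A_def by (rule mult_mat_vec_lin[OF X h that])
  have yb: "(l2_norm (y - X *\<^sub>v b))\<^sup>2 = (\<Sum>i<n. (\<epsilon> $ i - ?l i)\<^sup>2)"
  proof -
    have "X *\<^sub>v ?h = X *\<^sub>v b - X *\<^sub>v \<beta>" using X b \<beta> by (rule mult_minus_distrib_mat_vec)
    then have eq: "(y - X *\<^sub>v b) $ i = \<epsilon> $ i - ?l i" if "i < n" for i
      using X b \<beta> \<epsilon> that unfolding y Xh[OF that, symmetric] by simp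
    have "y - X *\<^sub>v b \<in> carrier_vec n" using X b by (intro carrier_vecI) simp
    then show ?thesis by (simp only: l2_norm_sq) (intro sum.cong refl, simp only: eq lessThan_iff)
  qed
  have y\<beta>: "(l2_norm (y - X *\<^sub>v \<beta>))\<^sup>2 = (\<Sum>i<n. (\<epsilon> $ i)\<^sup>2)"
    using X \<beta> \<epsilon> unfolding y by (subst l2_norm_sq[of _ n]) auto
  have "1 / real n * (l2_norm (y - X *\<^sub>v b))\<^sup>2 + l * (\<Sum>g<G. l2_on (I g) b)
      \<le> 1 / real n * (l2_norm (y - X *\<^sub>v \<beta>))\<^sup>2 + l * (\<Sum>g<G. l2_on (I g) \<beta>)"
    using sol \<beta> unfolding group_lasso_solution_def is_arg_min_def by (meson not_le)
  moreover have "(\<Sum>i<n. (\<epsilon> $ i - ?l i)\<^sup>2) = (\<Sum>i<n. (\<epsilon> $ i)\<^sup>2) - 2 * (\<Sum>i<n. \<epsilon> $ i * ?l i) + (\<Sum>i<n. (?l i)\<^sup>2)"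
    by (simp add: power2_diff sum.distrib sum_subtractf sum_distrib_left mult.assoc)
  ultimately have 1: "(\<Sum>i<n. (?l i)\<^sup>2) / real n
      \<le> 2 / real n * (\<Sum>i<n. \<epsilon> $ i * ?l i) + (l * (\<Sum>g<G. l2_on (I g) \<beta>) - l * (\<Sum>g<G. l2_on (I g) b))"
    unfolding yb y\<beta> by (simp add: algebra_simps add_divide_distrib diff_divide_distrib)
  have "(\<Sum>g<G. l2_on (I g) \<beta> - l2_on (I g) b) \<le> (\<Sum>g<G. if g \<in> J then l2_on (I g) ?h else - l2_on (I g) ?h)"
  proof (rule sum_mono)
    fix g assume "g \<in> {..<G}"
    then have g: "g < G" by simp
    have hj: "?h $ j = b $ j - \<beta> $ j" if "j \<in> I g" for j using I[OF g] that b \<beta> by auto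
    have "L2_set (\<lambda>j. \<beta> $ j) (I g) = L2_set (\<lambda>j. b $ j + (- ?h $ j)) (I g)"
      by (rule L2_set_cong) (auto simp: hj)
    also have "\<dots> \<le> L2_set (\<lambda>j. b $ j) (I g) + L2_set (\<lambda>j. - ?h $ j) (I g)" by (rule L2_set_triangle_ineq)
    also have "L2_set (\<lambda>j. - ?h $ j) (I g) = L2_set (\<lambda>j. ?h $ j) (I g)" by (simp add: L2_set_def)
    finally have tri: "l2_on (I g) \<beta> - l2_on (I g) b \<le> l2_on (I g) ?h" by (simp add: l2_on_def)
    show "l2_on (I g) \<beta> - l2_on (I g) b \<le> (if g \<in> J then l2_on (I g) ?h else - l2_on (I g) ?h)"
    proof (cases "g \<in> J")
      case False
      have "l2_on (I g) \<beta> = 0" unfolding l2_on_def L2_set_def using J(2)[OF g False] by simp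
      moreover have "l2_on (I g) ?h = l2_on (I g) b"
        unfolding l2_on_def by (rule L2_set_cong) (auto simp: hj J(2)[OF g False])
      ultimately show ?thesis using False by simp
    qed (use tri in simp)
  qed
  also have "\<dots> = (\<Sum>g\<in>J. l2_on (I g) ?h) - (\<Sum>g\<in>{..<G} - J. l2_on (I g) ?h)"
    using J(1) by (simp add: sum.If_cases Int_absorb1 sum_negf Diff_eq)
  finally have "l * (\<Sum>g<G. l2_on (I g) \<beta> - l2_on (I g) b)
      \<le> l * ((\<Sum>g\<in>J. l2_on (I g) ?h) - (\<Sum>g\<in>{..<G} - J. l2_on (I g) ?h))"
    using l by (rule mult_left_mono)
  then show ?thesis using 1 by (simp add: sum_subtractf right_diff_distrib)
qed

text \<open>Beyond positivity, all that is demanded of the penalty level is in \<open>noise\<close>,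
  so that the two formulas for it can be checked separately. The error is dominated by
  \<open>c1 + c2 * W\<close>, which yields integrability and, by linearity, the mean.\<close>

lemma group_lasso_expected_error:
  assumes model: "sub_gaussian_linear_model M n p \<sigma> X \<beta>s \<epsilon> y"
    and part: "group_partition p G I"
    and J: "J \<subseteq> {..<G}" "supp \<beta>s \<subseteq> (\<Union>g\<in>J. I g)" "card J = s" and s: "1 \<le> s" and \<alpha>: "2 \<le> \<alpha>"
    and op: "AE w in M. \<forall>g<G. \<forall>u. (\<Sum>i<n. (\<Sum>j\<in>I g. X w $$ (i, j) * u j)\<^sup>2) \<le> real n * (\<Sum>j\<in>I g. (u j)\<^sup>2)"
    and \<kappa>: "0 < \<kappa>" and re: "AE w in M. ereal \<kappa> \<le> group_lasso_re n p G I s \<alpha> (X w)"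
    and rv: "random_vec M p \<beta>h"
    and sol: "AE w in M. group_lasso_solution n p G I l (X w) (y w) (\<beta>h w)"
    and l: "l > 0"
    and noise: "\<And>r T. (\<And>g. g < G \<Longrightarrow> r g \<ge> 0) \<Longrightarrow> top_set {..<G} r T \<Longrightarrow> card T = s \<Longrightarrow>
      (\<Sum>g<G. \<sigma> * (sqrt (2 * real n * ln (2 * real G * exp 1 / real s)) + sqrt (real n * real (card (I g)))) * r g)
       \<le> 3 / 8 * (real n * l / \<alpha>) * (sqrt (real s) * sqrt (\<Sum>g\<in>T. (r g)\<^sup>2) + (\<Sum>g\<in>{..<G} - T. r g))"
  shows "integrable M (\<lambda>w. l2_norm (\<beta>h w - \<beta>s))"
    and "(\<integral>w. l2_norm (\<beta>h w - \<beta>s) \<partial>M) \<le> 3 * l * sqrt (real s) / \<kappa> + 16 * \<alpha> * \<sigma>\<^sup>2 * sqrt (real s) / (real n * l)"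
proof -
  interpret prob_space M using model by (simp add: sub_gaussian_linear_model_def)
  have n: "n > 0" and \<sigma>: "\<sigma> > 0" and \<beta>s: "\<beta>s \<in> carrier_vec p"
    and Xc: "\<And>w. w \<in> space M \<Longrightarrow> X w \<in> carrier_mat n p" and \<epsilon>c: "\<And>w. w \<in> space M \<Longrightarrow> \<epsilon> w \<in> carrier_vec n"
    and yeq: "\<And>w. w \<in> space M \<Longrightarrow> y w = X w *\<^sub>v \<beta>s + \<epsilon> w"
    using model by (auto simp: sub_gaussian_linear_model_def random_mat_def random_vec_def)
  have bc: "\<And>w. w \<in> space M \<Longrightarrow> \<beta>h w \<in> carrier_vec p"
    and bm [measurable]: "\<And>j. j < p \<Longrightarrow> (\<lambda>w. \<beta>h w $ j) \<in> borel_measurable M"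
    using rv by (auto simp: random_vec_def)
  obtain gr where gr: "\<And>j. j < p \<Longrightarrow> gr j < G" and I: "\<And>g. g < G \<Longrightarrow> I g = {j. j < p \<and> gr j = g}"
    using group_partition_index[OF part] by blast
  have ne: "\<exists>j<p. gr j = g" if "g < G" for g
    using part I[OF that] that unfolding group_partition_def by blast
  have sG: "s \<le> G" using J(1,3) card_mono[of "{..<G}" J] by simp
  have op': "AE w in M. \<forall>g<G. \<forall>u. (\<Sum>i<n. (\<Sum>j | j < p \<and> gr j = g. X w $$ (i, j) * u j)\<^sup>2)
       \<le> real n * (\<Sum>j | j < p \<and> gr j = g. (u j)\<^sup>2)"
    using op by eventually_elim (simp add: I)
  let ?L = "ln (2 * real G * exp 1 / real s)"
  obtain W where Wi: "integrable M W" and WE: "(\<integral>w. W w \<partial>M) \<le> \<sigma>\<^sup>2 * real s"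
    and W: "AE w in M. \<forall>h. (\<Sum>i<n. \<epsilon> w $ i * lin p (\<lambda>i j. X w $$ (i, j)) h i)
       \<le> 1 / 4 * (\<Sum>i<n. (lin p (\<lambda>i j. X w $$ (i, j)) h i)\<^sup>2) + W w
         + (\<Sum>g<G. \<sigma> * (sqrt (2 * real n * ?L) + sqrt (real n * real (card {j. j < p \<and> gr j = g}))) * group_norm p gr h g)"
    using noise_bound[OF model gr ne s sG op'] by blast
  define e where "e w = sqrt (\<Sum>j<p. (\<beta>h w $ j - \<beta>s $ j)\<^sup>2)" for w
  have e: "l2_norm (\<beta>h w - \<beta>s) = e w" if "w \<in> space M" for w
    unfolding e_def l2_on_def L2_set_def using bc[OF that] \<beta>s by simp
  have em: "e \<in> borel_measurable M" unfolding e_def[abs_def] by measurable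
  define c1 c2 where "c1 = 3 * l * sqrt (real s) / \<kappa>" and "c2 = 16 * \<alpha> / (real n * l * sqrt (real s))"
  have c: "c1 \<ge> 0" "c2 \<ge> 0" using l \<kappa> \<alpha> by (auto simp: c1_def c2_def)
  have bound: "AE w in M. e w \<le> c1 + c2 * W w"
    using AE_space W re sol
  proof eventually_elim
    case (elim w)
    define h where "h j = (\<beta>h w - \<beta>s) $ j" for j
    define r where "r = group_norm p gr h"
    have hc: "\<beta>h w - \<beta>s \<in> carrier_vec p" using bc[OF elim(1)] \<beta>s by simp
    have r0: "r g \<ge> 0" for g by (simp add: r_def group_norm_def sum_nonneg)
    have rI: "r g = l2_on (I g) (\<beta>h w - \<beta>s)" if "g < G" for g
      unfolding r_def group_norm_def l2_on_def L2_set_def h_def I[OF that] ..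
    have r2: "(r g)\<^sup>2 = (\<Sum>j | j < p \<and> gr j = g. (h j)\<^sup>2)" for g
      by (simp add: r_def group_norm_def sum_nonneg)
    obtain T where T: "top_set {..<G} r T" "card T = s"
      using top_set_exists[of "{..<G}" s r] sG by auto
    have Tsub: "T \<subseteq> {..<G}" using T by (simp add: top_set_def)
    have tot: "(\<Sum>g<G. (r g)\<^sup>2) = (\<Sum>j<p. (h j)\<^sup>2)"
      unfolding r2 by (rule sum_groups[symmetric]) (rule gr)
    have TI: "sqrt (\<Sum>g\<in>T. (r g)\<^sup>2) = l2_on (\<Union>g\<in>T. I g) (\<beta>h w - \<beta>s)"
    proof -
      have IT: "I g = {j. j < p \<and> gr j = g}" if "g \<in> T" for g using that Tsub by (intro I) auto
      have "(\<Sum>j\<in>(\<Union>g\<in>T. I g). (h j)\<^sup>2) = (\<Sum>g\<in>T. \<Sum>j\<in>I g. (h j)\<^sup>2)"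
        using Tsub by (intro sum.UNION_disjoint) (auto simp: IT intro: finite_subset)
      also have "\<dots> = (\<Sum>g\<in>T. (r g)\<^sup>2)" using Tsub unfolding r2 by (intro sum.cong) (auto simp: I)
      finally show ?thesis by (simp add: l2_on_def L2_set_def h_def)
    qed
    let ?A = "\<lambda>i j. X w $$ (i, j)"
    define E where "E = (\<Sum>i<n. (lin p ?A h i)\<^sup>2)"
    define B where "B = (\<Sum>i<n. \<epsilon> w $ i * lin p ?A h i)"
    define N where "N = (\<Sum>g<G. \<sigma> * (sqrt (2 * real n * ?L) + sqrt (real n * real (card (I g)))) * r g)"
    \<comment> \<open>The noise bound at \<open>h = 0\<close>.\<close>
    have W0: "W w \<ge> 0" using elim(2)[THEN spec, of "\<lambda>_. 0"] by (simp add: lin_def group_norm_def)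
    have "sqrt (\<Sum>g<G. (r g)\<^sup>2) \<le> 3 * l * sqrt (real (card T)) / \<kappa> + 16 * \<alpha> * W w / (real n * l * sqrt (real (card T)))"
    proof (rule error_bound[where S = J and E = E and B = B and N = N])
      show "E / real n \<le> 2 / real n * B + l * ((\<Sum>g\<in>J. r g) - (\<Sum>g\<in>{..<G} - J. r g))"
      proof -
        have Jz: "\<beta>s $ j = 0" if "g < G" "g \<notin> J" "j \<in> I g" for g j
        proof (rule ccontr)
          assume "\<beta>s $ j \<noteq> 0"
          moreover have "j < p" using that I by auto
          ultimately have "j \<in> supp \<beta>s" using \<beta>s by (simp add: supp_def)
          then obtain g' where "g' \<in> J" "j \<in> I g'" using J(2) by blast
          then show False using that J(1) I by auto
        qed
        have sJ: "(\<Sum>g\<in>J. r g) = (\<Sum>g\<in>J. l2_on (I g) (\<beta>h w - \<beta>s))"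
          using J(1) rI by (intro sum.cong) auto
        have sJc: "(\<Sum>g\<in>{..<G} - J. r g) = (\<Sum>g\<in>{..<G} - J. l2_on (I g) (\<beta>h w - \<beta>s))"
          using rI by (intro sum.cong) auto
        show ?thesis
          unfolding E_def B_def h_def[abs_def] sJ sJc
          by (rule group_lasso_basic_inequality[OF Xc[OF elim(1)] \<beta>s \<epsilon>c[OF elim(1)] yeq[OF elim(1)] elim(4) J(1) Jz])
            (use l I in auto)
      qed
      show "B \<le> 1 / 4 * E + W w + N"
        unfolding B_def E_def N_def r_def using elim(2) by (simp add: I)
      show "N \<le> 3 / 8 * (real n * l / \<alpha>) * (sqrt (real (card T)) * sqrt (\<Sum>g\<in>T. (r g)\<^sup>2) + (\<Sum>g\<in>{..<G} - T. r g))"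
        unfolding N_def T(2) by (rule noise) (use r0 T in auto)
      show "\<kappa> * (\<Sum>g<G. (r g)\<^sup>2) \<le> E / real n"
        if cone: "(\<Sum>g\<in>{..<G} - T. r g) \<le> \<alpha> / (\<alpha> - 1) * (\<Sum>g\<in>T. r g) + sqrt (real (card T)) / (\<alpha> - 1) * sqrt (\<Sum>g\<in>T. (r g)\<^sup>2)"
      proof -
        have "(\<Sum>g\<in>T. r g) = (\<Sum>g\<in>T. l2_on (I g) (\<beta>h w - \<beta>s))" using Tsub rI by (intro sum.cong) auto
        moreover have "(\<Sum>g\<in>{..<G} - T. r g) = (\<Sum>g\<in>{..<G} - T. l2_on (I g) (\<beta>h w - \<beta>s))"
          using rI by (intro sum.cong) auto
        ultimately have "\<beta>h w - \<beta>s \<in> group_cone p G I T (\<alpha> / (\<alpha> - 1)) (sqrt (real s) / (\<alpha> - 1))"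
          using cone hc unfolding group_cone_def TI T(2) by simp
        from group_lasso_re_le[OF Xc[OF elim(1)] elim(3) Tsub _ n this] T(2)
        show ?thesis unfolding tot E_def h_def by simp
      qed
      show "E \<ge> 0" by (simp add: E_def sum_nonneg)
    qed (use T J s n \<alpha> l \<kappa> W0 r0 in auto)
    moreover have "e w = sqrt (\<Sum>j<p. (h j)\<^sup>2)" unfolding e_def h_def using hc bc[OF elim(1)] \<beta>s by simp
    ultimately show "e w \<le> c1 + c2 * W w" unfolding T(2) tot c1_def c2_def by simp
  qed
  have ei: "integrable M e"
  proof (rule Bochner_Integration.integrable_bound)
    show "integrable M (\<lambda>w. c1 + c2 * W w)" using Wi by simp
    show "AE w in M. norm (e w) \<le> norm (c1 + c2 * W w)"
      using bound by eventually_elim (auto simp: e_def sum_nonneg)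
  qed (rule em)
  have "(\<integral>w. e w \<partial>M) \<le> (\<integral>w. c1 + c2 * W w \<partial>M)" using ei Wi bound by (intro integral_mono_AE) auto
  also have "\<dots> = c1 + c2 * (\<integral>w. W w \<partial>M)" using Wi by (simp add: prob_space)
  also have "\<dots> \<le> c1 + c2 * (\<sigma>\<^sup>2 * real s)" using WE c by (intro add_left_mono mult_left_mono) auto
  also have "c2 * (\<sigma>\<^sup>2 * real s) = 16 * \<alpha> * \<sigma>\<^sup>2 * sqrt (real s) / (real n * l)"
  proof -
    have "c2 * (\<sigma>\<^sup>2 * real s) = 16 * \<alpha> * \<sigma>\<^sup>2 / (real n * l) * (real s / sqrt (real s))"
      by (simp add: c2_def)
    also have "real s / sqrt (real s) = sqrt (real s)" by (rule real_div_sqrt) simp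
    finally show ?thesis by simp
  qed
  finally have eE: "(\<integral>w. e w \<partial>M) \<le> c1 + 16 * \<alpha> * \<sigma>\<^sup>2 * sqrt (real s) / (real n * l)" .
  show "integrable M (\<lambda>w. l2_norm (\<beta>h w - \<beta>s))"
    using ei by (subst Bochner_Integration.integrable_cong[OF refl e]) auto
  have "(\<integral>w. l2_norm (\<beta>h w - \<beta>s) \<partial>M) = (\<integral>w. e w \<partial>M)" by (intro Bochner_Integration.integral_cong refl e)
  then show "(\<integral>w. l2_norm (\<beta>h w - \<beta>s) \<partial>M) \<le> 3 * l * sqrt (real s) / \<kappa> + 16 * \<alpha> * \<sigma>\<^sup>2 * sqrt (real s) / (real n * l)"
    using eE unfolding c1_def by simp
qed

section \<open>The Lasso and the Group Lasso\<close>

text \<open>Some \<open>y\<close> in \<open>M\<close> is charged to the head \<open>x\<close> so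
  that the rest of \<open>M\<close> fits into the tail: \<open>x\<close> itself if it occurs in
  \<open>M\<close>, any element otherwise. Multisets are used because group sizes repeat.\<close>

lemma sum_mset_le_take_sorted:
  fixes xs :: "nat list"
  assumes "sorted_wrt (\<ge>) xs" "M \<subseteq># mset xs"
  shows "sum_mset M \<le> sum_list (take (size M) xs)"
  using assms
proof (induction xs arbitrary: M)
  case Nil
  then show ?case by simp
next
  case (Cons x xs)
  show ?case
  proof (cases "M = {#}")
    case False
    obtain y where y: "y \<in># M" "M - {#y#} \<subseteq># mset xs"
    proof (cases "x \<in># M")
      case True
      then show ?thesis using that[of x] Cons.prems(2) by (simp add: insert_subset_eq_iff subset_eq_diff_conv)
    next
      case False
      obtain y where "y \<in># M" using \<open>M \<noteq> {#}\<close> by blast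
      moreover have "M \<subseteq># mset xs"
      proof (rule mset_subset_eqI)
        fix a
        show "count M a \<le> count (mset xs) a"
          using mset_subset_eq_count[OF Cons.prems(2), of a] False
          by (cases "a = x") (simp_all add: not_in_iff)
      qed
      ultimately show ?thesis
        using that[of y] subset_mset.order_trans[OF diff_subset_eq_self[of M "{#y#}"]] by blast
    qed
    have "y \<in># mset (x # xs)" using y(1) Cons.prems(2) by (rule mset_subset_eqD[rotated])
    then have "y \<le> x" using Cons.prems(1) by auto
    have My: "M = add_mset y (M - {#y#})" using y(1) by simp
    have sz: "size M = Suc (size (M - {#y#}))" using arg_cong[OF My, of size] by (simp only: size_add_mset)
    have "sum_mset M = y + sum_mset (M - {#y#})" using arg_cong[OF My, of sum_mset] by (simp only: sum_mset.add_mset)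
    also have "\<dots> \<le> x + sum_list (take (size (M - {#y#})) xs)"
      using \<open>y \<le> x\<close> Cons.IH[OF _ y(2)] Cons.prems(1) by (intro add_mono) auto
    finally show ?thesis unfolding sz by simp
  qed simp
qed

lemma sum_card_le_largest_groups_size:
  assumes A: "A \<subseteq> {..<G}"
  shows "(\<Sum>g\<in>A. card (I g)) \<le> largest_groups_size G I (card A)"
proof -
  let ?f = "\<lambda>g. card (I g)"
  define xs where "xs = rev (sort (map ?f [0..<G]))"
  have fin: "finite A" using A finite_subset by blast
  have "sorted_wrt (\<ge>) xs" unfolding xs_def sorted_wrt_rev by (rule sorted_sort)
  moreover have "image_mset ?f (mset_set A) \<subseteq># mset xs"
  proof -
    have "mset xs = image_mset ?f (mset_set {..<G})"
      unfolding xs_def by (simp only: mset_rev mset_sort mset_map mset_upt atLeast0LessThan)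
    then show ?thesis using A by (simp only:) (intro image_mset_subseteq_mono subset_imp_msubset_mset_set finite_lessThan)
  qed
  ultimately have "sum_mset (image_mset ?f (mset_set A)) \<le> sum_list (take (size (image_mset ?f (mset_set A))) xs)"
    by (rule sum_mset_le_take_sorted)
  then show ?thesis using fin by (simp add: largest_groups_size_def xs_def sum_unfold_sum_mset)
qed

text \<open>A unit vector supported in group \<open>0\<close> vanishes on all other groups, so it
  lies in the cone of \<open>{0}\<close>, and the normalisation of the design bounds its ratio by
  \<open>1\<close>. This is what lets a term without \<open>1 / \<kappa>\<close> be absorbed into
  the claimed rate.\<close>

lemma re_constant_le_1:
  assumes X: "X \<in> carrier_mat n p" and part: "group_partition p G I" and n: "n > 0"
    and s: "1 \<le> s" "s \<le> G" and \<alpha>: "2 \<le> \<alpha>"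
    and op: "\<forall>g<G. \<forall>u. (\<Sum>i<n. (\<Sum>j\<in>I g. X $$ (i, j) * u j)\<^sup>2) \<le> real n * (\<Sum>j\<in>I g. (u j)\<^sup>2)"
    and re: "ereal \<kappa> \<le> group_lasso_re n p G I s \<alpha> X"
  shows "\<kappa> \<le> 1"
proof -
  obtain gr where gr: "\<And>j. j < p \<Longrightarrow> gr j < G" and I: "\<And>g. g < G \<Longrightarrow> I g = {j. j < p \<and> gr j = g}"
    using group_partition_index[OF part] by blast
  have G: "0 < G" using s by simp
  have "I 0 \<noteq> {}" using part G unfolding group_partition_def by blast
  then obtain j where j: "j \<in> I 0" by blast
  then have jp: "j < p" "gr j = 0" using I[OF G] by auto
  define z where "z = (unit_vec p j :: real vec)"
  have zi: "z $ i = (if i = j then 1 else 0)" if "i < p" for i using that jp by (simp add: z_def)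
  have "l2_on (I g) z = 0" if g: "g < G" "g \<noteq> 0" for g
  proof -
    have "z $ i = 0" if "i \<in> I g" for i using I[OF g(1)] that g(2) jp zi by auto
    then show ?thesis by (simp add: l2_on_def L2_set_def)
  qed
  then have "(\<Sum>g\<in>{..<G} - {0}. l2_on (I g) z) = 0" by (intro sum.neutral) auto
  moreover have "0 \<le> \<alpha> / (\<alpha> - 1) * (\<Sum>g\<in>{0}. l2_on (I g) z)
      + sqrt (real s) / (\<alpha> - 1) * l2_on (\<Union>g\<in>{0}. I g) z"
    using \<alpha> by (intro add_nonneg_nonneg mult_nonneg_nonneg) (auto simp: l2_on_def intro: L2_set_nonneg)
  ultimately have "z \<in> group_cone p G I {0} (\<alpha> / (\<alpha> - 1)) (sqrt (real s) / (\<alpha> - 1))"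
    unfolding group_cone_def by (simp add: z_def)
  from group_lasso_re_le[OF X re _ _ n this] G s
  have "\<kappa> * (\<Sum>i<p. (z $ i)\<^sup>2) \<le> (\<Sum>i<n. (lin p (\<lambda>i j. X $$ (i, j)) (\<lambda>j. z $ j) i)\<^sup>2) / real n" by simp
  moreover have "(\<Sum>i<p. (z $ i)\<^sup>2) = 1"
  proof -
    have "(\<Sum>i<p. (z $ i)\<^sup>2) = (\<Sum>i<p. if i = j then 1 else 0)" by (intro sum.cong) (auto simp: zi)
    then show ?thesis using jp by simp
  qed
  moreover have "(\<Sum>i<n. (lin p (\<lambda>i j. X $$ (i, j)) (\<lambda>j. z $ j) i)\<^sup>2) \<le> real n"
  proof -
    have e1: "lin p (\<lambda>i j. X $$ (i, j)) (\<lambda>j. z $ j) i = (\<Sum>l\<in>I 0. X $$ (i, l) * (if l = j then 1 else 0))" for i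
    proof -
      have "lin p (\<lambda>i j. X $$ (i, j)) (\<lambda>j. z $ j) i = (\<Sum>l<p. if l = j then X $$ (i, l) else 0)"
        unfolding lin_def by (intro sum.cong) (auto simp: zi)
      moreover have "(\<Sum>l\<in>I 0. X $$ (i, l) * (if l = j then 1 else 0)) = (\<Sum>l\<in>I 0. if l = j then X $$ (i, l) else 0)"
        by (intro sum.cong) auto
      moreover have "finite (I 0)" using I[OF G] by simp
      ultimately show ?thesis using j jp by simp
    qed
    have e2: "(\<Sum>l\<in>I 0. (if l = j then 1 else (0::real))\<^sup>2) = 1"
    proof -
      have "(\<Sum>l\<in>I 0. (if l = j then 1 else (0::real))\<^sup>2) = (\<Sum>l\<in>I 0. if l = j then 1 else 0)"
        by (intro sum.cong) auto
      moreover have "finite (I 0)" using I[OF G] by simp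
      ultimately show ?thesis using j by simp
    qed
    have "(\<Sum>i<n. (\<Sum>l\<in>I 0. X $$ (i, l) * (if l = j then 1 else 0))\<^sup>2)
        \<le> real n * (\<Sum>l\<in>I 0. (if l = j then 1 else 0)\<^sup>2)"
      by (rule op[rule_format, OF G])
    then show ?thesis unfolding e1 e2 by (simp only: mult_1_right)
  qed
  ultimately have "\<kappa> \<le> (\<Sum>i<n. (lin p (\<lambda>i j. X $$ (i, j)) (\<lambda>j. z $ j) i)\<^sup>2) / real n"
    "(\<Sum>i<n. (lin p (\<lambda>i j. X $$ (i, j)) (\<lambda>j. z $ j) i)\<^sup>2) / real n \<le> 1"
    using n by (auto simp: divide_le_eq)
  then show ?thesis by linarith
qed

text \<open>The mean of \<open>W\<close> contributes a term with the penalty level in the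
  denominator. A lower bound of order \<open>\<alpha> * \<sigma> / sqrt n\<close> for that level
  turns it into \<open>\<sigma> * sqrt (s / n)\<close>, and
  \<open>\<alpha> / \<kappa> \<ge> 1\<close> supplies the missing factor.\<close>

lemma remainder_bound:
  fixes \<alpha> \<sigma> \<kappa> s n l :: real
  assumes "\<alpha> \<ge> 1" "\<sigma> > 0" "0 < \<kappa>" "\<kappa> \<le> 1" "s > 0" "n > 0" and l: "12 * \<alpha> * \<sigma> * sqrt (1 / n) \<le> l"
  shows "16 * \<alpha> * \<sigma>\<^sup>2 * sqrt s / (n * l) \<le> \<alpha> * \<sigma> / \<kappa> * (2 * sqrt (s / n))"
proof -
  have nn: "n * sqrt (1 / n) = sqrt n" using assms by (simp add: real_sqrt_divide real_div_sqrt)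
  have p: "0 < 12 * \<alpha> * \<sigma> * sqrt (1 / n)" using assms by simp
  then have "0 < l" using l by linarith
  with p have "16 * \<alpha> * \<sigma>\<^sup>2 * sqrt s / (n * l) \<le> 16 * \<alpha> * \<sigma>\<^sup>2 * sqrt s / (n * (12 * \<alpha> * \<sigma> * sqrt (1 / n)))"
    using assms by (intro divide_left_mono mult_left_mono mult_pos_pos) auto
  also have "n * (12 * \<alpha> * \<sigma> * sqrt (1 / n)) = 12 * \<alpha> * \<sigma> * sqrt n" using nn by (simp add: mult_ac)
  also have "16 * \<alpha> * \<sigma>\<^sup>2 * sqrt s / (12 * \<alpha> * \<sigma> * sqrt n) = 4 / 3 * \<sigma> * sqrt (s / n)"
    using assms by (simp add: real_sqrt_divide power2_eq_square)
  also have "\<dots> \<le> \<alpha> * \<sigma> / \<kappa> * (2 * sqrt (s / n))"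
  proof -
    have "1 \<le> \<alpha> / \<kappa>" using assms by (simp add: le_divide_eq)
    then have "4 / 3 \<le> 2 * (\<alpha> / \<kappa>)" by linarith
    then have "4 / 3 * (\<sigma> * sqrt (s / n)) \<le> 2 * (\<alpha> / \<kappa>) * (\<sigma> * sqrt (s / n))" using assms by (intro mult_right_mono) auto
    then show ?thesis by (simp add: mult_ac)
  qed
  finally show ?thesis .
qed

section \<open>Logarithmic factors, and the Lasso in terms of singleton groups\<close>

lemma ln_2e_bounds: "1 \<le> ln (2 * exp 1 :: real)" "ln (2 * exp 1 :: real) \<le> 2"
  using ln_add_one_self_le_self[of "1::real"] by (auto simp: ln_mult)

lemma log_term:
  assumes "1 \<le> s" "s \<le> G"
  shows "ln (2 * real G * exp 1 / real s) = ln (real G / real s) + ln (2 * exp 1)"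
    and "0 \<le> ln (real G / real s)" and "1 \<le> ln (2 * real G * exp 1 / real s)"
proof -
  have e: "2 * real G * exp 1 / real s = (real G / real s) * (2 * exp 1)" by simp
  show 1: "ln (2 * real G * exp 1 / real s) = ln (real G / real s) + ln (2 * exp 1)"
    unfolding e using assms by (subst ln_mult) auto
  show 2: "0 \<le> ln (real G / real s)" using assms by simp
  show "1 \<le> ln (2 * real G * exp 1 / real s)" using 1 2 ln_2e_bounds by linarith
qed

lemma l2_on_singleton: "l2_on {g} z = \<bar>z $ g\<bar>"
  by (simp add: l2_on_def L2_set_def)

lemma lasso_re_eq_group: "lasso_re n p k \<alpha> X = group_lasso_re n p p (\<lambda>g. {g}) k \<alpha> X"
  unfolding lasso_re_def group_lasso_re_def lasso_cone_def group_cone_def l2_on_singleton l1_on_def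
  by simp

lemma lasso_solution_group:
  assumes "lasso_solution n p l X y b"
  shows "group_lasso_solution n p p (\<lambda>g. {g}) l X y b"
proof -
  have "l1_norm b = (\<Sum>g<p. l2_on {g} b)" if "b \<in> carrier_vec p" for b
    using that by (simp add: l1_on_def l2_on_singleton)
  then show ?thesis
    using assms unfolding lasso_solution_def group_lasso_solution_def is_arg_min_def by auto
qed

lemma singleton_partition: "group_partition p p (\<lambda>g. {g})"
  by (auto simp: group_partition_def disjoint_family_on_def)

lemma sqrt_le_sqrt_mult: "0 \<le> c \<Longrightarrow> x \<le> c * y \<Longrightarrow> sqrt x \<le> sqrt c * sqrt y"
  by (metis real_sqrt_le_mono real_sqrt_mult)

lemma mult_sqrt_divide: "0 < c \<Longrightarrow> c * sqrt (x / c) = sqrt c * sqrt x"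
  by (simp add: real_sqrt_divide field_simps)

text \<open>The penalty level contains \<open>ln (2 p e / k) \<ge> 1\<close>, while the rate has
  \<open>ln (p / k)\<close>, which vanishes at \<open>k = p\<close>. Keeping \<open>p / k\<close> at
  least \<open>\<rho> > 1\<close> makes them comparable, with factor
  \<open>1 + 2 / ln \<rho>\<close>. The constant \<open>72 = 3 * 24\<close> joins the factor of the
  error bound to that of the penalty level.\<close>

lemma lasso_bound:
  assumes \<delta>: "0 < \<delta>" "\<delta> < 1 / 2" and \<rho>: "\<rho> > 1"
    and model: "sub_gaussian_linear_model M n p \<sigma> X \<beta>s \<epsilon> y"
    and k: "k = card (supp \<beta>s)" "1 \<le> k" "\<rho> * real k \<le> real p" and \<alpha>: "2 \<le> \<alpha>"
    and col: "AE w in M. \<forall>j<p. l2_norm (col (X w) j) \<le> sqrt (real n)"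
    and \<kappa>: "0 < \<kappa>" and re: "AE w in M. ereal \<kappa> \<le> lasso_re n p k \<alpha> (X w)"
    and rv: "random_vec M p \<beta>h"
    and sol: "AE w in M. lasso_solution n p (lasso_lambda n p k \<sigma> \<alpha> \<delta>) (X w) (y w) (\<beta>h w)"
  shows "integrable M (\<lambda>w. l2_norm (\<beta>h w - \<beta>s))"
    and "(\<integral>w. l2_norm (\<beta>h w - \<beta>s) \<partial>M)
      \<le> (72 * sqrt (ln (1 / \<delta>)) * sqrt (1 + 2 / ln \<rho>) + 2 * sqrt (1 / ln \<rho>))
        * (\<alpha> * \<sigma> / \<kappa> * sqrt (real k * ln (real p / real k) / real n))"
proof -
  interpret prob_space M using model by (simp add: sub_gaussian_linear_model_def)
  have n: "n > 0" and \<sigma>: "\<sigma> > 0" and \<beta>s: "\<beta>s \<in> carrier_vec p"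
    and Xc: "\<And>w. w \<in> space M \<Longrightarrow> X w \<in> carrier_mat n p"
    using model by (auto simp: sub_gaussian_linear_model_def random_mat_def)
  have "real k \<le> \<rho> * real k" using \<rho> mult_right_mono[of 1 \<rho> "real k"] by simp
  then have kp: "k \<le> p" using k(3) by linarith
  define D where "D = ln (1 / \<delta>)"
  define L where "L = ln (2 * real p * exp 1 / real k)"
  define l where "l = lasso_lambda n p k \<sigma> \<alpha> \<delta>"
  \<comment> \<open>As \<open>\<delta> < 1 / 2\<close>, the factor \<open>D\<close> stays away from
    zero and its root is at least \<open>1 / 2\<close>; hence \<open>12 = 24 / 2\<close>
    below.\<close>
  have "ln 2 \<le> D" unfolding D_def using \<delta> by (subst ln_le_cancel_iff) (auto simp: field_simps)
  then have D: "1 / 4 \<le> D" using ln2_ge_two_thirds by linarith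
  have sD: "1 / 2 \<le> sqrt D" using D by (intro real_le_rsqrt) (simp add: power2_eq_square)
  have L1: "1 \<le> L" unfolding L_def using log_term[OF k(2) kp] by simp
  have l_eq: "l = 24 * \<alpha> * \<sigma> * (sqrt (L / real n) * sqrt D)"
    unfolding l_def lasso_lambda_def L_def[symmetric] D_def[symmetric] by (simp add: real_sqrt_mult[symmetric])
  have sLn: "sqrt (L / real n) \<ge> sqrt (1 / real n)" using L1 n by (simp add: divide_right_mono)
  have "sqrt (1 / real n) * (1 / 2) \<le> sqrt (L / real n) * sqrt D"
    using sLn sD L1 by (intro mult_mono) auto
  then have "24 * \<alpha> * \<sigma> * (sqrt (1 / real n) * (1 / 2)) \<le> l"
    unfolding l_eq using \<alpha> \<sigma> by (intro mult_left_mono) auto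
  then have l12: "12 * \<alpha> * \<sigma> * sqrt (1 / real n) \<le> l" by simp
  moreover have "0 < 12 * \<alpha> * \<sigma> * sqrt (1 / real n)" using \<alpha> \<sigma> n by simp
  ultimately have l0: "l > 0" by linarith
  have op_w: "\<forall>g<p. \<forall>u. (\<Sum>i<n. (\<Sum>j\<in>{g}. X w $$ (i, j) * u j)\<^sup>2) \<le> real n * (\<Sum>j\<in>{g}. (u j)\<^sup>2)"
    if w: "w \<in> space M" and c: "\<forall>j<p. l2_norm (col (X w) j) \<le> sqrt (real n)" for w
  proof (intro allI impI)
    fix g u assume g: "g < p"
    have cc: "col (X w) g \<in> carrier_vec n" using Xc[OF w] by auto
    have "(l2_norm (col (X w) g))\<^sup>2 \<le> (sqrt (real n))\<^sup>2"
      using c g by (intro power_mono) (auto simp: l2_on_def intro: L2_set_nonneg)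
    then have le: "(\<Sum>i<n. (X w $$ (i, g))\<^sup>2) \<le> real n"
      unfolding l2_norm_sq[OF cc] using Xc[OF w] g by simp
    have "(\<Sum>i<n. (\<Sum>j\<in>{g}. X w $$ (i, j) * u j)\<^sup>2) = (\<Sum>i<n. (X w $$ (i, g))\<^sup>2) * (u g)\<^sup>2"
      by (simp add: power_mult_distrib sum_distrib_right)
    also have "\<dots> \<le> real n * (u g)\<^sup>2" using le by (intro mult_right_mono) auto
    finally show "(\<Sum>i<n. (\<Sum>j\<in>{g}. X w $$ (i, j) * u j)\<^sup>2) \<le> real n * (\<Sum>j\<in>{g}. (u j)\<^sup>2)" by simp
  qed
  have op: "AE w in M. \<forall>g<p. \<forall>u. (\<Sum>i<n. (\<Sum>j\<in>{g}. X w $$ (i, j) * u j)\<^sup>2) \<le> real n * (\<Sum>j\<in>{g}. (u j)\<^sup>2)"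
    using AE_space col by eventually_elim (rule op_w)
  have re': "AE w in M. ereal \<kappa> \<le> group_lasso_re n p p (\<lambda>g. {g}) k \<alpha> (X w)"
    using re unfolding lasso_re_eq_group .
  have "AE w in M. \<kappa> \<le> 1"
    using AE_space op re'
    by eventually_elim (rule re_constant_le_1[OF Xc singleton_partition n k(2) kp \<alpha>])
  then have \<kappa>1: "\<kappa> \<le> 1" by simp
  have sol': "AE w in M. group_lasso_solution n p p (\<lambda>g. {g}) l (X w) (y w) (\<beta>h w)"
    using sol unfolding l_def by eventually_elim (rule lasso_solution_group)
  have supp: "supp \<beta>s \<subseteq> {..<p}" "supp \<beta>s \<subseteq> (\<Union>g\<in>supp \<beta>s. {g})" "card (supp \<beta>s) = k"
    using \<beta>s k by (auto simp: supp_def)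
  have noise: "(\<Sum>g<p. \<sigma> * (sqrt (2 * real n * L) + sqrt (real n * real (card {g}))) * r g)
      \<le> 3 / 8 * (real n * l / \<alpha>) * (sqrt (real k) * sqrt (\<Sum>g\<in>T. (r g)\<^sup>2) + (\<Sum>g\<in>{..<p} - T. r g))"
    if r: "\<And>g. g < p \<Longrightarrow> r g \<ge> 0" and T: "top_set {..<p} r T" "card T = k" for r T
  proof -
    have sub: "T \<subseteq> {..<p}" using T by (simp add: top_set_def)
    have "(\<Sum>g<p. r g) = (\<Sum>g\<in>T. r g) + (\<Sum>g\<in>{..<p} - T. r g)"
      using sum.subset_diff[OF sub finite_lessThan, of r] by simp
    also have "\<dots> \<le> sqrt (real k) * sqrt (\<Sum>g\<in>T. (r g)\<^sup>2) + (\<Sum>g\<in>{..<p} - T. r g)"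
      using sum_le_sqrt_card[of T r] r sub T by auto
    finally have tot: "(\<Sum>g<p. r g) \<le> sqrt (real k) * sqrt (\<Sum>g\<in>T. (r g)\<^sup>2) + (\<Sum>g\<in>{..<p} - T. r g)" (is "_ \<le> ?R") .
    have R0: "?R \<ge> 0" using r by (intro add_nonneg_nonneg sum_nonneg mult_nonneg_nonneg) (auto intro: sum_nonneg)
    have s2: "sqrt 2 \<le> 3 / 2" by (rule real_le_lsqrt) (auto simp: power2_eq_square)
    define z where "z = sqrt (real n) * sqrt L"
    have z: "sqrt (2 * real n * L) = sqrt 2 * z" by (simp add: z_def real_sqrt_mult mult.assoc)
    have z0: "z \<ge> 0" using L1 by (simp add: z_def)
    have "sqrt (real n) * 1 \<le> z" unfolding z_def using L1 by (intro mult_left_mono) auto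
    moreover have "sqrt 2 * z \<le> 3 / 2 * z" using s2 z0 by (rule mult_right_mono)
    moreover have "z * (1 / 2) \<le> z * sqrt D" using sD z0 by (rule mult_left_mono)
    \<comment> \<open>Here \<open>9\<close> is \<open>3 / 8\<close> of the \<open>24\<close> in the
      penalty level; the left side is at most \<open>5 / 2 * z\<close>, and
      \<open>z \<le> 2 * z * sqrt D\<close>.\<close>
    ultimately have "sqrt (2 * real n * L) + sqrt (real n) \<le> 9 * (z * sqrt D)" unfolding z using z0 by linarith
    then have "\<sigma> * (sqrt (2 * real n * L) + sqrt (real n)) \<le> \<sigma> * (9 * (z * sqrt D))"
      using \<sigma> by (intro mult_left_mono) auto
    also have "z = real n * sqrt (L / real n)"
      using n by (simp add: z_def mult_sqrt_divide)
    also have "\<sigma> * (9 * (real n * sqrt (L / real n) * sqrt D)) = 3 / 8 * (real n * l / \<alpha>)"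
      unfolding l_eq using \<alpha> by simp
    finally have c: "\<sigma> * (sqrt (2 * real n * L) + sqrt (real n)) \<le> 3 / 8 * (real n * l / \<alpha>)" .
    have "(\<Sum>g<p. \<sigma> * (sqrt (2 * real n * L) + sqrt (real n * real (card {g}))) * r g)
        = \<sigma> * (sqrt (2 * real n * L) + sqrt (real n)) * (\<Sum>g<p. r g)"
      by (simp add: sum_distrib_left)
    also have "\<dots> \<le> \<sigma> * (sqrt (2 * real n * L) + sqrt (real n)) * ?R"
      using tot \<sigma> L1 by (intro mult_left_mono) auto
    also have "\<dots> \<le> 3 / 8 * (real n * l / \<alpha>) * ?R" using c R0 by (rule mult_right_mono)
    finally show ?thesis .
  qed
  note main = group_lasso_expected_error[OF model singleton_partition supp k(2) \<alpha> op \<kappa> re' rv sol' l0]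
  show "integrable M (\<lambda>w. l2_norm (\<beta>h w - \<beta>s))" by (rule main(1)) (fact noise[unfolded L_def])
  have main2: "(\<integral>w. l2_norm (\<beta>h w - \<beta>s) \<partial>M)
      \<le> 3 * l * sqrt (real k) / \<kappa> + 16 * \<alpha> * \<sigma>\<^sup>2 * sqrt (real k) / (real n * l)"
    by (rule main(2)) (fact noise[unfolded L_def])
  define Q where "Q = sqrt (real k * ln (real p / real k) / real n)"
  have lr: "0 < ln \<rho>" using \<rho> by simp
  have "\<rho> \<le> real p / real k" using k by (simp add: le_divide_eq)
  then have lrp: "ln \<rho> \<le> ln (real p / real k)" using \<rho> by simp
  have "1 \<le> 1 / ln \<rho> * ln (real p / real k)" using lr lrp by (simp add: field_simps)
  then have L2: "L \<le> (1 + 2 / ln \<rho>) * ln (real p / real k)" "1 \<le> 1 / ln \<rho> * ln (real p / real k)"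
    unfolding L_def log_term(1)[OF k(2) kp] using ln_2e_bounds(2) by (auto simp: algebra_simps)
  have 1: "sqrt (real k * L / real n) \<le> sqrt (1 + 2 / ln \<rho>) * Q"
    unfolding Q_def
  proof (rule sqrt_le_sqrt_mult)
    have "real k * L / real n \<le> real k * ((1 + 2 / ln \<rho>) * ln (real p / real k)) / real n"
      using L2(1) by (intro divide_right_mono mult_left_mono) auto
    then show "real k * L / real n \<le> (1 + 2 / ln \<rho>) * (real k * ln (real p / real k) / real n)" by (simp add: mult_ac)
  qed (use lr in simp)
  have 2: "sqrt (real k / real n) \<le> sqrt (1 / ln \<rho>) * Q"
    unfolding Q_def
  proof (rule sqrt_le_sqrt_mult)
    have "real k * 1 / real n \<le> real k * (1 / ln \<rho> * ln (real p / real k)) / real n"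
      using L2(2) by (intro divide_right_mono mult_left_mono) auto
    then show "real k / real n \<le> 1 / ln \<rho> * (real k * ln (real p / real k) / real n)" by (simp add: mult_ac)
  qed (use lr in simp)
  have "3 * l * sqrt (real k) / \<kappa> = \<alpha> * \<sigma> / \<kappa> * (72 * sqrt D * sqrt (real k * L / real n))"
    unfolding l_eq by (simp add: real_sqrt_mult real_sqrt_divide mult_ac)
  also have "\<dots> \<le> \<alpha> * \<sigma> / \<kappa> * (72 * sqrt D * (sqrt (1 + 2 / ln \<rho>) * Q))"
    using 1 \<alpha> \<sigma> \<kappa> D by (intro mult_left_mono) auto
  finally have A: "3 * l * sqrt (real k) / \<kappa> \<le> \<alpha> * \<sigma> / \<kappa> * (72 * sqrt D * (sqrt (1 + 2 / ln \<rho>) * Q))" .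
  have "16 * \<alpha> * \<sigma>\<^sup>2 * sqrt (real k) / (real n * l) \<le> \<alpha> * \<sigma> / \<kappa> * (2 * sqrt (real k / real n))"
    using \<alpha> \<sigma> \<kappa> \<kappa>1 k(2) n l12 by (intro remainder_bound) auto
  also have "\<dots> \<le> \<alpha> * \<sigma> / \<kappa> * (2 * (sqrt (1 / ln \<rho>) * Q))"
    using 2 \<alpha> \<sigma> \<kappa> by (intro mult_left_mono) auto
  finally have "(\<integral>w. l2_norm (\<beta>h w - \<beta>s) \<partial>M)
      \<le> \<alpha> * \<sigma> / \<kappa> * (72 * sqrt D * (sqrt (1 + 2 / ln \<rho>) * Q)) + \<alpha> * \<sigma> / \<kappa> * (2 * (sqrt (1 / ln \<rho>) * Q))"
    using main2 A by linarith
  also have "\<dots> = (72 * sqrt D * sqrt (1 + 2 / ln \<rho>) + 2 * sqrt (1 / ln \<rho>)) * (\<alpha> * \<sigma> / \<kappa> * Q)"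
    by (simp add: algebra_simps)
  finally show "(\<integral>w. l2_norm (\<beta>h w - \<beta>s) \<partial>M)
      \<le> (72 * sqrt (ln (1 / \<delta>)) * sqrt (1 + 2 / ln \<rho>) + 2 * sqrt (1 / ln \<rho>))
        * (\<alpha> * \<sigma> / \<kappa> * sqrt (real k * ln (real p / real k) / real n))"
    unfolding D_def Q_def .
qed

text \<open>Groups are non-empty, so \<open>\<gamma> * m \<ge> s\<close>, and the rate itself
  dominates the constant part of the logarithm, whatever the ratio of \<open>G\<close> to
  \<open>s\<close>. In the constant, \<open>144 = 3 * 24 * 2\<close>, and
  \<open>14 = 3 * 4 + 2\<close> collects the second part of the penalty level and the
  residual.\<close>

lemma group_lasso_bound:
  assumes \<delta>: "0 < \<delta>" "\<delta> < 1 / 2"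
    and model: "sub_gaussian_linear_model M n p \<sigma> X \<beta>s \<epsilon> y"
    and part: "group_partition p G I"
    and s: "s = card (active_groups G I \<beta>s)" "1 \<le> s"
    and m: "m = (\<Sum>g\<in>active_groups G I \<beta>s. card (I g))" and \<alpha>: "2 \<le> \<alpha>"
    and mu: "AE w in M. (MAX g\<in>{..<G}.
          mu_max (transpose_mat (columns_of (X w) (I g)) * columns_of (X w) (I g))) \<le> real n"
    and \<gamma>: "1 \<le> \<gamma>" "real (largest_groups_size G I s) \<le> \<gamma> * real m"
    and \<kappa>: "0 < \<kappa>" and re: "AE w in M. ereal \<kappa> \<le> group_lasso_re n p G I s \<alpha> (X w)"
    and rv: "random_vec M p \<beta>h"
    and sol: "AE w in M. group_lasso_solution n p G I (group_lasso_lambda n G s m \<sigma> \<alpha> \<gamma> \<delta>)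
          (X w) (y w) (\<beta>h w)"
  shows "integrable M (\<lambda>w. l2_norm (\<beta>h w - \<beta>s))"
    and "(\<integral>w. l2_norm (\<beta>h w - \<beta>s) \<partial>M) \<le> (144 * sqrt (ln (2 / \<delta>)) + 14)
      * (\<alpha> * \<sigma> / \<kappa> * sqrt ((real s * ln (real G / real s) + \<gamma> * real m) / real n))"
proof -
  interpret prob_space M using model by (simp add: sub_gaussian_linear_model_def)
  have n: "n > 0" and \<sigma>: "\<sigma> > 0" and \<beta>s: "\<beta>s \<in> carrier_vec p"
    and Xc: "\<And>w. w \<in> space M \<Longrightarrow> X w \<in> carrier_mat n p"
    using model by (auto simp: sub_gaussian_linear_model_def random_mat_def)
  define J where "J = active_groups G I \<beta>s"
  have J_eq: "J = {g. g < G \<and> I g \<inter> supp \<beta>s \<noteq> {}}" unfolding J_def by (rule active_groups_eq[OF part \<beta>s])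
  have Ip: "I g \<subseteq> {..<p}" "I g \<noteq> {}" if "g < G" for g
    using part that unfolding group_partition_def by blast+
  have Jsub: "J \<subseteq> {..<G}" unfolding J_eq by auto
  have Jsupp: "supp \<beta>s \<subseteq> (\<Union>g\<in>J. I g)"
  proof
    fix j assume j: "j \<in> supp \<beta>s"
    then have "j < p" using \<beta>s by (simp add: supp_def)
    then have "j \<in> (\<Union>g<G. I g)" using part unfolding group_partition_def by simp
    then show "j \<in> (\<Union>g\<in>J. I g)" using j unfolding J_eq by blast
  qed
  have Jc: "card J = s" using s by (simp add: J_def)
  have sG: "s \<le> G" using card_mono[OF finite_lessThan Jsub] Jc by simp
  have sm: "s \<le> m"
  proof -
    have "(\<Sum>g\<in>J. 1) \<le> (\<Sum>g\<in>J. card (I g))"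
    proof (rule sum_mono)
      fix g assume "g \<in> J"
      then have g: "g < G" using Jsub by auto
      then have "finite (I g)" using Ip finite_subset by blast
      then show "1 \<le> card (I g)" using Ip(2)[OF g] by (simp add: Suc_le_eq card_gt_0_iff)
    qed
    then show ?thesis using Jc m by (simp add: J_def)
  qed
  then have sgm: "real s \<le> \<gamma> * real m" using \<gamma>(1) mult_right_mono[of 1 \<gamma> "real m"] by linarith
  define D where "D = ln (2 / \<delta>)"
  define L where "L = ln (2 * real G * exp 1 / real s)"
  define l where "l = group_lasso_lambda n G s m \<sigma> \<alpha> \<gamma> \<delta>"
  define P where "P = \<gamma> * real m"
  have P0: "P > 0" using sgm s by (simp add: P_def)
  have "exp 1 \<le> 2 / \<delta>"
  proof -
    have "exp 1 \<le> (3::real)" by (rule exp_le)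
    also have "3 \<le> 2 / \<delta>" using \<delta> by (simp add: field_simps)
    finally show ?thesis .
  qed
  then have "1 \<le> D" unfolding D_def using \<delta> by (subst ln_ge_iff) auto
  then have sD: "1 \<le> sqrt D" by simp
  have L1: "1 \<le> L" unfolding L_def using log_term[OF s(2) sG] by simp
  have l_eq: "l = 24 * \<alpha> * \<sigma> * (sqrt (L / real n) * sqrt D) + 4 * \<alpha> * \<sigma> * sqrt (P / real s / real n)"
    unfolding l_def group_lasso_lambda_def L_def[symmetric] D_def[symmetric] P_def
    by (simp add: real_sqrt_mult[symmetric] mult_ac)
  have sLn: "sqrt (1 / real n) \<le> sqrt (L / real n)" using L1 n by (simp add: divide_right_mono)
  have "sqrt (1 / real n) * 1 \<le> sqrt (L / real n) * sqrt D"
    using sLn sD L1 by (intro mult_mono) auto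
  then have "24 * \<alpha> * \<sigma> * (sqrt (1 / real n) * 1) \<le> 24 * \<alpha> * \<sigma> * (sqrt (L / real n) * sqrt D)"
    using \<alpha> \<sigma> by (intro mult_left_mono) auto
  moreover have "0 \<le> 4 * \<alpha> * \<sigma> * sqrt (P / real s / real n)" using \<alpha> \<sigma> P0 by simp
  moreover have p12: "0 < 12 * \<alpha> * \<sigma> * sqrt (1 / real n)" using \<alpha> \<sigma> n by simp
  ultimately have l12: "12 * \<alpha> * \<sigma> * sqrt (1 / real n) \<le> l" unfolding l_eq by linarith
  with p12 have l0: "l > 0" by linarith
  have op_w: "\<forall>g<G. \<forall>u. (\<Sum>i<n. (\<Sum>j\<in>I g. X w $$ (i, j) * u j)\<^sup>2) \<le> real n * (\<Sum>j\<in>I g. (u j)\<^sup>2)"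
    if w: "w \<in> space M" and c: "(MAX g\<in>{..<G}.
          mu_max (transpose_mat (columns_of (X w) (I g)) * columns_of (X w) (I g))) \<le> real n" for w
  proof (intro allI impI)
    fix g u assume g: "g < G"
    have "mu_max (transpose_mat (columns_of (X w) (I g)) * columns_of (X w) (I g))
        \<le> (MAX g\<in>{..<G}. mu_max (transpose_mat (columns_of (X w) (I g)) * columns_of (X w) (I g)))"
      using g by (intro Max_ge) auto
    with c have "mu_max (transpose_mat (columns_of (X w) (I g)) * columns_of (X w) (I g)) \<le> real n" by linarith
    then show "(\<Sum>i<n. (\<Sum>j\<in>I g. X w $$ (i, j) * u j)\<^sup>2) \<le> real n * (\<Sum>j\<in>I g. (u j)\<^sup>2)"
      by (rule columns_of_quadratic_bound[OF Xc[OF w] Ip(1)[OF g]])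
  qed
  have op: "AE w in M. \<forall>g<G. \<forall>u. (\<Sum>i<n. (\<Sum>j\<in>I g. X w $$ (i, j) * u j)\<^sup>2) \<le> real n * (\<Sum>j\<in>I g. (u j)\<^sup>2)"
    using AE_space mu by eventually_elim (rule op_w)
  have "AE w in M. \<kappa> \<le> 1"
    using AE_space op re
    by eventually_elim (rule re_constant_le_1[OF Xc part n s(2) sG \<alpha>])
  then have \<kappa>1: "\<kappa> \<le> 1" by simp
  have s2: "sqrt 2 \<le> 3 / 2" by (rule real_le_lsqrt) (auto simp: power2_eq_square)
  \<comment> \<open>The \<open>s\<close> largest groups, with the square roots of the sizes as
    weights; in general these are neither the active groups nor those where the error is
    largest.\<close>
  obtain A where A: "top_set {..<G} (\<lambda>g. sqrt (real (card (I g)))) A" "card A = s"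
    using top_set_exists[of "{..<G}" s] sG by auto
  have Asum: "(\<Sum>g\<in>A. (sqrt (real (card (I g))))\<^sup>2) \<le> P"
  proof -
    have "(\<Sum>g\<in>A. (sqrt (real (card (I g))))\<^sup>2) = real (\<Sum>g\<in>A. card (I g))" by simp
    also have "\<dots> \<le> real (largest_groups_size G I s)"
      using sum_card_le_largest_groups_size[of A G I] A by (simp only: of_nat_le_iff top_set_def)
    finally show ?thesis using \<gamma>(2) by (simp add: P_def)
  qed
  have noise: "(\<Sum>g<G. \<sigma> * (sqrt (2 * real n * L) + sqrt (real n * real (card (I g)))) * r g)
      \<le> 3 / 8 * (real n * l / \<alpha>) * (sqrt (real s) * sqrt (\<Sum>g\<in>T. (r g)\<^sup>2) + (\<Sum>g\<in>{..<G} - T. r g))"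
    if r: "\<And>g. g < G \<Longrightarrow> r g \<ge> 0" and T: "top_set {..<G} r T" "card T = s" for r T
  proof -
    define q b where "q = sqrt (\<Sum>g\<in>T. (r g)\<^sup>2)" and "b = (\<Sum>g\<in>{..<G} - T. r g)"
    have sub: "T \<subseteq> {..<G}" using T by (simp add: top_set_def)
    have q0: "q \<ge> 0" by (simp add: q_def sum_nonneg)
    have b0: "b \<ge> 0" unfolding b_def using r by (intro sum_nonneg) auto
    have R0: "sqrt (real s) * q + b \<ge> 0" using q0 b0 by simp
    have "(\<Sum>g<G. r g) = (\<Sum>g\<in>T. r g) + b"
      unfolding b_def using sum.subset_diff[OF sub finite_lessThan, of r] by simp
    also have "\<dots> \<le> sqrt (real s) * q + b"
      using sum_le_sqrt_card[of T r] r sub T by (auto simp: q_def)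
    finally have tot: "(\<Sum>g<G. r g) \<le> sqrt (real s) * q + b" .
    have "(\<Sum>g<G. sqrt (real (card (I g))) * r g) \<le> sqrt (2 * P) * q + sqrt (P / real s) * b"
      using weighted_sum_bound[OF finite_lessThan T(1) A(1) _ _ r _ Asum] A(2) T(2) s(2)
      by (simp add: q_def b_def)
    also have "sqrt (2 * P) = sqrt 2 * sqrt (P / real s) * sqrt (real s)"
      using s(2) by (simp add: real_sqrt_mult real_sqrt_divide)
    also have "sqrt (P / real s) * b \<le> sqrt 2 * sqrt (P / real s) * b"
      using b0 P0 mult_right_mono[of 1 "sqrt 2" "sqrt (P / real s)"] by (intro mult_right_mono) auto
    finally have wt: "(\<Sum>g<G. sqrt (real (card (I g))) * r g) \<le> sqrt 2 * sqrt (P / real s) * (sqrt (real s) * q + b)"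
      by (simp add: algebra_simps)
    define z where "z = sqrt (real n) * sqrt L"
    have z: "sqrt (2 * real n * L) = sqrt 2 * z" by (simp add: z_def real_sqrt_mult mult.assoc)
    have z0: "z \<ge> 0" using L1 by (simp add: z_def)
    define x where "x = sqrt (real n) * sqrt (P / real s)"
    have x0: "x \<ge> 0" using P0 by (simp add: x_def)
    have "sqrt 2 * z \<le> 3 / 2 * z" using s2 z0 by (rule mult_right_mono)
    moreover have "z * 1 \<le> z * sqrt D" using sD z0 by (rule mult_left_mono)
    moreover have "sqrt 2 * x \<le> 3 / 2 * x" using s2 x0 by (rule mult_right_mono)
    \<comment> \<open>The coefficients \<open>9\<close> and \<open>3 / 2\<close> are
      \<open>3 / 8\<close> of the \<open>24\<close> and \<open>4\<close> in the penalty
      level.\<close>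
    ultimately have "sqrt 2 * z + sqrt 2 * x \<le> 9 * (z * sqrt D) + 3 / 2 * x" using z0 by linarith
    then have "\<sigma> * (sqrt 2 * z + sqrt 2 * x) \<le> \<sigma> * (9 * (z * sqrt D) + 3 / 2 * x)"
      using \<sigma> by (intro mult_left_mono) auto
    also have "\<dots> = 3 / 8 * (real n * l / \<alpha>)"
    proof -
      have "z = real n * sqrt (L / real n)" using n by (simp add: z_def mult_sqrt_divide)
      moreover have "x = real n * sqrt (P / real s / real n)" using n by (simp add: x_def mult_sqrt_divide del: divide_divide_eq_left)
      ultimately show ?thesis unfolding l_eq using \<alpha> by (simp add: field_simps)
    qed
    finally have c: "\<sigma> * (sqrt 2 * z + sqrt 2 * x) \<le> 3 / 8 * (real n * l / \<alpha>)" .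
    have "(\<Sum>g<G. \<sigma> * (sqrt (2 * real n * L) + sqrt (real n * real (card (I g)))) * r g)
        = \<sigma> * (sqrt 2 * z * (\<Sum>g<G. r g) + sqrt (real n) * (\<Sum>g<G. sqrt (real (card (I g))) * r g))"
    proof -
      have "\<sigma> * (sqrt (2 * real n * L) + sqrt (real n * real (card (I g)))) * r g
        = \<sigma> * (sqrt 2 * z * r g) + \<sigma> * (sqrt (real n) * (sqrt (real (card (I g))) * r g))" for g
        unfolding z real_sqrt_mult[of "real n" "real (card (I g))"] by (simp add: algebra_simps)
      then show ?thesis by (simp only: sum.distrib sum_distrib_left[symmetric] distrib_left)
    qed
    also have "\<dots> \<le> \<sigma> * (sqrt 2 * z * (sqrt (real s) * q + b)
        + sqrt (real n) * (sqrt 2 * sqrt (P / real s) * (sqrt (real s) * q + b)))"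
      using tot wt z0 \<sigma> by (intro mult_left_mono add_mono) auto
    also have "\<dots> = \<sigma> * (sqrt 2 * z + sqrt 2 * x) * (sqrt (real s) * q + b)"
      by (simp add: x_def algebra_simps)
    also have "\<dots> \<le> 3 / 8 * (real n * l / \<alpha>) * (sqrt (real s) * q + b)" using c R0 by (rule mult_right_mono)
    finally show ?thesis unfolding q_def b_def .
  qed
  note main = group_lasso_expected_error[OF model part Jsub Jsupp Jc s(2) \<alpha> op \<kappa> re rv sol[folded l_def] l0]
  show "integrable M (\<lambda>w. l2_norm (\<beta>h w - \<beta>s))" by (rule main(1)) (fact noise[unfolded L_def])
  define H where "H = real s * ln (real G / real s) + P"
  have main2: "(\<integral>w. l2_norm (\<beta>h w - \<beta>s) \<partial>M)
      \<le> 3 * l * sqrt (real s) / \<kappa> + 16 * \<alpha> * \<sigma>\<^sup>2 * sqrt (real s) / (real n * l)"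
    by (rule main(2)) (fact noise[unfolded L_def])
  define Q where "Q = sqrt (H / real n)"
  have lG: "0 \<le> real s * ln (real G / real s)" using log_term(2)[OF s(2) sG] by simp
  have "real s * L \<le> real s * (ln (real G / real s) + 2)"
    unfolding L_def log_term(1)[OF s(2) sG] using ln_2e_bounds(2) by (intro mult_left_mono) auto
  \<comment> \<open>Uses \<open>s \<le> P\<close>; the generous \<open>4\<close> has an exact
    root.\<close>
  also have "\<dots> \<le> 4 * H" unfolding H_def using lG sgm P0 by (simp add: P_def algebra_simps)
  finally have sL: "real s * L \<le> 4 * H" .
  have "sqrt (real s * L / real n) \<le> sqrt 4 * Q"
    unfolding Q_def by (rule sqrt_le_sqrt_mult) (use sL n in \<open>simp_all add: divide_right_mono\<close>)
  then have 1: "sqrt (real s * L / real n) \<le> 2 * Q" by simp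
  have 2: "sqrt (real s / real n) \<le> Q" "sqrt (P / real n) \<le> Q"
    unfolding Q_def H_def using lG sgm by (auto simp: P_def divide_right_mono)
  have ls: "l * sqrt (real s) = \<alpha> * \<sigma> * (24 * sqrt D * sqrt (real s * L / real n) + 4 * sqrt (P / real n))"
    unfolding l_eq using s(2) by (simp add: real_sqrt_mult real_sqrt_divide algebra_simps)
  have "3 * l * sqrt (real s) / \<kappa> = \<alpha> * \<sigma> / \<kappa> * (3 * (24 * sqrt D * sqrt (real s * L / real n) + 4 * sqrt (P / real n)))"
    using arg_cong[OF ls, of "\<lambda>x. 3 * x / \<kappa>"] by (simp add: mult_ac)
  also have "\<dots> \<le> \<alpha> * \<sigma> / \<kappa> * (3 * (24 * sqrt D * (2 * Q) + 4 * Q))"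
    using 1 2 \<alpha> \<sigma> \<kappa> sD by (intro mult_left_mono add_mono) auto
  finally have B1: "3 * l * sqrt (real s) / \<kappa> \<le> \<alpha> * \<sigma> / \<kappa> * (3 * (24 * sqrt D * (2 * Q) + 4 * Q))" .
  have "16 * \<alpha> * \<sigma>\<^sup>2 * sqrt (real s) / (real n * l) \<le> \<alpha> * \<sigma> / \<kappa> * (2 * sqrt (real s / real n))"
    using \<alpha> \<sigma> \<kappa> \<kappa>1 s(2) n l12 by (intro remainder_bound) auto
  also have "\<dots> \<le> \<alpha> * \<sigma> / \<kappa> * (2 * Q)" using 2 \<alpha> \<sigma> \<kappa> by (intro mult_left_mono) auto
  finally have "(\<integral>w. l2_norm (\<beta>h w - \<beta>s) \<partial>M)
      \<le> \<alpha> * \<sigma> / \<kappa> * (3 * (24 * sqrt D * (2 * Q) + 4 * Q)) + \<alpha> * \<sigma> / \<kappa> * (2 * Q)"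
    using main2 B1 by linarith
  also have "\<dots> = (144 * sqrt D + 14) * (\<alpha> * \<sigma> / \<kappa> * Q)"
    by (simp add: algebra_simps)
  finally show "(\<integral>w. l2_norm (\<beta>h w - \<beta>s) \<partial>M) \<le> (144 * sqrt (ln (2 / \<delta>)) + 14)
      * (\<alpha> * \<sigma> / \<kappa> * sqrt ((real s * ln (real G / real s) + \<gamma> * real m) / real n))"
    unfolding D_def Q_def H_def P_def .
qed

theorem corollary1:
  fixes \<delta> :: real
  assumes "0 < \<delta>" and "\<delta> < 1 / 2"
  shows
    "(\<forall>\<rho>>1. \<exists>C>0. \<forall>(M :: 'w measure) n p \<sigma> X \<beta>s \<epsilon> y \<alpha> \<kappa> \<beta>h k.
       sub_gaussian_linear_model M n p \<sigma> X \<beta>s \<epsilon> y \<longrightarrow>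
       k = card (supp \<beta>s) \<longrightarrow> 1 \<le> k \<longrightarrow> \<rho> * real k \<le> real p \<longrightarrow>
       2 \<le> \<alpha> \<longrightarrow>
       (AE w in M. \<forall>j<p. l2_norm (col (X w) j) \<le> sqrt (real n)) \<longrightarrow>
       0 < \<kappa> \<longrightarrow> (AE w in M. ereal \<kappa> \<le> lasso_re n p k \<alpha> (X w)) \<longrightarrow>
       random_vec M p \<beta>h \<longrightarrow>
       (AE w in M. lasso_solution n p (lasso_lambda n p k \<sigma> \<alpha> \<delta>) (X w) (y w) (\<beta>h w)) \<longrightarrow>
       integrable M (\<lambda>w. l2_norm (\<beta>h w - \<beta>s)) \<and>
       (\<integral>w. l2_norm (\<beta>h w - \<beta>s) \<partial>M)
         \<le> C * (\<alpha> * \<sigma> / \<kappa> * sqrt (real k * ln (real p / real k) / real n)))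
     \<and>
     (\<exists>C>0. \<forall>(M :: 'w measure) n p \<sigma> X \<beta>s \<epsilon> y \<alpha> \<kappa> \<beta>h G I s m \<gamma>.
       sub_gaussian_linear_model M n p \<sigma> X \<beta>s \<epsilon> y \<longrightarrow>
       group_partition p G I \<longrightarrow>
       s = card (active_groups G I \<beta>s) \<longrightarrow> 1 \<le> s \<longrightarrow>
       m = (\<Sum>g\<in>active_groups G I \<beta>s. card (I g)) \<longrightarrow>
       2 \<le> \<alpha> \<longrightarrow>
       (AE w in M. (MAX g\<in>{..<G}.
          mu_max (transpose_mat (columns_of (X w) (I g)) * columns_of (X w) (I g))) \<le> real n) \<longrightarrow>
       1 \<le> \<gamma> \<longrightarrow> real (largest_groups_size G I s) \<le> \<gamma> * real m \<longrightarrow>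
       0 < \<kappa> \<longrightarrow> (AE w in M. ereal \<kappa> \<le> group_lasso_re n p G I s \<alpha> (X w)) \<longrightarrow>
       random_vec M p \<beta>h \<longrightarrow>
       (AE w in M. group_lasso_solution n p G I (group_lasso_lambda n G s m \<sigma> \<alpha> \<gamma> \<delta>)
          (X w) (y w) (\<beta>h w)) \<longrightarrow>
       integrable M (\<lambda>w. l2_norm (\<beta>h w - \<beta>s)) \<and>
       (\<integral>w. l2_norm (\<beta>h w - \<beta>s) \<partial>M)
         \<le> C * (\<alpha> * \<sigma> / \<kappa>
                * sqrt ((real s * ln (real G / real s) + \<gamma> * real m) / real n)))"
proof (intro conjI allI impI)
  fix \<rho> :: real assume \<rho>: "1 < \<rho>"
  let ?C = "72 * sqrt (ln (1 / \<delta>)) * sqrt (1 + 2 / ln \<rho>) + 2 * sqrt (1 / ln \<rho>)"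
  show "\<exists>C>0. \<forall>(M :: 'w measure) n p \<sigma> X \<beta>s \<epsilon> y \<alpha> \<kappa> \<beta>h k.
       sub_gaussian_linear_model M n p \<sigma> X \<beta>s \<epsilon> y \<longrightarrow>
       k = card (supp \<beta>s) \<longrightarrow> 1 \<le> k \<longrightarrow> \<rho> * real k \<le> real p \<longrightarrow>
       2 \<le> \<alpha> \<longrightarrow>
       (AE w in M. \<forall>j<p. l2_norm (col (X w) j) \<le> sqrt (real n)) \<longrightarrow>
       0 < \<kappa> \<longrightarrow> (AE w in M. ereal \<kappa> \<le> lasso_re n p k \<alpha> (X w)) \<longrightarrow>
       random_vec M p \<beta>h \<longrightarrow>
       (AE w in M. lasso_solution n p (lasso_lambda n p k \<sigma> \<alpha> \<delta>) (X w) (y w) (\<beta>h w)) \<longrightarrow>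
       integrable M (\<lambda>w. l2_norm (\<beta>h w - \<beta>s)) \<and>
       (\<integral>w. l2_norm (\<beta>h w - \<beta>s) \<partial>M)
         \<le> C * (\<alpha> * \<sigma> / \<kappa> * sqrt (real k * ln (real p / real k) / real n))"
  proof (intro exI[of _ ?C] conjI allI impI, goal_cases)
    case 1
    show ?case using assms \<rho> by (intro add_nonneg_pos mult_nonneg_nonneg) auto
  next
    case 2
    then show ?case by (rule lasso_bound(1)[OF assms \<rho>])
  next
    case 3
    then show ?case by (rule lasso_bound(2)[OF assms \<rho>])
  qed
next
  let ?C = "144 * sqrt (ln (2 / \<delta>)) + 14"
  show "\<exists>C>0. \<forall>(M :: 'w measure) n p \<sigma> X \<beta>s \<epsilon> y \<alpha> \<kappa> \<beta>h G I s m \<gamma>.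
       sub_gaussian_linear_model M n p \<sigma> X \<beta>s \<epsilon> y \<longrightarrow>
       group_partition p G I \<longrightarrow>
       s = card (active_groups G I \<beta>s) \<longrightarrow> 1 \<le> s \<longrightarrow>
       m = (\<Sum>g\<in>active_groups G I \<beta>s. card (I g)) \<longrightarrow>
       2 \<le> \<alpha> \<longrightarrow>
       (AE w in M. (MAX g\<in>{..<G}.
          mu_max (transpose_mat (columns_of (X w) (I g)) * columns_of (X w) (I g))) \<le> real n) \<longrightarrow>
       1 \<le> \<gamma> \<longrightarrow> real (largest_groups_size G I s) \<le> \<gamma> * real m \<longrightarrow>
       0 < \<kappa> \<longrightarrow> (AE w in M. ereal \<kappa> \<le> group_lasso_re n p G I s \<alpha> (X w)) \<longrightarrow>
       random_vec M p \<beta>h \<longrightarrow>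
       (AE w in M. group_lasso_solution n p G I (group_lasso_lambda n G s m \<sigma> \<alpha> \<gamma> \<delta>)
          (X w) (y w) (\<beta>h w)) \<longrightarrow>
       integrable M (\<lambda>w. l2_norm (\<beta>h w - \<beta>s)) \<and>
       (\<integral>w. l2_norm (\<beta>h w - \<beta>s) \<partial>M)
         \<le> C * (\<alpha> * \<sigma> / \<kappa>
                * sqrt ((real s * ln (real G / real s) + \<gamma> * real m) / real n))"
  proof (intro exI[of _ ?C] conjI allI impI, goal_cases)
    case 1
    show ?case using assms by (intro add_nonneg_pos mult_nonneg_nonneg) auto
  next
    case 2
    then show ?case by (rule group_lasso_bound(1)[OF assms])
  next
    case 3
    then show ?case by (rule group_lasso_bound(2)[OF assms])
  qed
qed

end
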